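(* Let $q$ be a power of $2$ and $n\ge 1$. (1) The number of involutions in $O^+(2n,q)$ is equal to $$\sum_{\substack{0\le r\le n\\ r \text{ even}}} \frac{|O^+(2n,q)|}{A_r^+} + \sum_{\substack{1\le r\le n\\ r \text{ even}}} \frac{|O^+(2n,q)|}{B_r} + \sum_{\substack{1\le r\le n\\ r \text{ odd}}} \frac{|O^+(2n,q)|}{C_r}.$$ (2) The number of involutions in $O^-(2n,q)$ is equal to $$\sum_{\substack{0\le r\le n-1\\ r \text{ even}}} \frac{|O^-(2n,q)|}{A_r^-} + \sum_{\substack{1\le r\le n\\ r \text{ even}}} \frac{|O^-(2n,q)|}{B_r} + \sum_{\substack{1\le r\le n\\ r \text{ odd}}} \frac{|O^-(2n,q)|}{C_r}.$$ Here $$A_r^{\pm} = q^{r(r-1)/2+r(2n-2r)}\, |Sp(r,q)|\, |O^{\pm}(2n-2r,q)|,$$ $$B_r = 2q^{r(r+1)/2+(r-1)(2n-2r)-1}\, |Sp(r-2,q)|\, |Sp(2n-2r,q)|,$$ $$C_r = 2q^{r(r-1)/2+(r-1)(2n-2r)}\, |Sp(r-1,q)|\, |Sp(2n-2r,q)|.$$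
   Context: $Sp(2m,q)$ is the symplectic group of a nondegenerate alternating form on the $2m$-dimensional vector space over $\mathbb{F}_q$, of order $|Sp(2m,q)|=q^{m^2}\prod_{i=1}^m (q^{2i}-1)$, with $|Sp(0,q)|=1$. $O^{\pm}(2m,q)$ are the stabilizers (full isometry groups) of the two types of nondegenerate quadratic forms $\nu$ on a $2m$-dimensional vector space over $\mathbb{F}_q$ (nondegenerate meaning that the associated alternating form $(v,w)=\nu(v+w)+\nu(v)+\nu(w)$ is nondegenerate); $O^+(2m,q)$ corresponds to the forms having totally singular subspaces of dimension $m$, and $O^-(2m,q)$ to the forms whose totally singular subspaces have dimension at most $m-1$. For $m\ge1$, $|O^{\pm}(2m,q)|=\frac{2q^{m^2-m}}{q^m\pm 1}\prod_{i=1}^m (q^{2i}-1)$, and $|O^+(0,q)|=1$. "Involution" means an element $g$ with $g^2=1$ (the identity is counted; it corresponds to the $r=0$ term). *)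

theory Defs
  imports "Jordan_Normal_Form.VS_Connect"
begin

text \<open>
  The \<open>d\<close>-dimensional space over the finite field \<open>'a\<close> is \<open>carrier_vec d\<close>, and groups of linear maps
  are groups of \<open>d\<close> by \<open>d\<close> matrices acting by \<open>*\<^sub>v\<close>.  Dimensions are natural
  numbers, not types, since several of them occur together in one formula.  Forms are functions on
  \<open>'a vec\<close>; only their values on \<open>carrier_vec d\<close> matter.
\<close>

definition bilinear_form :: "nat \<Rightarrow> ('a::field vec \<Rightarrow> 'a vec \<Rightarrow> 'a) \<Rightarrow> bool" where
  "bilinear_form d \<beta> \<longleftrightarrow>
     (\<forall>u\<in>carrier_vec d. \<forall>v\<in>carrier_vec d. \<forall>w\<in>carrier_vec d.
        \<beta> (u + v) w = \<beta> u w + \<beta> v w \<and> \<beta> w (u + v) = \<beta> w u + \<beta> w v) \<and>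
     (\<forall>c. \<forall>v\<in>carrier_vec d. \<forall>w\<in>carrier_vec d.
        \<beta> (c \<cdot>\<^sub>v v) w = c * \<beta> v w \<and> \<beta> v (c \<cdot>\<^sub>v w) = c * \<beta> v w)"

definition alternating_form :: "nat \<Rightarrow> ('a::field vec \<Rightarrow> 'a vec \<Rightarrow> 'a) \<Rightarrow> bool" where
  "alternating_form d \<beta> \<longleftrightarrow> bilinear_form d \<beta> \<and> (\<forall>v\<in>carrier_vec d. \<beta> v v = 0)"

definition nondegenerate_form :: "nat \<Rightarrow> ('a::field vec \<Rightarrow> 'a vec \<Rightarrow> 'a) \<Rightarrow> bool" where
  "nondegenerate_form d \<beta> \<longleftrightarrow>
     (\<forall>v\<in>carrier_vec d. (\<forall>w\<in>carrier_vec d. \<beta> v w = 0) \<longrightarrow> v = 0\<^sub>v d)"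

definition symplectic_group :: "nat \<Rightarrow> ('a::field vec \<Rightarrow> 'a vec \<Rightarrow> 'a) \<Rightarrow> 'a mat set" where
  "symplectic_group d \<beta> =
     {g \<in> carrier_mat d d. invertible_mat g \<and>
        (\<forall>v\<in>carrier_vec d. \<forall>w\<in>carrier_vec d. \<beta> (g *\<^sub>v v) (g *\<^sub>v w) = \<beta> v w)}"

text \<open>The signs of the associated form are those of characteristic 2.\<close>

definition assoc_form :: "('a::field vec \<Rightarrow> 'a) \<Rightarrow> 'a vec \<Rightarrow> 'a vec \<Rightarrow> 'a" where
  "assoc_form \<nu> v w = \<nu> (v + w) + \<nu> v + \<nu> w"

definition quadratic_form :: "nat \<Rightarrow> ('a::field vec \<Rightarrow> 'a) \<Rightarrow> bool" where
  "quadratic_form d \<nu> \<longleftrightarrow>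
     (\<forall>c. \<forall>v\<in>carrier_vec d. \<nu> (c \<cdot>\<^sub>v v) = c\<^sup>2 * \<nu> v) \<and> bilinear_form d (assoc_form \<nu>)"

definition nondegenerate_quadratic_form :: "nat \<Rightarrow> ('a::field vec \<Rightarrow> 'a) \<Rightarrow> bool" where
  "nondegenerate_quadratic_form d \<nu> \<longleftrightarrow>
     quadratic_form d \<nu> \<and> nondegenerate_form d (assoc_form \<nu>)"

definition totally_singular_subspace :: "nat \<Rightarrow> ('a::field vec \<Rightarrow> 'a) \<Rightarrow> 'a vec set \<Rightarrow> bool" where
  "totally_singular_subspace d \<nu> W \<longleftrightarrow>
     VectorSpace.subspace class_ring W (module_vec TYPE('a) d) \<and> (\<forall>w\<in>W. \<nu> w = 0)"

definition subspace_dim :: "nat \<Rightarrow> 'a::field vec set \<Rightarrow> nat" where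
  "subspace_dim d W = vectorspace.dim class_ring ((module_vec TYPE('a) d)\<lparr>carrier := W\<rparr>)"

text \<open>
  In dimension \<open>d = 2 * m\<close>, the conditions \<open>2 * subspace_dim d W = d\<close> and
  \<open>2 * subspace_dim d W < d\<close> say that \<open>W\<close> has dimension \<open>m\<close> and at most
  \<open>m - 1\<close> (with integer subtraction), respectively.
\<close>

definition plus_type :: "nat \<Rightarrow> ('a::field vec \<Rightarrow> 'a) \<Rightarrow> bool" where
  "plus_type d \<nu> \<longleftrightarrow> nondegenerate_quadratic_form d \<nu> \<and>
     (\<exists>W. totally_singular_subspace d \<nu> W \<and> 2 * subspace_dim d W = d)"

definition minus_type :: "nat \<Rightarrow> ('a::field vec \<Rightarrow> 'a) \<Rightarrow> bool" where
  "minus_type d \<nu> \<longleftrightarrow> nondegenerate_quadratic_form d \<nu> \<and>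
     (\<forall>W. totally_singular_subspace d \<nu> W \<longrightarrow> 2 * subspace_dim d W < d)"

definition orthogonal_group :: "nat \<Rightarrow> ('a::field vec \<Rightarrow> 'a) \<Rightarrow> 'a mat set" where
  "orthogonal_group d \<nu> =
     {g \<in> carrier_mat d d. invertible_mat g \<and> (\<forall>v\<in>carrier_vec d. \<nu> (g *\<^sub>v v) = \<nu> v)}"

definition involutions :: "nat \<Rightarrow> 'a::field mat set \<Rightarrow> 'a mat set" where
  "involutions d G = {g \<in> G. g * g = 1\<^sub>m d}"

text \<open>
  The arguments \<open>sp\<close> and \<open>ort\<close> map a dimension \<open>d\<close> to the order of \<open>Sp(d,q)\<close> and of
  \<open>O(d,q)\<close> of the relevant type, respectively.  The subtractions are never truncated for
  the \<open>r\<close> that are used: \<open>r \<le> n\<close> throughout, \<open>r \<ge> 2\<close> in \<open>B_coeff\<close> and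
  \<open>r \<ge> 1\<close> in \<open>C_coeff\<close>.
\<close>

definition A_coeff :: "nat \<Rightarrow> nat \<Rightarrow> (nat \<Rightarrow> nat) \<Rightarrow> (nat \<Rightarrow> nat) \<Rightarrow> nat \<Rightarrow> nat" where
  "A_coeff q n sp ort r =
     q ^ (r * (r - 1) div 2 + r * (2 * n - 2 * r)) * sp r * ort (2 * n - 2 * r)"

definition B_coeff :: "nat \<Rightarrow> nat \<Rightarrow> (nat \<Rightarrow> nat) \<Rightarrow> nat \<Rightarrow> nat" where
  "B_coeff q n sp r =
     2 * q ^ (r * (r + 1) div 2 + (r - 1) * (2 * n - 2 * r) - 1) * sp (r - 2) * sp (2 * n - 2 * r)"

definition C_coeff :: "nat \<Rightarrow> nat \<Rightarrow> (nat \<Rightarrow> nat) \<Rightarrow> nat \<Rightarrow> nat" where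
  "C_coeff q n sp r =
     2 * q ^ (r * (r - 1) div 2 + (r - 1) * (2 * n - 2 * r)) * sp (r - 1) * sp (2 * n - 2 * r)"

end

theory Submission
  imports Defs "HOL-Library.Function_Algebras"
begin

text \<open>
  Write an involution as \<open>g = 1 + N\<close>.  Then \<open>N\<^sup>2 = 0\<close>, the image \<open>W\<close> of \<open>N\<close> is totally isotropic,
  and \<open>c (N x) (N y) = B x (N y)\<close> defines a nondegenerate symmetric form on \<open>W\<close> with
  \<open>c w w = \<nu> w\<close>; conversely, \<open>N\<close> is determined by \<open>W\<close> and \<open>c\<close>.  Let \<open>r\<close> be the dimension of \<open>W\<close>.
  Three kinds of tuples in \<open>V\<close> arise as bases of \<open>W\<close> that are standard for \<open>c\<close>.
  If \<open>\<nu> = 0\<close> on \<open>W\<close>, then \<open>c\<close> is alternating, and the bases are the hyperbolic ones.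
  Otherwise \<open>\<nu> w = (c u w)\<^sup>2\<close> on \<open>W\<close> for a unique \<open>u\<close>; a basis consists of \<open>u\<close> and a hyperbolic
  basis of its orthogonal complement if \<open>c u u = 1\<close> (\<open>r\<close> odd), and of \<open>u\<close>, some \<open>f\<close> with
  \<open>c u f = 1\<close> and a hyperbolic basis of their complement if \<open>c u u = 0\<close> (\<open>r\<close> even).
  So the number of involutions of each kind is the number of such tuples, all of which
  are totally singular up to at most one vector and are counted one vector at a time, divided by
  the number of standard bases of \<open>c\<close>, which is the order of a symplectic group up to a power of
  \<open>q\<close>.  The orders of the symplectic and orthogonal groups are computed by counting the same
  kind of bases of \<open>V\<close>, with the type of \<open>\<nu>\<close> read off from its number of singular vectors.
\<close>

section \<open>Finite vector spaces of characteristic 2\<close>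

text \<open>The counting works because the tuples carry no hidden condition. Starting from
  \<open>N\<close>, a basis of \<open>W\<close> has to be standard for \<open>c\<close>. Conversely,
  take any linearly independent totally singular list of even length: the formula that expands
  \<open>N\<close> in a hyperbolic basis already defines a map of square 0, and the form
  \<open>c\<close> belonging to that map makes the list hyperbolic. The two nonsingular kinds behave
  in the same way. So the standard bases of all forms of one kind and rank are together all tuples
  of that kind in \<open>V\<close>, and these can be counted without knowing a single involution.
  Group orders enter only as numbers of bases; identities between such counts take the place of
  orbit-stabilizer arguments. In the even nonsingular case \<open>u\<close> is determined by
  \<open>N\<close> but \<open>f\<close> is not; its \<open>q ^ (r - 1)\<close> choices explain the
  irregular exponent in \<open>B_coeff\<close>.\<close>

lemma card_fibres_const:
  assumes "finite A" and "finite B" and "f ` A \<subseteq> B" and "\<And>b. b \<in> B \<Longrightarrow> card {a \<in> A. f a = b} = k"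
  shows "card A = card B * k"
proof -
  have "A = (\<Union>b\<in>B. {a \<in> A. f a = b})" using assms(3) by auto
  then have "card A = (\<Sum>b\<in>B. card {a \<in> A. f a = b})"
    using card_UN_disjoint[OF assms(2), of "\<lambda>b. {a \<in> A. f a = b}"] assms(1) by auto
  then show ?thesis using assms(4) by simp
qed

text \<open>The set \<open>S a\<close> of continuations may vary with \<open>a\<close>; only its
  size is fixed. The function \<open>g\<close> stands for consing, in whichever order the parts of
  the list are chosen.\<close>

lemma card_Cons_image:
  assumes "finite A" and "\<And>a. a \<in> A \<Longrightarrow> finite (S a)" and "\<And>a. a \<in> A \<Longrightarrow> card (S a) = k"
    and inj: "\<And>a x b y. a \<in> A \<Longrightarrow> b \<in> A \<Longrightarrow> x \<in> S a \<Longrightarrow> y \<in> S b \<Longrightarrow> g a x = g b y \<Longrightarrow> a = b \<and> x = y"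
  shows "card {g a x | a x. a \<in> A \<and> x \<in> S a} = card A * k"
proof -
  have "{g a x | a x. a \<in> A \<and> x \<in> S a} = (\<lambda>(a, x). g a x) ` (SIGMA a:A. S a)" by auto
  moreover have "inj_on (\<lambda>(a, x). g a x) (SIGMA a:A. S a)"
    using inj by (auto simp: inj_on_def)
  ultimately have "card {g a x | a x. a \<in> A \<and> x \<in> S a} = card (SIGMA a:A. S a)"
    by (simp add: card_image)
  also have "\<dots> = (\<Sum>a\<in>A. card (S a))" using assms by simp
  finally show ?thesis using assms by simp
qed

locale char2_space = vector_space scale
  for scale :: "'a::{field,finite} \<Rightarrow> 'b::ab_group_add \<Rightarrow> 'b" (infixr "*s" 75) +
  fixes q :: nat
  assumes one_plus_one: "(1::'a) + 1 = 0"
    and card_field: "card (UNIV :: 'a set) = q"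
begin

lemma self_add [simp]: "(x::'a) + x = 0"
  by (metis one_plus_one distrib_left mult.right_neutral mult_zero_right)

lemma self_add_left [simp]: "(x::'a) + (x + y) = y"
  by (simp add: add.assoc[symmetric])

lemma vself_add [simp]: "(x::'b) + x = 0"
  by (metis one_plus_one scale_left_distrib scale_one scale_zero_left)

lemma vself_add_left [simp]: "(x::'b) + (x + y) = y"
  by (simp add: add.assoc[symmetric])

lemma add_eq_0: "(x::'a) + y = 0 \<longleftrightarrow> x = y"
  by (metis self_add self_add_left add.right_neutral)

lemma vadd_eq_0: "(x::'b) + y = 0 \<longleftrightarrow> x = y"
  by (metis vself_add vself_add_left add.right_neutral)

lemma q_ge_2: "q \<ge> 2"
  using card_mono[of UNIV "{0::'a, 1}"] card_field by simp

lemma q_pos [simp]: "q > 0" "q \<noteq> 0" using q_ge_2 by linarith+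

lemma q_power_inject [simp]: "q ^ i = q ^ j \<longleftrightarrow> i = j"
  using q_ge_2 by (simp add: power_inject_exp)

lemma sq_add: "((x::'a) + y)\<^sup>2 = x\<^sup>2 + y\<^sup>2"
proof -
  have "(x + y)\<^sup>2 = x\<^sup>2 + y\<^sup>2 + (x * y + x * y)" by (simp add: power2_eq_square algebra_simps)
  then show ?thesis by simp
qed

lemma sq_inj: "(x::'a)\<^sup>2 = y\<^sup>2 \<longleftrightarrow> x = y"
  using sq_add[of x y] add_eq_0 by (metis power_eq_0_iff zero_neq_numeral)

lemma sq_surj: "\<exists>y::'a. y\<^sup>2 = x"
proof -
  have "inj (\<lambda>y::'a. y\<^sup>2)" by (simp add: inj_def sq_inj)
  then have "surj (\<lambda>y::'a. y\<^sup>2)" by (simp add: finite_UNIV_inj_surj)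
  then show ?thesis by (metis surjD)
qed

text \<open>Translation by a vector of value \<open>a + b\<close> carries the fibre over
  \<open>a\<close> into the fibre over \<open>b\<close>. The map \<open>h\<close> is only additive
  here so that the statement also covers maps homogeneous of degree 2, such as \<open>\<nu>\<close>
  on a totally isotropic subspace.\<close>

lemma card_fibre_surj:
  fixes h :: "'b \<Rightarrow> 'a"
  assumes "finite V" and "subspace V" and add: "\<And>x y. x \<in> V \<Longrightarrow> y \<in> V \<Longrightarrow> h (x + y) = h x + h y"
    and sur: "\<And>t. \<exists>x\<in>V. h x = t"
  shows "q * card {x \<in> V. h x = a} = card V"
proof -
  have le: "card {x \<in> V. h x = a} \<le> card {x \<in> V. h x = b}" for a b
  proof -
    obtain z where z: "z \<in> V" "h z = a + b" using sur by blast
    have "(\<lambda>x. x + z) ` {x \<in> V. h x = a} \<subseteq> {x \<in> V. h x = b}"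
      using z add subspace_add[OF assms(2)] by auto
    moreover have "inj_on (\<lambda>x. x + z) {x \<in> V. h x = a}" by (simp add: inj_on_def)
    ultimately show ?thesis by (intro card_inj_on_le[of "\<lambda>x. x + z"]) (use assms(1) in auto)
  qed
  have "card {x \<in> V. h x = b} = card {x \<in> V. h x = a}" for b by (rule le_antisym[OF le le])
  from card_fibres_const[of V "UNIV::'a set" h, OF assms(1) finite_UNIV subset_UNIV this]
  show ?thesis using card_field by simp
qed

lemma card_fibre_linear:
  fixes h :: "'b \<Rightarrow> 'a"
  assumes "finite V" and "subspace V" and "\<And>x y. x \<in> V \<Longrightarrow> y \<in> V \<Longrightarrow> h (x + y) = h x + h y"
    and sc: "\<And>c x. x \<in> V \<Longrightarrow> h (c *s x) = c * h x" and "\<exists>x\<in>V. h x \<noteq> 0"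
  shows "q * card {x \<in> V. h x = a} = card V"
proof (rule card_fibre_surj[OF assms(1-3)])
  fix t
  obtain z where z: "z \<in> V" "h z \<noteq> 0" using assms(5) by blast
  then have "h ((t / h z) *s z) = t" by (simp add: sc)
  then show "\<exists>x\<in>V. h x = t" using subspace_scale[OF assms(2) z(1)] by (rule bexI)
qed

lemma card_fibre_sq:
  fixes h :: "'b \<Rightarrow> 'a"
  assumes "finite V" and "subspace V" and "\<And>x y. x \<in> V \<Longrightarrow> y \<in> V \<Longrightarrow> h (x + y) = h x + h y"
    and sc: "\<And>c x. x \<in> V \<Longrightarrow> h (c *s x) = c\<^sup>2 * h x" and "\<exists>x\<in>V. h x \<noteq> 0"
  shows "q * card {x \<in> V. h x = a} = card V"
proof (rule card_fibre_surj[OF assms(1-3)])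
  fix t
  obtain z where z: "z \<in> V" "h z \<noteq> 0" using assms(5) by blast
  obtain c where "c\<^sup>2 = t / h z" using sq_surj by blast
  then have "h (c *s z) = t" using z by (simp add: sc)
  then show "\<exists>x\<in>V. h x = t" using subspace_scale[OF assms(2) z(1)] by (rule bexI)
qed

lemma card_span_insert:
  assumes "finite V" and "subspace V" and "w \<notin> V"
  shows "finite (span (insert w V))" and "card (span (insert w V)) = q * card V"
proof -
  have eq: "span (insert w V) = (\<lambda>(c, v). v + c *s w) ` (UNIV \<times> V)"
    (is "_ = ?f ` _")
  proof -
    have spV: "span V = V" using assms(2) by (simp add: span_eq_iff)
    have sp: "span (insert w V) = {x. \<exists>k. x - k *s w \<in> V}" by (simp only: span_insert spV)
    show ?thesis
    proof (intro equalityI subsetI)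
      fix x assume "x \<in> span (insert w V)"
      then obtain k where "x - k *s w \<in> V" using sp by auto
      then show "x \<in> ?f ` (UNIV \<times> V)" by (intro image_eqI[of _ _ "(k, x - k *s w)"]) auto
    next
      fix x assume "x \<in> ?f ` (UNIV \<times> V)"
      then obtain k v where "v \<in> V" "x = v + k *s w" by auto
      then have "x - k *s w \<in> V" by simp
      then show "x \<in> span (insert w V)" using sp by blast
    qed
  qed
  have inj: "inj_on ?f (UNIV \<times> V)"
  proof (clarsimp simp: inj_on_def)
    fix c v c' v' assume v: "v \<in> V" "v' \<in> V" "v + c *s w = v' + c' *s w"
    have "(c - c') *s w = v' - v" using v(3) by (simp add: scale_left_diff_distrib algebra_simps)
    then have "(c - c') *s w \<in> V" using v subspace_diff[OF assms(2)] by simp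
    then have "c = c'" using assms(3) subspace_scale[OF assms(2), of "(c-c') *s w" "inverse (c-c')"]
      by (cases "c = c'") auto
    then show "c = c' \<and> v = v'" using v by simp
  qed
  show "finite (span (insert w V))" unfolding eq using assms(1) by simp
  show "card (span (insert w V)) = q * card V" unfolding eq
    using card_image[OF inj] by (simp add: card_cartesian_product card_field)
qed

lemma span_insert_span: "span (insert w (span S)) = span (insert w S)"
  by (simp only: span_insert span_span)

lemma span_insertE:
  assumes "w \<in> span (insert a S)"
  obtains k y where "w = k *s a + y" "y \<in> span S"
proof -
  obtain k where "w - k *s a \<in> span S" using assms by (auto simp: span_insert)
  then show ?thesis using that[of k "w - k *s a"] by simp
qed

lemma card_span_set:
  "finite (span (set ws)) \<and> card (span (set ws)) \<le> q ^ length ws"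
proof (induction ws)
  case (Cons w ws)
  show ?case
  proof (cases "w \<in> span (set ws)")
    case True
    have "1 * q ^ length ws \<le> q * q ^ length ws" using q_ge_2 by (intro mult_right_mono) auto
    then have "card (span (set ws)) \<le> q * q ^ length ws" using Cons by linarith
    then show ?thesis using True Cons by (simp add: span_redundant)
  next
    case False
    then show ?thesis using card_span_insert[OF _ subspace_span False] Cons by (simp add: span_insert_span)
  qed
qed auto

lemma finite_span_set [simp]: "finite (span (set ws))" using card_span_set by blast

text \<open>Linear independence of a list, in a form that does not depend on the order of the list.\<close>

definition indep :: "'b list \<Rightarrow> bool" where
  "indep ws \<longleftrightarrow> card (span (set ws)) = q ^ length ws"

lemma indep_Nil [simp]: "indep []" by (simp add: indep_def)

lemma indep_Cons: "indep (w # ws) \<longleftrightarrow> w \<notin> span (set ws) \<and> indep ws"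
proof (cases "w \<in> span (set ws)")
  case True
  have "card (span (set ws)) \<noteq> q * q ^ length ws"
  proof -
    have "1 * q ^ length ws < q * q ^ length ws"
      using q_ge_2 by (intro mult_strict_right_mono) auto
    then show ?thesis using card_span_set[of ws] by linarith
  qed
  then show ?thesis using True by (simp add: indep_def span_redundant)
next
  case False
  then show ?thesis using card_span_insert[OF _ subspace_span False] by (simp add: indep_def span_insert_span)
qed

lemma indep_perm: "indep ws \<Longrightarrow> set us = set ws \<Longrightarrow> length us = length ws \<Longrightarrow> indep us"
  by (simp add: indep_def)

lemma exists_indep_list:
  assumes "finite V" and "subspace V"
  shows "\<exists>ws. indep ws \<and> span (set ws) = V"
proof -
  \<comment> \<open>\<open>card V\<close> bounds the length of an independent list in
    \<open>V\<close>, because already \<open>q ^ card V\<close> exceeds \<open>card V\<close>. So a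
    longest such list exists, and it spans.\<close>
  define k where "k = card V"
  have "k < 2 ^ k" by (rule less_exp)
  also have "\<dots> \<le> q ^ k" using q_ge_2 by (rule power_mono) simp
  finally have k: "card V < q ^ k" by (simp add: k_def)
  let ?P = "\<lambda>ws. indep ws \<and> set ws \<subseteq> V"
  have b: "\<forall>ws. ?P ws \<longrightarrow> length ws \<le> k"
  proof (intro allI impI)
    fix ws assume w: "?P ws"
    then have "span (set ws) \<subseteq> V" using span_minimal assms(2) by blast
    then have "q ^ length ws \<le> card V" using w assms(1) card_mono by (metis indep_def)
    then have "q ^ length ws < q ^ k" using k by simp
    then show "length ws \<le> k" using q_ge_2 by (simp add: power_strict_increasing_iff less_imp_le)
  qed
  obtain ws where ws: "?P ws" and mx: "\<And>us. ?P us \<Longrightarrow> length us \<le> length ws"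
  proof -
    have "\<forall>ws. ?P ws \<longrightarrow> length ws < Suc k" using b by (simp add: less_Suc_eq_le)
    from ex_has_greatest_nat[of ?P "[]" length, OF _ this] show ?thesis using that indep_Nil by (metis empty_set empty_subsetI)
  qed
  have "V \<subseteq> span (set ws)"
  proof
    fix v assume v: "v \<in> V"
    show "v \<in> span (set ws)"
    proof (rule ccontr)
      assume "v \<notin> span (set ws)"
      then have "?P (v # ws)" using ws v by (simp add: indep_Cons)
      then show False using mx[of "v # ws"] by simp
    qed
  qed
  moreover have "span (set ws) \<subseteq> V" using ws span_minimal assms(2) by blast
  ultimately show ?thesis using ws by (intro exI[of _ ws] conjI subset_antisym) auto
qed

lemma card_subspace:
  assumes "finite V" and "subspace V"
  obtains k where "card V = q ^ k"
proof -
  obtain ws where "indep ws \<and> span (set ws) = V" using exists_indep_list[OF assms] by blast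
  then show ?thesis using that[of "length ws"] by (auto simp: indep_def)
qed

end

section \<open>Bilinear forms and hyperbolic frames\<close>

locale bilin = char2_space scale q
  for scale :: "'a::{field,finite} \<Rightarrow> 'b::ab_group_add \<Rightarrow> 'b" (infixr "*s" 75) and q :: nat +
  fixes B :: "'b \<Rightarrow> 'b \<Rightarrow> 'a"
  assumes add_l: "B (x + y) z = B x z + B y z"
    and add_r: "B x (y + z) = B x y + B x z"
    and scale_l: "B (c *s x) y = c * B x y"
    and scale_r: "B x (c *s y) = c * B x y"
begin

lemma zero_l [simp]: "B 0 y = 0"
  using scale_l[of 0 0 y] by simp

lemma zero_r [simp]: "B y 0 = 0"
  using scale_r[of y 0 0] by simp

lemmas B_simps = add_l add_r scale_l scale_r

definition nondeg :: "'b set \<Rightarrow> bool" where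
  "nondeg V \<longleftrightarrow> (\<forall>w\<in>V. (\<forall>v\<in>V. B v w = 0) \<longrightarrow> w = 0)"

definition alt :: "'b set \<Rightarrow> bool" where
  "alt V \<longleftrightarrow> (\<forall>v\<in>V. B v v = 0)"

definition perp :: "'b set \<Rightarrow> 'b set \<Rightarrow> 'b set" where
  "perp V S = {v \<in> V. \<forall>w\<in>S. B v w = 0}"

lemma subspace_perp [intro]: "subspace V \<Longrightarrow> subspace (perp V S)"
  by (auto simp: subspace_def perp_def B_simps)

lemma zero_on_span:
  assumes "\<forall>w\<in>S. B v w = 0" "w \<in> span S"
  shows "B v w = 0"
proof -
  have "subspace {w. B v w = 0}" by (auto simp: subspace_def B_simps)
  then have "span S \<subseteq> {w. B v w = 0}" using assms(1) by (intro span_minimal) auto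
  then show ?thesis using assms(2) by auto
qed

lemma perp_span: "perp V (span S) = perp V S"
  unfolding perp_def using zero_on_span span_superset[of S] by blast

lemma alt_sym:
  assumes "alt V" "subspace V" "x \<in> V" "y \<in> V"
  shows "B x y = B y x"
proof -
  have "B (x + y) (x + y) = 0" using assms subspace_add by (auto simp: alt_def)
  then show ?thesis using assms by (auto simp: alt_def B_simps add_eq_0)
qed

text \<open>Both sides of the formula come from counting the pairs \<open>(v, w)\<close> with \<open>B v w = 0\<close>.\<close>

lemma perp_card:
  assumes V: "finite V" "subspace V" and W: "finite W" "subspace W"
    and nd: "\<And>w. w \<in> W \<Longrightarrow> w \<noteq> 0 \<Longrightarrow> \<exists>v\<in>V. B v w \<noteq> 0"
  shows "card (perp V W) * card W = card V"
proof -
  let ?P = "perp V W"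
  have P: "?P \<subseteq> V" by (auto simp: perp_def)
  have a: "q * card {w \<in> W. B v w = 0} = (if v \<in> ?P then q * card W else card W)" if "v \<in> V" for v
  proof (cases "v \<in> ?P")
    case True
    then have "{w \<in> W. B v w = 0} = W" by (auto simp: perp_def)
    then show ?thesis using True by simp
  next
    case False
    then show ?thesis using that
      by (subst card_fibre_linear[OF W, of "B v"]) (auto simp: perp_def B_simps)
  qed
  have b: "q * card {v \<in> V. B v w = 0} = (if w = 0 then q * card V else card V)" if "w \<in> W" for w
  proof (cases "w = 0")
    case True
    then show ?thesis by simp
  next
    case False
    then show ?thesis using nd[OF that]
      by (subst card_fibre_linear[OF V, of "\<lambda>v. B v w"]) (auto simp: B_simps)
  qed
  have "(\<Sum>v\<in>V. card {w \<in> W. B v w = 0}) = (\<Sum>w\<in>W. card {v \<in> V. B v w = 0})"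
    using V W by (intro sum_multicount_gen) auto
  then have "(\<Sum>v\<in>V. q * card {w \<in> W. B v w = 0}) = (\<Sum>w\<in>W. q * card {v \<in> V. B v w = 0})"
    by (simp flip: sum_distrib_left)
  moreover have "(\<Sum>v\<in>V. q * card {w \<in> W. B v w = 0}) = (\<Sum>v\<in>V. if v \<in> ?P then q * card W else card W)"
    by (intro sum.cong refl a)
  moreover have "\<dots> = card ?P * (q * card W) + card (V - ?P) * card W"
    using V P by (subst sum.If_cases) (auto simp: Int_absorb1 Collect_mem_eq Diff_eq)
  moreover have "(\<Sum>w\<in>W. q * card {v \<in> V. B v w = 0}) = (\<Sum>w\<in>W. if w = 0 then q * card V else card V)"
    by (intro sum.cong refl b)
  moreover have "\<dots> = q * card V + card (W - {0}) * card V"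
    using W subspace_0[OF W(2)]
    by (subst sum.remove[of _ 0]) auto
  ultimately have "card ?P * (q * card W) + (card V - card ?P) * card W = q * card V + (card W - 1) * card V"
    using V P W subspace_0[OF W(2)] by (simp add: card_Diff_subset finite_subset)
  moreover have "card ?P \<le> card V" "1 \<le> card W"
    using card_mono[OF V(1) P] W subspace_0[OF W(2)] by (auto simp: Suc_le_eq card_gt_0_iff)
  ultimately have "int (card ?P) * (int q * int (card W)) + (int (card V) - int (card ?P)) * int (card W)
      = int q * int (card V) + (int (card W) - 1) * int (card V)"
    by (smt (verit) of_nat_add of_nat_mult of_nat_diff of_nat_1)
  then have "(int q - 1) * (int (card ?P) * int (card W)) = (int q - 1) * int (card V)"
    by (simp add: algebra_simps)
  then have "int (card ?P) * int (card W) = int (card V)" using q_ge_2 by simp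
  then show ?thesis by (metis of_nat_mult of_nat_eq_iff)
qed

text \<open>By \<open>perp_card\<close>, adjoining \<open>w\<close> to \<open>W\<close> shrinks the
  perp by the factor \<open>q\<close>; a vector lost in this way is scaled.\<close>

lemma separate:
  assumes V: "finite V" "subspace V" and nd: "nondeg V" and W: "subspace W" "W \<subseteq> V"
    and w: "w \<in> V" "w \<notin> W"
  shows "\<exists>v\<in>V. (\<forall>x\<in>W. B v x = 0) \<and> B v w = 1"
proof -
  have fW: "finite W" using V W finite_subset by blast
  let ?W = "span (insert w W)"
  have sW: "?W \<subseteq> V" using w W V by (intro span_minimal) auto
  have ex: "\<exists>v\<in>V. B v x \<noteq> 0" if "x \<in> V" "x \<noteq> 0" for x
    using nd that by (auto simp: nondeg_def)
  have 1: "card (perp V W) * card W = card V"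
    using V W fW ex by (intro perp_card) auto
  have 2: "card (perp V ?W) * card ?W = card V"
    using V sW ex finite_subset[OF sW] by (intro perp_card) auto
  have 3: "card ?W = q * card W" "finite ?W" using card_span_insert[OF fW W(1) w(2)] by auto
  have "card V \<noteq> 0" using V subspace_0[OF V(2)] by auto
  have "perp V W \<noteq> perp V ?W"
  proof
    assume "perp V W = perp V ?W"
    then have "card (perp V W) * (q * card W) = card V" using 2 3 by simp
    moreover have "card (perp V W) * (q * card W) = q * (card (perp V W) * card W)" by simp
    ultimately have "q * card V = card V" using 1 by simp
    then show False using \<open>card V \<noteq> 0\<close> q_ge_2 by simp
  qed
  then obtain v where v: "v \<in> V" "\<forall>x\<in>W. B v x = 0" "B v w \<noteq> 0"
  proof -
    have "perp V W \<noteq> perp V (insert w W)" using \<open>perp V W \<noteq> perp V ?W\<close> by (simp add: perp_span)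
    then show ?thesis using that by (auto simp: perp_def)
  qed
  then show ?thesis
    using subspace_scale[OF V(2) v(1), of "inverse (B v w)"]
    by (intro bexI[of _ "inverse (B v w) *s v"]) (auto simp: B_simps)
qed

text \<open>The tool for reading \<open>N\<close> off a tuple: at such a \<open>v\<close>, a formula
  built from pairings with the tuple keeps only the terms of \<open>w\<close>.\<close>

lemma dual_vector:
  assumes V: "finite V" "subspace V" "nondeg V" and "indep (w # ws)" "set (w # ws) \<subseteq> V"
  shows "\<exists>v\<in>V. B v w = 1 \<and> (\<forall>u\<in>set ws. B v u = 0)"
proof -
  have "w \<notin> span (set ws)" using assms by (simp add: indep_Cons)
  moreover have "span (set ws) \<subseteq> V" using assms by (intro span_minimal) auto
  ultimately obtain v where "v \<in> V" "\<forall>x\<in>span (set ws). B v x = 0" "B v w = 1"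
    using separate[OF V subspace_span, of "set ws" w] assms(5) by auto
  then show ?thesis using span_base by blast
qed

section \<open>Hyperbolic pairs, frames and coordinates with respect to a frame\<close>

fun hyperbolic :: "'b list \<Rightarrow> bool" where
  "hyperbolic [] \<longleftrightarrow> True"
| "hyperbolic [e] \<longleftrightarrow> False"
| "hyperbolic (e # f # ws) \<longleftrightarrow> B e f = 1 \<and> (\<forall>w\<in>set ws. B e w = 0 \<and> B f w = 0) \<and> hyperbolic ws"

definition hpairs :: "'b set \<Rightarrow> ('b \<times> 'b) set" where
  "hpairs V = {(e, f). e \<in> V \<and> f \<in> V \<and> B e f = 1}"

definition hperp :: "'b set \<Rightarrow> 'b \<Rightarrow> 'b \<Rightarrow> 'b set" where
  "hperp V e f = {v \<in> V. B e v = 0 \<and> B f v = 0}"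

definition frames :: "nat \<Rightarrow> 'b set \<Rightarrow> 'b list set" where
  "frames m V = {ws. length ws = 2 * m \<and> set ws \<subseteq> V \<and> hyperbolic ws}"

text \<open>For a hyperbolic list spanning \<open>V\<close> as first argument, \<open>tr\<close> is the linear map that
  takes it to the second list.\<close>

fun tr :: "'b list \<Rightarrow> 'b list \<Rightarrow> 'b \<Rightarrow> 'b" where
  "tr (e # f # ws) (e' # f' # ws') v = B v f *s e' + (B v e *s f' + tr ws ws' v)"
| "tr _ _ v = 0"

lemma frames_0 [simp]: "frames 0 V = {[]}"
  by (auto simp: frames_def)

lemma frames_Suc:
  "frames (Suc m) V = {fst p # snd p # ws | p ws. p \<in> hpairs V \<and> ws \<in> frames m (hperp V (fst p) (snd p))}"
proof (intro equalityI subsetI)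
  fix us assume us: "us \<in> frames (Suc m) V"
  then obtain e f ws where "us = e # f # ws"
    by (auto simp: frames_def numeral_2_eq_2 length_Suc_conv)
  then show "us \<in> {fst p # snd p # ws | p ws. p \<in> hpairs V \<and> ws \<in> frames m (hperp V (fst p) (snd p))}"
    using us by (auto simp: frames_def hpairs_def hperp_def)
next
  fix us assume "us \<in> {fst p # snd p # ws | p ws. p \<in> hpairs V \<and> ws \<in> frames m (hperp V (fst p) (snd p))}"
  then show "us \<in> frames (Suc m) V"
    by (force simp: frames_def hpairs_def hperp_def)
qed

lemma finite_frames: "finite V \<Longrightarrow> finite (frames m V)"
  using finite_lists_length_eq[of V "2 * m"] by (rule finite_subset[rotated]) (auto simp: frames_def)

lemma finite_hpairs: "finite V \<Longrightarrow> finite (hpairs V)"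
  by (rule finite_subset[of _ "V \<times> V"]) (auto simp: hpairs_def)

lemma hperp_sub: "hperp V e f \<subseteq> V"
  by (auto simp: hperp_def)

lemma subspace_hperp: "subspace V \<Longrightarrow> subspace (hperp V e f)"
  by (auto simp: subspace_def hperp_def B_simps)

lemma alt_mono: "alt V \<Longrightarrow> W \<subseteq> V \<Longrightarrow> alt W"
  by (auto simp: alt_def)

text \<open>Orthogonal projection along the plane of \<open>e\<close> and \<open>f\<close>; in
  characteristic 2 the subtraction is an addition.\<close>

lemma hperp_decomp:
  assumes V: "subspace V" "alt V" and p: "(e, f) \<in> hpairs V" and v: "v \<in> V"
  shows "v + (B v f *s e + B v e *s f) \<in> hperp V e f"
proof -
  have "e \<in> V" "f \<in> V" "B e f = 1" using p by (auto simp: hpairs_def)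
  moreover have "B f e = 1" "B e v = B v e" "B f v = B v f" "B e e = 0" "B f f = 0"
    using calculation V v alt_sym[OF V(2,1)] by (auto simp: alt_def)
  ultimately show ?thesis
    using v V by (auto simp: hperp_def B_simps subspace_add subspace_scale)
qed

lemma hperp_nondeg:
  assumes V: "subspace V" "alt V" "nondeg V" and p: "(e, f) \<in> hpairs V"
  shows "nondeg (hperp V e f)"
  unfolding nondeg_def
proof (intro ballI impI)
  fix w assume w: "w \<in> hperp V e f" and h: "\<forall>v\<in>hperp V e f. B v w = 0"
  have "B v w = 0" if "v \<in> V" for v
  proof -
    have "B (v + (B v f *s e + B v e *s f)) w = 0" using h hperp_decomp[OF V(1,2) p that] by blast
    then show ?thesis using w by (simp add: B_simps hperp_def)
  qed
  then show "w = 0" using V(3) w hperp_sub[of V e f] by (auto simp: nondeg_def)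
qed

lemma hperp_card:
  assumes V: "finite V" "subspace V" "alt V" and p: "(e, f) \<in> hpairs V"
  shows "q * (q * card (hperp V e f)) = card V"
proof -
  have ef: "e \<in> V" "f \<in> V" "B e f = 1" "B e e = 0" using p V by (auto simp: hpairs_def alt_def)
  have fe: "B f e = 1" using alt_sym[OF V(3,2)] ef by auto
  let ?U = "{v \<in> V. B e v = 0}"
  have U: "finite ?U" "subspace ?U" using V by (auto simp: subspace_def B_simps)
  have "q * card {v \<in> V. B e v = 0} = card V"
    using V ef by (intro card_fibre_linear) (auto simp: B_simps intro!: bexI[of _ f])
  moreover have "q * card {v \<in> ?U. B f v = 0} = card ?U"
    using ef fe by (intro card_fibre_linear U) (auto simp: B_simps intro!: bexI[of _ e])
  moreover have "{v \<in> ?U. B f v = 0} = hperp V e f" by (auto simp: hperp_def)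
  ultimately show ?thesis by simp
qed

lemma card_hpairs:
  assumes V: "finite V" "subspace V" "alt V" "nondeg V"
  shows "q * card (hpairs V) = (card V - 1) * card V"
proof -
  have eq: "hpairs V = (SIGMA e:V - {0}. {f \<in> V. B e f = 1})"
    by (auto simp: hpairs_def)
  have "q * card {f \<in> V. B e f = 1} = card V" if "e \<in> V - {0}" for e
  proof (rule card_fibre_linear[OF V(1,2)])
    show "\<exists>x\<in>V. B e x \<noteq> 0" using V that alt_sym[OF V(3,2)] unfolding nondeg_def by (metis DiffE singletonI)
  qed (auto simp: B_simps)
  then have "(\<Sum>e\<in>V - {0}. q * card {f \<in> V. B e f = 1}) = (\<Sum>e\<in>V - {0}. card V)" by simp
  then show ?thesis unfolding eq using V subspace_0[OF V(2)] by (simp flip: sum_distrib_left)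
qed

text \<open>The order of the symplectic group in dimension \<open>2 * m\<close>.\<close>

fun spord :: "nat \<Rightarrow> nat" where
  "spord 0 = 1"
| "spord (Suc m) = (q ^ (2 * Suc m) - 1) * q ^ (2 * m + 1) * spord m"

text \<open>The first pair is a nonzero \<open>e\<close> with a point of the affine hyperplane
  \<open>B e f = 1\<close>; the rest is a frame of the complement. The exponents
  \<open>2 * m + 1\<close> are the odd numbers, whose sum is the exponent m^2 in the order of
  Sp(2m,q).\<close>

lemma card_frames:
  assumes "finite V" "subspace V" "alt V" "nondeg V" "card V = q ^ (2 * m)"
  shows "card (frames m V) = spord m"
  using assms
proof (induction m arbitrary: V)
  case (Suc m)
  note V = Suc.prems
  have k: "card (frames m (hperp V (fst p) (snd p))) = spord m" if "p \<in> hpairs V" for p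
  proof -
    obtain e f where ef: "p = (e, f)" "(e, f) \<in> hpairs V" using \<open>p \<in> hpairs V\<close> by (cases p) auto
    have "q * (q * card (hperp V e f)) = q * (q * q ^ (2 * m))" using V hperp_card[OF V(1-3) ef(2)] by simp
    then have "card (hperp V e f) = q ^ (2 * m)" by simp
    then show ?thesis unfolding ef fst_conv snd_conv
      using V ef(2) hperp_sub[of V e f]
      by (intro Suc.IH hperp_nondeg subspace_hperp) (auto intro: finite_subset alt_mono)
  qed
  have "card (frames (Suc m) V) = card (hpairs V) * spord m"
    unfolding frames_Suc
    using V(1) finite_subset[OF hperp_sub]
    by (intro card_Cons_image k finite_hpairs finite_frames) (auto simp: prod_eq_iff)
  moreover have "card (hpairs V) = (q ^ (2 * Suc m) - 1) * q ^ (2 * m + 1)"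
  proof -
    have "q * card (hpairs V) = q * ((q ^ (2 * Suc m) - 1) * q ^ (2 * m + 1))"
      using card_hpairs[OF V(1-4)] V(5) by simp
    then show ?thesis using q_pos(2) by (simp only: mult_cancel1) simp
  qed
  ultimately show ?case by simp
qed simp

lemma spord_pos: "spord m > 0"
proof (induction m)
  case (Suc m)
  have "q ^ (2 * Suc m) > 1" using q_ge_2 by (intro one_less_power) auto
  then have "q ^ (2 * Suc m) - 1 > 0" by linarith
  then show ?case using Suc by (simp only: spord.simps) simp
qed simp

text \<open>One hyperbolic plane is split off at a time. Applied to the form \<open>c\<close> on
  \<open>W\<close> and on parts of it, this decides the parity of the rank of
  \<open>N\<close>.\<close>

lemma alt_card_even:
  assumes "finite V" "subspace V" "alt V" "nondeg V"
  shows "\<exists>m. card V = q ^ (2 * m)"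
  using assms
proof (induction "card V" arbitrary: V rule: less_induct)
  case less
  note V = less.prems
  show ?case
  proof (cases "V = {0}")
    case True
    then show ?thesis by (intro exI[of _ 0]) simp
  next
    case False
    then obtain f where f: "f \<in> V" "f \<noteq> 0" using subspace_0[OF V(2)] by auto
    then obtain e where "e \<in> V" "B e f \<noteq> 0" using V(4) by (auto simp: nondeg_def)
    then have p: "(inverse (B e f) *s e, f) \<in> hpairs V"
      using f V by (auto simp: hpairs_def B_simps subspace_scale)
    let ?U = "hperp V (inverse (B e f) *s e) f"
    have c: "q * (q * card ?U) = card V" using hperp_card[OF V(1-3) p] .
    have "card ?U < card V"
    proof (rule psubset_card_mono[OF V(1)])
      have "f \<notin> ?U" using p by (simp add: hperp_def hpairs_def)
      then show "?U \<subset> V" using f hperp_sub[of V] by blast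
    qed
    then obtain m where "card ?U = q ^ (2 * m)"
      using less.hyps[of ?U] V hperp_nondeg[OF V(2-4) p] subspace_hperp finite_subset[OF hperp_sub V(1)]
        alt_mono[OF V(3) hperp_sub] by blast
    then show ?thesis using c by (intro exI[of _ "Suc m"]) simp
  qed
qed

text \<open>\<open>tr\<close> sees \<open>v\<close> only through its pairings with
  \<open>ws\<close>. Hence \<open>v\<close> may be replaced by its projection to \<open>V\<close> or
  to a hyperbolic complement.\<close>

lemma tr_cong:
  assumes "\<forall>w\<in>set ws. B v w = B v' w"
  shows "tr ws us v = tr ws us v'"
  using assms by (induction ws us v rule: tr.induct) auto

lemma tr_id:
  assumes "finite V" "subspace V" "alt V" "nondeg V" "card V = q ^ (2 * m)" "ws \<in> frames m V" "v \<in> V"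
  shows "tr ws ws v = v"
  using assms
proof (induction m arbitrary: V ws v)
  case 0
  then have "V = {0}" using subspace_0[OF 0(2)] by (auto simp: card_1_singleton_iff)
  then show ?case using 0 by simp
next
  case (Suc m)
  note V = Suc.prems
  obtain e f us where ws: "ws = e # f # us" and p: "(e, f) \<in> hpairs V" and us: "us \<in> frames m (hperp V e f)"
    using V(6) unfolding frames_Suc by auto
  let ?U = "hperp V e f" and ?u = "v + (B v f *s e + B v e *s f)"
  have "q * (q * card ?U) = q * (q * q ^ (2 * m))" using V hperp_card[OF V(1-3) p] by simp
  then have c: "card ?U = q ^ (2 * m)" by simp
  have u: "?u \<in> ?U" using hperp_decomp V p by blast
  have "tr us us ?u = ?u"
    using V us p u c hperp_sub[of V e f]
    by (intro Suc.IH[of ?U] hperp_nondeg subspace_hperp) (auto intro: finite_subset alt_mono)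
  moreover have "tr us us ?u = tr us us v"
    using us by (intro tr_cong) (auto simp: B_simps frames_def hperp_def)
  ultimately have "tr us us v = ?u" by simp
  then show ?case using ws by (simp add: ac_simps)
qed

lemma tr_add: "tr ws us (v + w) = tr ws us v + tr ws us w"
  by (induction ws us v rule: tr.induct) (auto simp: B_simps scale_left_distrib ac_simps)

lemma tr_scale: "tr ws us (c *s v) = c *s tr ws us v"
  by (induction ws us v rule: tr.induct) (auto simp: B_simps scale_right_distrib ac_simps)

lemma tr_span: "tr ws us v \<in> span (set us)"
proof (induction ws us v rule: tr.induct)
  case (1 e f ws e' f' us v)
  have "span (set us) \<subseteq> span (set (e' # f' # us))" by (intro span_mono) auto
  then have "tr ws us v \<in> span (set (e' # f' # us))" using 1 by blast
  moreover have "e' \<in> span (set (e' # f' # us))" "f' \<in> span (set (e' # f' # us))" by (auto intro: span_base)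
  ultimately show ?case by (simp only: tr.simps) (intro span_add span_scale)
qed (auto simp: span_zero)

end

section \<open>Isometry groups\<close>

text \<open>The parameter \<open>\<kappa>\<close> covers both kinds of isometry groups: it is \<open>1\<close> for a
  quadratic form \<open>\<nu>\<close> with polar form \<open>B\<close>, and \<open>0\<close> with \<open>\<nu> = 0\<close> in the symplectic case.
  Linear maps on \<open>V\<close> are represented by linear maps \<open>g\<close> on the whole type with
  \<open>g \<circ> \<pi> = g\<close> for a fixed projection \<open>\<pi>\<close> onto \<open>V\<close>.\<close>

locale isometry_space = bilin scale q B
  for scale :: "'a::{field,finite} \<Rightarrow> 'b::ab_group_add \<Rightarrow> 'b" (infixr "*s" 75) and q :: nat
    and B :: "'b \<Rightarrow> 'b \<Rightarrow> 'a" +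
  fixes \<nu> :: "'b \<Rightarrow> 'a" and \<kappa> :: 'a and V :: "'b set" and \<pi> :: "'b \<Rightarrow> 'b"
  assumes nu_add': "\<nu> (x + y) = \<nu> x + \<nu> y + \<kappa> * B x y"
    and nu_scale': "\<nu> (c *s x) = c\<^sup>2 * \<nu> x"
    and B_self: "B x x = 0"
    and finV: "finite V" and subV: "subspace V" and ndV: "nondeg V"
    and pi_add: "\<pi> (x + y) = \<pi> x + \<pi> y" and pi_scale: "\<pi> (c *s x) = c *s \<pi> x"
    and pi_in: "\<pi> x \<in> V" and pi_id: "x \<in> V \<Longrightarrow> \<pi> x = x"
    and B_pi: "B (\<pi> x) y = B x y" and nu_pi: "\<nu> (\<pi> x) = \<nu> x"
begin

lemma altU: "alt U" by (simp add: alt_def B_self)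

lemma B_sym: "B x y = B y x"
  using alt_sym[OF altU subspace_UNIV] by simp

lemma B_pi_r: "B x (\<pi> y) = B x y"
  by (metis B_sym B_pi)

definition isos :: "('b \<Rightarrow> 'b) set" where
  "isos = {g. (\<forall>x y. g (x + y) = g x + g y) \<and> (\<forall>c x. g (c *s x) = c *s g x) \<and>
     (\<forall>x. g (\<pi> x) = g x) \<and> (\<forall>x. g x \<in> V) \<and>
     (\<forall>x y. B (g x) (g y) = B x y) \<and> (\<forall>x. \<nu> (g x) = \<nu> x)}"

lemma hyperbolic_map:
  assumes "\<And>x y. B (g x) (g y) = B x y" "hyperbolic ws"
  shows "hyperbolic (map g ws)"
  using assms(2) by (induction ws rule: hyperbolic.induct) (auto simp: assms(1))

lemma tr_linear_image:
  assumes "\<And>x y. g (x + y) = g x + g y" "\<And>c x. g (c *s x) = c *s g x"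
  shows "g (tr ws us v) = tr ws (map g us) v"
proof -
  have "g 0 = 0" using assms(1)[of 0 0] by simp
  then show ?thesis by (induction ws us v rule: tr.induct) (auto simp: assms)
qed

lemma tr_0: "tr ws us 0 = 0"
  by (induction ws us "0::'b" rule: tr.induct) auto

lemma map_tr:
  assumes "hyperbolic ws" "length us = length ws"
  shows "map (tr ws us) ws = us"
  using assms
proof (induction ws arbitrary: us rule: hyperbolic.induct)
  case (3 e f ws)
  obtain e' f' vs where us: "us = e' # f' # vs"
    using 3(3) by (auto simp: length_Suc_conv)
  have h: "B e f = 1" "B f e = 1" "B e e = 0" "B f f = 0" using 3 B_sym[of f e] by (auto simp: B_self)
  have "tr (e # f # ws) us w = tr ws vs w" if "w \<in> set ws" for w
    using 3(2) that us B_sym[of w] by simp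
  then have "map (tr (e # f # ws) us) ws = map (tr ws vs) ws" by (intro map_cong refl)
  moreover have "map (tr ws vs) ws = vs" using 3 us by simp
  ultimately have m: "map (tr (e # f # ws) us) ws = vs" by (rule trans)
  have "tr ws vs e = tr ws vs 0" "tr ws vs f = tr ws vs 0"
    using 3 by (auto intro!: tr_cong)
  moreover have "tr ws vs 0 = 0" by (rule tr_0)
  ultimately have "tr (e # f # ws) us e = e'" "tr (e # f # ws) us f = f'" using us h by simp_all
  then show ?case unfolding list.map m using us by simp
qed auto

lemma B_tr_0: "\<forall>w\<in>set us. B x w = 0 \<Longrightarrow> B x (tr ws us v) = 0"
  by (induction ws us v rule: tr.induct) (auto simp: B_simps)

text \<open>The coordinates of \<open>v\<close> come from \<open>ws\<close> alone, and a hyperbolic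
  target list has prescribed pairings, so only the values of \<open>\<nu>\<close> on the target list
  are left to compare.\<close>

lemma tr_nu:
  assumes "hyperbolic us" "hyperbolic us'" "map \<nu> us = map \<nu> us'"
  shows "\<nu> (tr ws us v) = \<nu> (tr ws us' v)"
  using assms
proof (induction ws us v arbitrary: us' rule: tr.induct)
  case (1 e f ws e' f' us v)
  obtain e2 f2 vs where us': "us' = e2 # f2 # vs"
    using 1(4) by (auto simp: Cons_eq_map_conv)
  have "B e' (tr ws us v) = 0" "B f' (tr ws us v) = 0" "B e2 (tr ws vs v) = 0" "B f2 (tr ws vs v) = 0"
    using 1(2,3) us' by (auto intro!: B_tr_0)
  moreover have "\<nu> (tr ws us v) = \<nu> (tr ws vs v)" using 1 us' by auto
  ultimately show ?case using 1 us' by (simp add: nu_add' nu_scale' B_simps)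
next
  case ("2_1" us v)
  then show ?case by simp
next
  case ("2_2" w us v)
  then show ?case by simp
next
  case ("2_3" ws v)
  then have "us' = []" by simp
  then show ?case by simp
next
  case ("2_4" ws w v)
  then show ?case by simp
qed

lemma tr_B:
  assumes "hyperbolic us" "hyperbolic us'" "length us = length us'"
  shows "B (tr ws us v) (tr ws us w) = B (tr ws us' v) (tr ws us' w)"
  using assms
proof (induction ws us v arbitrary: us' rule: tr.induct)
  case (1 e f ws e' f' us v)
  obtain e2 f2 vs where us': "us' = e2 # f2 # vs"
    using 1(4)[symmetric] by (auto simp: length_Suc_conv)
  have "B e' (tr ws us z) = 0" "B f' (tr ws us z) = 0" "B e2 (tr ws vs z) = 0" "B f2 (tr ws vs z) = 0"
    "B (tr ws us z) e' = 0" "B (tr ws us z) f' = 0" "B (tr ws vs z) e2 = 0" "B (tr ws vs z) f2 = 0" for z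
    using 1(2,3) us' by (auto intro!: B_tr_0 simp: B_sym[of "tr _ _ _"])
  moreover have "B (tr ws us v) (tr ws us w) = B (tr ws vs v) (tr ws vs w)" using 1 us' by auto
  moreover have "B f' e' = B e' f'" "B f2 e2 = B e2 f2" by (rule B_sym)+
  ultimately show ?case using 1(2,3) us' by (simp add: B_simps B_self)
next
  case ("2_1" us v)
  then show ?case by simp
next
  case ("2_2" w us v)
  then show ?case by simp
next
  case ("2_3" ws v)
  then have "us' = []" by simp
  then show ?case by simp
next
  case ("2_4" ws w v)
  then show ?case by simp
qed

text \<open>An isometry is determined by the image of a frame, and any frame with the same values of
  \<open>\<nu>\<close> is such an image, under \<open>tr ws0 ws\<close>. This turns group orders
  into numbers of frames.\<close>

lemma card_isos:
  assumes V: "card V = q ^ (2 * m)" and ws0: "ws0 \<in> frames m V"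
  shows "card isos = card {ws \<in> frames m V. map \<nu> ws = map \<nu> ws0}"
proof (rule bij_betw_same_card[of "\<lambda>g. map g ws0"])
  \<comment> \<open>\<open>tr ws0 ws0\<close> is the identity on \<open>V\<close>, and replacing
    \<open>v\<close> by \<open>\<pi> v\<close> does not change the pairings with the frame.\<close>
  have tid: "tr ws0 ws0 v = \<pi> v" for v
  proof -
    have "tr ws0 ws0 v = tr ws0 ws0 (\<pi> v)" by (intro tr_cong) (simp add: B_pi)
    then show ?thesis using tr_id[OF finV subV altU ndV V ws0 pi_in] by simp
  qed
  have ws0': "hyperbolic ws0" "length ws0 = 2 * m" "set ws0 \<subseteq> V" using ws0 by (auto simp: frames_def)
  show "bij_betw (\<lambda>g. map g ws0) isos {ws \<in> frames m V. map \<nu> ws = map \<nu> ws0}"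
  proof (intro bij_betwI')
    fix g h assume g: "g \<in> isos" and h: "h \<in> isos"
    have r: "k x = tr ws0 (map k ws0) x" if "k \<in> isos" for k x
    proof -
      have "k x = k (tr ws0 ws0 x)" using that unfolding tid by (auto simp: isos_def)
      also have "\<dots> = tr ws0 (map k ws0) x" using that by (intro tr_linear_image) (auto simp: isos_def)
      finally show ?thesis .
    qed
    show "(map g ws0 = map h ws0) = (g = h)" using r[OF g] r[OF h] by (metis ext)
  next
    fix g assume g: "g \<in> isos"
    have "hyperbolic (map g ws0)" by (rule hyperbolic_map) (use g ws0' in \<open>auto simp: isos_def\<close>)
    then show "map g ws0 \<in> {ws \<in> frames m V. map \<nu> ws = map \<nu> ws0}"
      using g ws0' by (auto simp: isos_def frames_def)
  next
    fix ws assume ws: "ws \<in> {ws \<in> frames m V. map \<nu> ws = map \<nu> ws0}"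
    then have ws': "hyperbolic ws" "length ws = 2 * m" "set ws \<subseteq> V" "map \<nu> ws = map \<nu> ws0" by (auto simp: frames_def)
    have "tr ws0 ws \<in> isos"
    proof -
      have "tr ws0 ws (\<pi> x) = tr ws0 ws x" for x by (intro tr_cong) (simp add: B_pi)
      moreover have "tr ws0 ws x \<in> V" for x
        using tr_span[of ws0 ws x] span_minimal[OF ws'(3) subV] by blast
      moreover have "B (tr ws0 ws x) (tr ws0 ws y) = B x y" for x y
        using tr_B[of ws ws0 ws0 x y] ws' ws0' tid by (simp add: B_pi B_pi_r)
      moreover have "\<nu> (tr ws0 ws x) = \<nu> x" for x
        using tr_nu[of ws ws0 ws0 x] ws' ws0' tid by (simp add: nu_pi)
      ultimately show ?thesis unfolding isos_def by (auto simp: tr_add tr_scale)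
    qed
    moreover have "map (tr ws0 ws) ws0 = ws" using map_tr ws' ws0' by simp
    ultimately show "\<exists>g\<in>isos. ws = map g ws0" by metis
  qed
qed

lemma card_isos_symplectic:
  assumes V: "card V = q ^ (2 * m)" and "\<nu> = (\<lambda>_. 0)"
  shows "card isos = spord m"
proof -
  have c: "card (frames m V) = spord m" using card_frames[OF finV subV altU ndV V] .
  then obtain ws0 where ws0: "ws0 \<in> frames m V" using spord_pos[of m] by fastforce
  have "map \<nu> ws = map \<nu> ws0" if "ws \<in> frames m V" for ws
    using that ws0 assms(2) by (auto simp: frames_def map_replicate_const)
  then have "{ws \<in> frames m V. map \<nu> ws = map \<nu> ws0} = frames m V" by auto
  then show ?thesis using card_isos[OF V ws0] c by simp
qed

end

section \<open>Quadratic forms\<close>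

locale quad = bilin scale q B
  for scale :: "'a::{field,finite} \<Rightarrow> 'b::ab_group_add \<Rightarrow> 'b" (infixr "*s" 75) and q :: nat
    and B :: "'b \<Rightarrow> 'b \<Rightarrow> 'a" +
  fixes \<nu> :: "'b \<Rightarrow> 'a"
  assumes nu_add: "\<nu> (x + y) = \<nu> x + \<nu> y + B x y"
    and nu_scale: "\<nu> (c *s x) = c\<^sup>2 * \<nu> x"
begin

abbreviation Q :: int where "Q \<equiv> int q"

lemma Q_ge_2: "Q \<ge> 2" using q_ge_2 by simp

lemma nu_0 [simp]: "\<nu> 0 = 0" using nu_scale[of 0 0] by simp

lemma B_self [simp]: "B x x = 0" using nu_add[of x x] by simp

lemma altU: "alt U" by (simp add: alt_def)

lemma B_sym: "B x y = B y x"
  using alt_sym[OF altU subspace_UNIV] by simp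

definition Z :: "'b set \<Rightarrow> nat" where
  "Z U = card {v \<in> U. \<nu> v = 0}"

text \<open>The types \<open>\<epsilon> = 1\<close> and \<open>\<epsilon> = -1\<close> of a nondegenerate form on a space of dimension
  \<open>2 * m\<close> are told apart by the number of its singular vectors.\<close>

definition qtype :: "int \<Rightarrow> nat \<Rightarrow> 'b set \<Rightarrow> bool" where
  "qtype \<epsilon> m U \<longleftrightarrow> finite U \<and> subspace U \<and> nondeg U \<and> card U = q ^ (2 * m) \<and> (\<epsilon> = 1 \<or> \<epsilon> = -1) \<and>
     Q * int (Z U) = Q ^ (2 * m) + \<epsilon> * (Q - 1) * Q ^ m"

lemma B_singular:
  assumes "subspace W" "\<And>w. w \<in> W \<Longrightarrow> \<nu> w = 0" "x \<in> W" "y \<in> W"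
  shows "B x y = 0"
  using nu_add[of x y] assms subspace_add by auto

text \<open>On a coset \<open>v + W\<close> with \<open>v\<close> not orthogonal to \<open>W\<close>, the form takes every value equally often.\<close>

lemma zero_perp:
  assumes U: "finite U" "subspace U" and W: "subspace W" "W \<subseteq> U" and s: "\<And>w. w \<in> W \<Longrightarrow> \<nu> w = 0"
  shows "q * Z U + card (perp U W) = q * Z (perp U W) + card U"
proof -
  let ?P = "perp U W" and ?D = "U - perp U W"
  have fW: "finite W" using U W finite_subset by blast
  have P: "?P \<subseteq> U" by (auto simp: perp_def)
  have WP: "w \<in> ?P" if "w \<in> W" for w
    using that W B_singular[OF W(1) s] by (auto simp: perp_def)
  have sP: "subspace ?P" using U by auto
  have nv: "\<nu> (v + w) = \<nu> v + B v w" if "w \<in> W" for v w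
    using nu_add s that by simp
  have a: "q * card {w \<in> W. \<nu> (v + w) = 0} = card W" if "v \<in> ?D" for v
  proof -
    have "{w \<in> W. \<nu> (v + w) = 0} = {w \<in> W. B v w = \<nu> v}" using nv by (auto simp: add_eq_0)
    moreover have "\<exists>w\<in>W. B v w \<noteq> 0" using that by (auto simp: perp_def)
    ultimately show ?thesis using card_fibre_linear[OF fW W(1), of "B v"] by (simp add: B_simps)
  qed
  have b: "card {v \<in> ?D. \<nu> (v + w) = 0} = card {v \<in> ?D. \<nu> v = 0}" if w: "w \<in> W" for w
  proof (rule bij_betw_same_card[of "\<lambda>v. v + w"])
    have D: "v + w \<in> ?D" if "v \<in> ?D" for v
    proof -
      have "v + w \<notin> ?P"
      proof
        assume "v + w \<in> ?P"
        then have "(v + w) + w \<in> ?P" using subspace_add[OF sP] WP[OF w] by blast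
        then show False using that by (simp add: add.assoc)
      qed
      then show ?thesis using that w W subspace_add[OF U(2)] by auto
    qed
    show "bij_betw (\<lambda>v. v + w) {v \<in> ?D. \<nu> (v + w) = 0} {v \<in> ?D. \<nu> v = 0}"
    proof (rule bij_betw_byWitness[of _ "\<lambda>v. v + w"])
      show "(\<lambda>v. v + w) ` {v \<in> ?D. \<nu> (v + w) = 0} \<subseteq> {v \<in> ?D. \<nu> v = 0}" using D by blast
      show "(\<lambda>v. v + w) ` {v \<in> ?D. \<nu> v = 0} \<subseteq> {v \<in> ?D. \<nu> (v + w) = 0}" using D by (auto simp: add.assoc)
    qed (auto simp: add.assoc)
  qed
  \<comment> \<open>Double count of the pairs with \<open>v + w\<close> singular. For fixed
    \<open>v\<close> one in \<open>q\<close> elements of \<open>W\<close> qualifies; for fixed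
    \<open>w\<close> the number is that of the singular vectors in \<open>?D\<close>, since
    translation by \<open>w\<close> permutes \<open>?D\<close>.\<close>
  have "(\<Sum>v\<in>?D. card {w \<in> W. \<nu> (v + w) = 0}) = (\<Sum>w\<in>W. card {v \<in> ?D. \<nu> (v + w) = 0})"
    using U fW by (intro sum_multicount_gen) auto
  then have "(\<Sum>v\<in>?D. q * card {w \<in> W. \<nu> (v + w) = 0}) = q * (\<Sum>w\<in>W. card {v \<in> ?D. \<nu> v = 0})"
    using b by (simp flip: sum_distrib_left)
  moreover have "(\<Sum>v\<in>?D. q * card {w \<in> W. \<nu> (v + w) = 0}) = (\<Sum>v\<in>?D. card W)"
    by (intro sum.cong refl a)
  ultimately have "card W * card ?D = card W * (q * card {v \<in> ?D. \<nu> v = 0})"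
    by (simp add: ac_simps)
  moreover have "card W \<noteq> 0" using fW subspace_0[OF W(1)] by auto
  ultimately have c: "card ?D = q * card {v \<in> ?D. \<nu> v = 0}" by simp
  have "{v \<in> U. \<nu> v = 0} = {v \<in> ?P. \<nu> v = 0} \<union> {v \<in> ?D. \<nu> v = 0}" using P by auto
  then have "Z U = Z ?P + card {v \<in> ?D. \<nu> v = 0}"
    unfolding Z_def using U P finite_subset[OF P] by (subst card_Un_disjoint[symmetric]) auto
  moreover have "card U = card ?P + card ?D"
    using U P card_mono[OF U(1) P] finite_subset[OF P] by (simp add: card_Diff_subset)
  ultimately show ?thesis using c by (simp add: algebra_simps)
qed

text \<open>Scaling by a square root of \<open>c\<close> carries value 1 to value \<open>c\<close>,
  so the nonsingular vectors are spread evenly over the \<open>q - 1\<close> nonzero values.\<close>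

lemma count_nu_1:
  assumes U: "finite U" "subspace U"
  shows "(q - 1) * card {v \<in> U. \<nu> v = 1} + Z U = card U"
proof -
  have k: "card {v \<in> U. \<nu> v = c} = card {v \<in> U. \<nu> v = 1}" if c: "c \<noteq> 0" for c
  proof (rule bij_betw_same_card[of "\<lambda>v. inverse (SOME s. s\<^sup>2 = c) *s v"])
    define s where "s = (SOME s. s\<^sup>2 = c)"
    have s: "s\<^sup>2 = c" unfolding s_def using sq_surj by (rule someI_ex)
    then have "s \<noteq> 0" using c by auto
    then show "bij_betw (\<lambda>v. inverse (SOME s. s\<^sup>2 = c) *s v) {v \<in> U. \<nu> v = c} {v \<in> U. \<nu> v = 1}"
      unfolding s_def[symmetric] using s c U
      by (intro bij_betw_byWitness[of _ "\<lambda>v. s *s v"])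
        (auto simp: nu_scale subspace_scale power_inverse)
  qed
  let ?g = "\<lambda>c. card {v \<in> U. \<nu> v = c}"
  have "U = (\<Union>c\<in>UNIV. {v \<in> U. \<nu> v = c})" by auto
  then have 1: "card U = sum ?g UNIV"
    using card_UN_disjoint[of UNIV "\<lambda>c. {v \<in> U. \<nu> v = c}"] U by auto
  have 2: "sum ?g UNIV = ?g 0 + sum ?g (UNIV - {0})"
    by (rule sum.remove[of UNIV 0 ?g]) simp_all
  have "sum ?g (UNIV - {0}) = (\<Sum>c\<in>UNIV - {0::'a}. ?g 1)"
    by (rule sum.cong[OF refl]) (rule k, simp)
  then have 3: "sum ?g (UNIV - {0}) = (q - 1) * ?g 1" using card_field by (simp add: card_Diff_singleton)
  show ?thesis unfolding Z_def 1 2 3 by simp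
qed

section \<open>Totally singular tuples and their extensions by a nonsingular vector\<close>

definition sing_tuples :: "nat \<Rightarrow> 'b set \<Rightarrow> 'b list set" where
  "sing_tuples r V = {ws. length ws = r \<and> set ws \<subseteq> V \<and> indep ws \<and> (\<forall>w\<in>span (set ws). \<nu> w = 0)}"

text \<open>The extra vector lies outside the span automatically, as \<open>\<nu>\<close> vanishes
  there. For odd rank of \<open>N\<close> it plays the part of \<open>u\<close>; for even rank it is
  \<open>f\<close>, and \<open>u\<close> heads the singular list.\<close>

definition ext_tuples :: "nat \<Rightarrow> 'b set \<Rightarrow> 'b list set" where
  "ext_tuples r V = {f # ws | ws f. ws \<in> sing_tuples r V \<and> f \<in> {f \<in> perp V (span (set ws)). \<nu> f = 1}}"

lemma finite_sing_tuples: "finite V \<Longrightarrow> finite (sing_tuples r V)"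
  using finite_lists_length_eq[of V r] by (rule finite_subset[rotated]) (auto simp: sing_tuples_def)

lemma sing_tuples_0: "sing_tuples 0 V = {[]}"
  by (auto simp: sing_tuples_def)

lemma span_tuple_subset:
  assumes "subspace V" "ws \<in> sing_tuples r V"
  shows "span (set ws) \<subseteq> V"
  using assms by (intro span_minimal) (auto simp: sing_tuples_def)

lemma sing_tuples_Suc:
  assumes V: "subspace V"
  shows "sing_tuples (Suc r) V = {w # ws | ws w. ws \<in> sing_tuples r V \<and>
    w \<in> {w \<in> perp V (span (set ws)). \<nu> w = 0} - span (set ws)}"
    (is "_ = ?R")
proof (intro equalityI subsetI)
  fix us assume us: "us \<in> sing_tuples (Suc r) V"
  then obtain w ws where e: "us = w # ws" by (auto simp: sing_tuples_def length_Suc_conv)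
  have "span (set ws) \<subseteq> span (set us)" unfolding e by (intro span_mono) auto
  moreover have "w \<in> span (set us)" unfolding e by (intro span_base) auto
  moreover have "B w x = 0" if "x \<in> span (set us)" for x
    using B_singular[OF subspace_span[of "set us"]] us that calculation(2) by (auto simp: sing_tuples_def)
  ultimately show "us \<in> ?R" using us
    unfolding e by (auto simp: sing_tuples_def indep_Cons perp_def subset_iff)
next
  fix us assume "us \<in> ?R"
  then obtain w ws where e: "us = w # ws" and ws: "ws \<in> sing_tuples r V"
    and w: "w \<in> perp V (span (set ws))" "\<nu> w = 0" "w \<notin> span (set ws)" by auto
  have "\<nu> x = 0" if x: "x \<in> span (set us)" for x
  proof -
    obtain k y where "x = k *s w + y" "y \<in> span (set ws)"
      using x unfolding e by (auto elim: span_insertE)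
    then show ?thesis using w ws by (simp add: nu_add nu_scale B_simps perp_def sing_tuples_def)
  qed
  then show "us \<in> sing_tuples (Suc r) V"
    using ws w unfolding e by (auto simp: sing_tuples_def indep_Cons perp_def)
qed

lemma sing_perp_card:
  assumes V: "qtype \<epsilon> n V" and ws: "ws \<in> sing_tuples r V"
  shows "card (perp V (span (set ws))) = q ^ (2 * n - r)"
    and "q * Z V + card (perp V (span (set ws))) = q * Z (perp V (span (set ws))) + card V"
    and "r \<le> n"
proof -
  let ?W = "span (set ws)"
  have v: "finite V" "subspace V" "nondeg V" "card V = q ^ (2 * n)" using V by (auto simp: qtype_def)
  have W: "?W \<subseteq> V" using span_tuple_subset v ws by blast
  have cW: "card ?W = q ^ r" and s: "\<And>w. w \<in> ?W \<Longrightarrow> \<nu> w = 0"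
    using ws by (auto simp: sing_tuples_def indep_def)
  have 1: "card (perp V ?W) * q ^ r = q ^ (2 * n)"
    using perp_card[of V ?W] v W cW by (auto simp: nondeg_def)
  show "q * Z V + card (perp V ?W) = q * Z (perp V ?W) + card V"
    by (intro zero_perp v W s subspace_span)
  have "?W \<subseteq> perp V ?W" using W B_singular[OF subspace_span s] by (auto simp: perp_def)
  then have "q ^ r \<le> card (perp V ?W)" using cW v card_mono[of "perp V ?W" ?W] by (auto simp: perp_def)
  then have "q ^ r * q ^ r \<le> card (perp V ?W) * q ^ r" by simp
  then have "q ^ (2 * r) \<le> q ^ (2 * n)" using 1 by (simp add: mult_2 power_add)
  then show "r \<le> n" using q_ge_2 by (simp add: power_increasing_iff)
  then have "q ^ (2 * n) = q ^ (2 * n - r) * q ^ r" by (simp flip: power_add)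
  then show "card (perp V ?W) = q ^ (2 * n - r)" using 1 by simp
qed

text \<open>The new factor is \<open>Q ^ r\<close> times the number of nonzero singular vectors in
  dimension \<open>2 * Suc k\<close>, as one expects from the quotient of the perp by the span. The
  count takes place in the perp itself, by means of \<open>zero_perp\<close>. For
  \<open>\<epsilon> = -1\<close> and \<open>k = 0\<close> the factor is 0: there are no totally
  singular tuples of length \<open>n\<close>.\<close>

lemma card_sing_tuples_Suc:
  assumes V: "qtype \<epsilon> n V" and n: "n = Suc (r + k)"
  shows "int (card (sing_tuples (Suc r) V)) =
    int (card (sing_tuples r V)) * (Q ^ r * (Q ^ Suc k - \<epsilon>) * (Q ^ k + \<epsilon>))"
proof -
  have v: "finite V" "subspace V" "nondeg V" "card V = q ^ (2 * n)" using V by (auto simp: qtype_def)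
  let ?N = "nat (Q ^ r * (Q ^ Suc k - \<epsilon>) * (Q ^ k + \<epsilon>))"
  have eps: "\<epsilon> = 1 \<or> \<epsilon> = -1" using V by (auto simp: qtype_def)
  have pos: "Q ^ r * (Q ^ Suc k - \<epsilon>) * (Q ^ k + \<epsilon>) \<ge> 0"
  proof -
    have "Q ^ Suc k \<ge> 1" "Q ^ k \<ge> 1" using Q_ge_2 by (intro one_le_power; simp)+
    then show ?thesis using eps by auto
  qed
  have "card (sing_tuples (Suc r) V) = card (sing_tuples r V) * ?N"
    unfolding sing_tuples_Suc[OF v(2)]
  proof (rule card_Cons_image)
    fix ws assume ws: "ws \<in> sing_tuples r V"
    let ?W = "span (set ws)" and ?P = "perp V (span (set ws))"
    have P: "finite ?P" using v by (simp add: perp_def)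
    have W: "?W \<subseteq> {w \<in> ?P. \<nu> w = 0}"
      using ws span_tuple_subset[OF v(2) ws] B_singular[OF subspace_span[of "set ws"]]
      by (auto simp: sing_tuples_def perp_def)
    have "int (card ({w \<in> ?P. \<nu> w = 0} - ?W)) = int (Z ?P) - Q ^ r"
      using W P ws card_mono[OF _ W]
      by (subst card_Diff_subset) (auto simp: Z_def sing_tuples_def indep_def of_nat_diff)
    moreover have "Q * int (Z ?P) = \<epsilon> * (Q - 1) * Q ^ n + Q ^ (Suc (n + k))"
    proof -
      have "card ?P = q ^ Suc (n + k)" using sing_perp_card(1)[OF V ws] n by (simp add: mult_2 ac_simps)
      then have "int (q * Z V + q ^ Suc (n + k)) = int (q * Z ?P + card V)"
        using sing_perp_card(2)[OF V ws] by simp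
      then show ?thesis using V v by (simp add: qtype_def)
    qed
    ultimately have "Q * int (card ({w \<in> ?P. \<nu> w = 0} - ?W)) = \<epsilon> * (Q - 1) * Q ^ n + Q ^ (Suc (n + k)) - Q * Q ^ r"
      by (simp add: right_diff_distrib)
    also have "\<dots> = Q * (Q ^ r * (Q ^ Suc k - \<epsilon>) * (Q ^ k + \<epsilon>))"
      using eps by (auto simp: n power_add algebra_simps power2_eq_square)
    finally have "Q * int (card ({w \<in> ?P. \<nu> w = 0} - ?W)) = Q * (Q ^ r * (Q ^ Suc k - \<epsilon>) * (Q ^ k + \<epsilon>))" .
    then have "int (card ({w \<in> ?P. \<nu> w = 0} - ?W)) = Q ^ r * (Q ^ Suc k - \<epsilon>) * (Q ^ k + \<epsilon>)" by simp
    then show "card ({w \<in> ?P. \<nu> w = 0} - ?W) = ?N" by linarith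
    show "finite ({w \<in> ?P. \<nu> w = 0} - ?W)" using P by simp
  qed (auto simp: finite_sing_tuples v)
  then show ?thesis using pos by simp
qed

text \<open>The factor is the number of vectors of value 1 in the perp; \<open>count_nu_1\<close>
  derives it from the number of singular vectors there.\<close>

lemma card_ext_tuples:
  assumes V: "qtype \<epsilon> n V" and n: "n = Suc (r + k)"
  shows "int (card (ext_tuples r V)) = int (card (sing_tuples r V)) * (Q ^ (n + k) - \<epsilon> * Q ^ (r + k))"
proof -
  have v: "finite V" "subspace V" "nondeg V" "card V = q ^ (2 * n)" using V by (auto simp: qtype_def)
  let ?N = "nat (Q ^ (n + k) - \<epsilon> * Q ^ (r + k))"
  have eps: "\<epsilon> = 1 \<or> \<epsilon> = -1" using V by (auto simp: qtype_def)
  have pos: "Q ^ (n + k) - \<epsilon> * Q ^ (r + k) \<ge> 0"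
  proof -
    have "Q ^ (n + k) \<ge> Q ^ (r + k)" using Q_ge_2 n by (intro power_increasing) auto
    moreover have "Q ^ (r + k) \<ge> 0" by simp
    ultimately show ?thesis using eps by (elim disjE; hypsubst; linarith)
  qed
  have "card (ext_tuples r V) = card (sing_tuples r V) * ?N"
    unfolding ext_tuples_def
  proof (rule card_Cons_image)
    fix ws assume ws: "ws \<in> sing_tuples r V"
    let ?W = "span (set ws)" and ?P = "perp V (span (set ws))"
    have P: "finite ?P" using v by (simp add: perp_def)
    have sP: "subspace ?P" using v by (intro subspace_perp)
    let ?c = "int (card {f \<in> ?P. \<nu> f = 1})"
    have cP: "card ?P = q ^ Suc (n + k)" using sing_perp_card(1)[OF V ws] n by (simp add: mult_2 ac_simps)
    then have "int (q * Z V + q ^ Suc (n + k)) = int (q * Z ?P + card V)"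
      using sing_perp_card(2)[OF V ws] by simp
    then have 1: "Q * int (Z ?P) = \<epsilon> * (Q - 1) * Q ^ n + Q ^ (Suc (n + k))"
      using V v by (simp add: qtype_def)
    have "int ((q - 1) * card {f \<in> ?P. \<nu> f = 1} + Z ?P) = int (card ?P)"
      using count_nu_1[OF P sP] by simp
    then have "(Q - 1) * ?c + int (Z ?P) = Q ^ Suc (n + k)"
      using cP q_ge_2 by (simp add: of_nat_diff)
    then have "Q * ((Q - 1) * ?c) = Q * Q ^ Suc (n + k) - (\<epsilon> * (Q - 1) * Q ^ n + Q ^ (Suc (n + k)))"
      unfolding 1[symmetric] by (simp add: algebra_simps flip: distrib_left)
    also have "\<dots> = Q * ((Q - 1) * (Q ^ (n + k) - \<epsilon> * Q ^ (r + k)))"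
      by (simp add: n algebra_simps power_add)
    finally have "?c = Q ^ (n + k) - \<epsilon> * Q ^ (r + k)" using Q_ge_2 by simp
    then show "card {f \<in> ?P. \<nu> f = 1} = ?N" by linarith
    show "finite {f \<in> ?P. \<nu> f = 1}" using P by simp
  qed (auto simp: finite_sing_tuples v)
  then show ?thesis using pos by simp
qed

section \<open>Splitting off a hyperbolic pair and recognizing the type\<close>

lemma Z_orth_line:
  assumes U: "finite U" "subspace U" and p: "(e, f) \<in> hpairs U" and e: "\<nu> e = 0"
  shows "Z {v \<in> U. B e v = 0} = q * Z (hperp U e f)"
proof -
  let ?H = "hperp U e f"
  have ef: "e \<in> U" "f \<in> U" "B e f = 1" "B f e = 1" using p B_sym[of f e] by (auto simp: hpairs_def)
  have fH: "finite ?H" using U finite_subset[OF hperp_sub] by blast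
  have "bij_betw (\<lambda>(c, u). u + c *s e) (UNIV \<times> {u \<in> ?H. \<nu> u = 0}) {v \<in> {v \<in> U. B e v = 0}. \<nu> v = 0}"
  proof (rule bij_betw_byWitness[of _ "\<lambda>v. (B f v, v + B f v *s e)"])
    show "\<forall>a\<in>UNIV \<times> {u \<in> ?H. \<nu> u = 0}.
       (B f (case a of (c, u) \<Rightarrow> u + c *s e), (case a of (c, u) \<Rightarrow> u + c *s e) + B f (case a of (c, u) \<Rightarrow> u + c *s e) *s e) = a"
      using ef by (auto simp: hperp_def B_simps add.assoc)
    show "\<forall>v\<in>{v \<in> {v \<in> U. B e v = 0}. \<nu> v = 0}. (case (B f v, v + B f v *s e) of (c, u) \<Rightarrow> u + c *s e) = v"
      by (auto simp: add.assoc)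
    show "(\<lambda>(c, u). u + c *s e) ` (UNIV \<times> {u \<in> ?H. \<nu> u = 0}) \<subseteq> {v \<in> {v \<in> U. B e v = 0}. \<nu> v = 0}"
      using ef U e B_sym[of _ e] by (auto simp: hperp_def B_simps nu_add nu_scale subspace_add subspace_scale)
    show "(\<lambda>v. (B f v, v + B f v *s e)) ` {v \<in> {v \<in> U. B e v = 0}. \<nu> v = 0} \<subseteq> UNIV \<times> {u \<in> ?H. \<nu> u = 0}"
      using ef U e B_sym[of _ e] by (auto simp: hperp_def B_simps nu_add nu_scale subspace_add subspace_scale)
  qed
  from bij_betw_same_card[OF this] show ?thesis
    using fH card_field by (simp add: Z_def card_cartesian_product)
qed

lemma hperp_Z:
  assumes U: "finite U" "subspace U" and p: "(e, f) \<in> hpairs U" and e: "\<nu> e = 0"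
  shows "q * Z U + q * card (hperp U e f) = q * (q * Z (hperp U e f)) + card U"
    and "q * (q * card (hperp U e f)) = card U"
proof -
  have ef: "e \<in> U" "f \<in> U" "B e f = 1" using p by (auto simp: hpairs_def)
  have se: "span {e} = range (\<lambda>k. k *s e)" by (rule span_singleton)
  have P: "perp U (span {e}) = {v \<in> U. B e v = 0}"
    unfolding perp_span using B_sym[of e] by (auto simp: perp_def)
  have c: "q * (q * card (hperp U e f)) = card U" using hperp_card[OF U altU p] .
  then show "q * (q * card (hperp U e f)) = card U" .
  have "q * card {v \<in> U. B e v = 0} = card U"
    using U ef by (intro card_fibre_linear) (auto simp: B_simps intro!: bexI[of _ f])
  then have "q * card {v \<in> U. B e v = 0} = q * (q * card (hperp U e f))" using c by simp
  then have "card {v \<in> U. B e v = 0} = q * card (hperp U e f)" using q_pos(2) by (simp only: mult_cancel1) simp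
  moreover have "q * Z U + card (perp U (span {e})) = q * Z (perp U (span {e})) + card U"
    using U ef e by (intro zero_perp subspace_span) (auto simp: se nu_scale subspace_scale)
  ultimately show "q * Z U + q * card (hperp U e f) = q * (q * Z (hperp U e f)) + card U"
    unfolding P using Z_orth_line[OF assms] by simp
qed

text \<open>The comparison passes through the perp of the line of \<open>e\<close>, which is the
  complement \<open>hperp U e f\<close> plus multiples of \<open>e\<close>, and these do not change
  \<open>\<nu>\<close>. The deviation of \<open>Q * Z\<close> from the power of \<open>Q\<close> is
  thereby multiplied by exactly \<open>Q\<close>, so its sign survives.\<close>

lemma hperp_qtype_iff:
  assumes U: "finite U" "subspace U" "nondeg U" "card U = q ^ (2 * Suc m)"
    and p: "(e, f) \<in> hpairs U" and e: "\<nu> e = 0"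
  shows "qtype \<epsilon> (Suc m) U \<longleftrightarrow> qtype \<epsilon> m (hperp U e f)"
    and "card (hperp U e f) = q ^ (2 * m)"
proof -
  let ?H = "hperp U e f"
  have "q * (q * card ?H) = q * (q * q ^ (2 * m))" using hperp_Z(2)[OF U(1,2) p e] U(4) by simp
  then show c: "card ?H = q ^ (2 * m)" by simp
  have "int (q * Z U + q * card ?H) = int (q * (q * Z ?H) + card U)" using hperp_Z(1)[OF U(1,2) p e] by simp
  then have r: "Q * int (Z U) + Q * Q ^ (2 * m) = Q * (Q * int (Z ?H)) + Q ^ (2 * Suc m)"
    using c U(4) by simp
  have "Q * int (Z U) = Q ^ (2 * Suc m) + \<epsilon> * (Q - 1) * Q ^ Suc m \<longleftrightarrow>
    Q * (Q * int (Z ?H)) = Q * (Q ^ (2 * m) + \<epsilon> * (Q - 1) * Q ^ m)"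
    using r by (auto simp: algebra_simps)
  then have "Q * int (Z U) = Q ^ (2 * Suc m) + \<epsilon> * (Q - 1) * Q ^ Suc m \<longleftrightarrow>
    Q * int (Z ?H) = Q ^ (2 * m) + \<epsilon> * (Q - 1) * Q ^ m" by simp
  moreover have "finite ?H" "subspace ?H" "nondeg ?H"
    using U hperp_nondeg[OF U(2) altU U(3) p] subspace_hperp finite_subset[OF hperp_sub] by blast+
  ultimately show "qtype \<epsilon> (Suc m) U \<longleftrightarrow> qtype \<epsilon> m ?H"
    using U c by (simp add: qtype_def)
qed

lemma hpair_exists:
  assumes "subspace U" "nondeg U" "e \<in> U" "e \<noteq> 0"
  obtains f where "(e, f) \<in> hpairs U"
proof -
  obtain v where v: "v \<in> U" "B v e \<noteq> 0" using assms by (auto simp: nondeg_def)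
  then have "(e, inverse (B v e) *s v) \<in> hpairs U"
    using assms B_sym[of v e] by (auto simp: hpairs_def B_simps subspace_scale)
  then show ?thesis using that by blast
qed

text \<open>A totally singular subspace of half the dimension is its own perp, so
  \<open>zero_perp\<close> yields the number of singular vectors at once.\<close>

lemma plus_type_witness:
  assumes U: "finite U" "subspace U" "nondeg U" "card U = q ^ (2 * m)"
    and W: "subspace W" "W \<subseteq> U" "\<And>w. w \<in> W \<Longrightarrow> \<nu> w = 0" "card W = q ^ m"
  shows "qtype 1 m U"
proof -
  have fW: "finite W" using U W finite_subset by blast
  have "\<exists>v\<in>U. B v w \<noteq> 0" if "w \<in> W" "w \<noteq> 0" for w using U(3) W(2) that by (auto simp: nondeg_def)
  then have "card (perp U W) * q ^ m = q ^ m * q ^ m"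
    using perp_card[OF U(1,2) fW W(1)] U(4) W(4) by (simp add: mult_2 power_add)
  then have c: "card (perp U W) = q ^ m" by simp
  have "W \<subseteq> perp U W" using W B_singular[OF W(1,3)] by (auto simp: perp_def)
  then have "perp U W = W" using c W(4) U(1) by (intro card_subset_eq[symmetric]) (auto simp: perp_def)
  moreover have "{v \<in> W. \<nu> v = 0} = W" using W(3) by auto
  ultimately have "Z (perp U W) = q ^ m" using W(4) by (simp add: Z_def)
  moreover have "q * Z U + card (perp U W) = q * Z (perp U W) + card U"
    by (intro zero_perp U W)
  ultimately have "int (q * Z U + q ^ m) = int (q * q ^ m + q ^ (2 * m))" using c U(4) by simp
  then show ?thesis using U by (simp add: qtype_def algebra_simps)
qed

text \<open>Dimension at least 4 leaves room for a \<open>y\<close> orthogonal to \<open>x\<close>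
  and independent of it. On orthogonal vectors \<open>\<nu>\<close> is additive and every scalar is
  a square, so unless \<open>x\<close> is singular some \<open>y + a *s x\<close> is.\<close>

lemma singular_vector_exists:
  assumes U: "finite U" "subspace U" "nondeg U" "card U = q ^ (2 * Suc (Suc m))"
  obtains e where "e \<in> U" "e \<noteq> 0" "\<nu> e = 0"
proof -
  have "q ^ 1 \<le> q ^ (2 * Suc (Suc m))" using q_ge_2 by (intro power_increasing) simp_all
  then have "card U \<noteq> card {0::'b}" using U(4) q_ge_2 by simp
  then obtain x where x: "x \<in> U" "x \<noteq> 0" using subspace_0[OF U(2)] by (metis subsetI singletonI subset_singleton_iff insert_absorb empty_iff)
  have sx: "card (span {x}) = q"
    using card_span_insert[of "{0}" x] x by (simp add: insert_commute span_insert_0)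
  have px: "card (perp U (span {x})) * q = q ^ (2 * Suc (Suc m))"
    using perp_card[OF U(1,2), of "span {x}"] U x sx span_minimal[of "{x}" U] finite_span_set[of "[x]"]
    by (auto simp: nondeg_def)
  have "\<not> perp U (span {x}) \<subseteq> span {x}"
  proof
    assume "perp U (span {x}) \<subseteq> span {x}"
    then have "card (perp U (span {x})) \<le> q" using card_mono[of "span {x}"] finite_span_set[of "[x]"] sx by simp
    then have "q ^ (2 * Suc (Suc m)) \<le> q * q" unfolding px[symmetric] by simp
    moreover have "q ^ 2 < q ^ (2 * Suc (Suc m))" using q_ge_2 by (intro power_strict_increasing) simp_all
    ultimately show False by (simp add: power2_eq_square)
  qed
  then obtain y where y: "y \<in> U" "B y x = 0" "y \<notin> span {x}"
    unfolding perp_span by (auto simp: perp_def)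
  show ?thesis
  proof (cases "\<nu> x = 0")
    case True
    then show ?thesis using that x by blast
  next
    case False
    obtain a where a: "a\<^sup>2 = \<nu> y / \<nu> x" using sq_surj by blast
    have "\<nu> (y + a *s x) = 0" using a y False by (simp add: nu_add nu_scale B_simps)
    moreover have "y + a *s x \<noteq> 0"
    proof
      assume "y + a *s x = 0"
      then have "y = a *s x" by (simp add: vadd_eq_0)
      then show False using y(3) by (simp add: span_base span_scale)
    qed
    moreover have "y + a *s x \<in> U" using x y U subspace_add subspace_scale by blast
    ultimately show ?thesis using that by blast
  qed
qed

text \<open>Links \<open>minus_type\<close>, which speaks of subspaces, to \<open>qtype\<close>,
  which speaks of numbers of singular vectors. Splitting off singular vectors either exhausts
  \<open>U\<close>, and they span the witness, or stops at a plane without nonzero singular vectors,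
  and such a plane has minus type.\<close>

lemma minus_type_or_witness:
  assumes "finite U" "subspace U" "nondeg U" "card U = q ^ (2 * m)"
  shows "qtype (-1) m U \<or> (\<exists>W. subspace W \<and> W \<subseteq> U \<and> (\<forall>w\<in>W. \<nu> w = 0) \<and> card W = q ^ m)"
  using assms
proof (induction m arbitrary: U)
  \<comment> \<open>In dimension 0 the zero space is the witness; \<open>qtype (-1) 0 U\<close>
    never holds.\<close>
  case 0
  then show ?case using subspace_0[of U] by (intro disjI2 exI[of _ "{0}"]) (auto simp: subspace_def)
next
  case (Suc m)
  note U = Suc.prems
  show ?case
  proof (cases "\<exists>e\<in>U. e \<noteq> 0 \<and> \<nu> e = 0")
    case True
    then obtain e where e: "e \<in> U" "e \<noteq> 0" "\<nu> e = 0" by blast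
    obtain f where p: "(e, f) \<in> hpairs U" using hpair_exists[OF U(2,3) e(1,2)] .
    let ?H = "hperp U e f"
    have H: "finite ?H" "subspace ?H" "nondeg ?H"
      using U hperp_nondeg[OF U(2) altU U(3) p] subspace_hperp finite_subset[OF hperp_sub] by blast+
    from Suc.IH[OF H hperp_qtype_iff(2)[OF U p e(3)]] show ?thesis
    proof
      assume "qtype (-1) m ?H"
      then show ?thesis using hperp_qtype_iff(1)[OF U p e(3)] by blast
    next
      assume "\<exists>W. subspace W \<and> W \<subseteq> ?H \<and> (\<forall>w\<in>W. \<nu> w = 0) \<and> card W = q ^ m"
      then obtain W where W: "subspace W" "W \<subseteq> ?H" "\<forall>w\<in>W. \<nu> w = 0" "card W = q ^ m" by blast
      have "f \<in> U" "B e f = 1" using p by (auto simp: hpairs_def)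
      then have eW: "e \<notin> W" using W(2) B_sym[of f e] by (auto simp: hperp_def)
      let ?W = "span (insert e W)"
      have "card ?W = q ^ Suc m" using card_span_insert[OF finite_subset[OF W(2) H(1)] W(1) eW] W(4) by simp
      moreover have "?W \<subseteq> U" using e W(2) hperp_sub[of U e f] U by (intro span_minimal) auto
      moreover have "\<nu> w = 0" if w: "w \<in> ?W" for w
      proof -
        obtain k y where "w = k *s e + y" "y \<in> span W" using w by (rule span_insertE)
        moreover have "span W = W" using W(1) by (simp add: span_eq_iff)
        ultimately have "w = k *s e + y" "y \<in> W" "B e y = 0" using W(2) by (auto simp: hperp_def)
        then show ?thesis using e W(3) by (simp add: nu_add nu_scale B_simps)
      qed
      ultimately show ?thesis by blast
    qed
  next
    case False
    have "m = 0"
    proof (rule ccontr)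
      assume "m \<noteq> 0"
      then obtain k where "m = Suc k" using not0_implies_Suc by blast
      then show False using singular_vector_exists[OF U(1-3), of k] U(4) False by blast
    qed
    moreover have "{v \<in> U. \<nu> v = 0} = {0}" using False subspace_0[OF U(2)] by auto
    ultimately have "qtype (-1) (Suc m) U" using U by (simp add: qtype_def Z_def algebra_simps power2_eq_square)
    then show ?thesis by blast
  qed
qed

section \<open>Planes and the Artin-Schreier map\<close>

definition artin_schreier :: "'a set" where
  "artin_schreier = range (\<lambda>t. t\<^sup>2 + t)"

lemma artin_schreier_fibre:
  assumes "c \<in> artin_schreier"
  shows "card {t. t\<^sup>2 + t = c} = 2"
proof -
  obtain s where s: "c = s\<^sup>2 + s" using assms by (auto simp: artin_schreier_def)
  have "t\<^sup>2 + t = c \<longleftrightarrow> t = s \<or> t = s + 1" for t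
  proof -
    have "t\<^sup>2 + t + (s\<^sup>2 + s) = (t + s) * (t + (s + 1))"
    proof -
      have "(t + s) * (t + (s + 1)) = t\<^sup>2 + t + (s\<^sup>2 + s) + (s * t + s * t)"
        by (simp add: algebra_simps power2_eq_square)
      then show ?thesis by simp
    qed
    then show ?thesis unfolding s by (metis add_eq_0 mult_eq_0_iff)
  qed
  then have "{t. t\<^sup>2 + t = c} = {s, s + 1}" by auto
  then show ?thesis by simp
qed

lemma artin_schreier_add_in:
  assumes "a \<in> artin_schreier" "b \<in> artin_schreier"
  shows "a + b \<in> artin_schreier"
proof -
  obtain s t where "a = s\<^sup>2 + s" "b = t\<^sup>2 + t" using assms by (auto simp: artin_schreier_def)
  then have "a + b = (s + t)\<^sup>2 + (s + t)" by (simp add: sq_add ac_simps)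
  then show ?thesis by (auto simp: artin_schreier_def)
qed

lemma card_artin_schreier: "2 * card artin_schreier = q"
proof -
  have "card {t \<in> UNIV. t\<^sup>2 + t = b} = 2" if "b \<in> artin_schreier" for b
    using artin_schreier_fibre[OF that] by simp
  from card_fibres_const[of UNIV artin_schreier "\<lambda>t. t\<^sup>2 + t", OF _ _ _ this]
  show ?thesis by (simp add: artin_schreier_def card_field)
qed

text \<open>The subgroup has index 2: together with its translate by \<open>a\<close> it fills the
  field.\<close>

lemma artin_schreier_add_notin:
  assumes a: "a \<notin> artin_schreier" and b: "b \<notin> artin_schreier"
  shows "a + b \<in> artin_schreier"
proof -
  let ?S = artin_schreier
  have "a + x \<notin> ?S" if "x \<in> ?S" for x
  proof
    assume "a + x \<in> ?S"
    then have "x + (a + x) \<in> ?S" using that artin_schreier_add_in by blast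
    then show False using a by (simp add: add.commute[of a])
  qed
  then have "?S \<inter> (+) a ` ?S = {}" by auto
  moreover have "card ((+) a ` ?S) = card ?S" by (intro card_image) (simp add: inj_on_def)
  ultimately have "card (?S \<union> (+) a ` ?S) = q"
    using card_artin_schreier by (subst card_Un_disjoint) auto
  then have "?S \<union> (+) a ` ?S = UNIV" using card_field by (intro card_subset_eq) auto
  then obtain x where "x \<in> ?S" "b = a + x" using b by blast
  then show ?thesis by simp
qed

lemma artin_schreier_exists:
  assumes "\<epsilon> = 1 \<or> \<epsilon> = (-1::int)"
  obtains \<alpha> where "\<alpha> \<in> artin_schreier \<longleftrightarrow> \<epsilon> = 1"
proof -
  have "0 \<in> artin_schreier" by (auto simp: artin_schreier_def intro: image_eqI[of _ _ 0])
  moreover have "artin_schreier \<noteq> UNIV" using card_artin_schreier card_field q_pos by auto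
  then obtain \<alpha> where "\<alpha> \<notin> artin_schreier" by blast
  ultimately show ?thesis using assms that[of 0] that[of \<alpha>] by auto
qed

lemma plane_decomp:
  assumes U: "finite U" "subspace U" "card U = q ^ 2" and p: "(e, f) \<in> hpairs U" and v: "v \<in> U"
  shows "v = B v f *s e + B v e *s f"
proof -
  have "q * (q * card (hperp U e f)) = q * (q * 1)"
    using hperp_card[OF U(1,2) altU p] U(3) by (simp add: power2_eq_square)
  then have "card (hperp U e f) = 1" using q_pos(2) by (simp only: mult_cancel1) simp
  moreover have "0 \<in> hperp U e f" using subspace_0[OF subspace_hperp[OF U(2)]] .
  ultimately have "hperp U e f = {0}" by (auto simp: card_1_singleton_iff)
  then have "v + (B v f *s e + B v e *s f) = 0" using hperp_decomp[OF U(2) altU p v] by simp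
  then show ?thesis by (simp only: vadd_eq_0)
qed

text \<open>Since \<open>\<nu> (e + t *s f) = \<nu> e + (t\<^sup>2 + t)\<close>, a nonzero singular
  vector exists exactly if \<open>\<nu> e\<close> is a value of the Artin-Schreier map, and planes
  of the two types have 1 and \<open>2 * Q - 1\<close> singular vectors. The class of
  \<open>\<nu> e\<close> is the Arf invariant of the plane.\<close>

lemma plane_artin_schreier:
  assumes U: "qtype \<epsilon> 1 U" and p: "(e, f) \<in> hpairs U" and f: "\<nu> f = 1"
  shows "\<nu> e \<in> artin_schreier \<longleftrightarrow> \<epsilon> = 1"
proof -
  have u: "finite U" "subspace U" "nondeg U" "card U = q ^ 2" "\<epsilon> = 1 \<or> \<epsilon> = -1"
    "Q * int (Z U) = Q ^ 2 + \<epsilon> * (Q - 1) * Q" using U by (auto simp: qtype_def)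
  have ef: "e \<in> U" "f \<in> U" "B e f = 1" using p by (auto simp: hpairs_def)
  have fin: "finite {v \<in> U. \<nu> v = 0}" using u by simp
  show ?thesis
  proof
    assume "\<nu> e \<in> artin_schreier"
    then obtain t where t: "\<nu> e = t\<^sup>2 + t" by (auto simp: artin_schreier_def)
    let ?w = "e + t *s f"
    have "\<nu> ?w = 0" using t f ef by (simp add: nu_add nu_scale B_simps ac_simps)
    moreover have "?w \<in> U" using ef u subspace_add subspace_scale by blast
    moreover have "B ?w f = 1" using ef by (simp add: B_simps)
    then have "?w \<noteq> 0" by auto
    ultimately have "{0, ?w} \<subseteq> {v \<in> U. \<nu> v = 0}" "card {0, ?w} = 2" using subspace_0[OF u(2)] by auto
    then have "2 \<le> Z U" unfolding Z_def using card_mono[OF fin] by metis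
    show "\<epsilon> = 1"
    proof (rule ccontr)
      assume "\<epsilon> \<noteq> 1"
      then have "Q * int (Z U) = Q * 1" using u(5,6) by (auto simp: algebra_simps power2_eq_square)
      then have "int (Z U) = 1" using q_pos(2) by (simp only: mult_cancel_left) simp
      then show False using \<open>2 \<le> Z U\<close> by simp
    qed
  next
    assume "\<epsilon> = 1"
    then have "Q * int (Z U) = Q * (2 * Q - 1)" using u(6) by (simp add: algebra_simps power2_eq_square)
    then have "int (Z U) = 2 * Q - 1" using q_pos(2) by (simp only: mult_cancel_left) simp
    then have "Z U \<noteq> 1" using Q_ge_2 by auto
    moreover have "0 \<in> {v \<in> U. \<nu> v = 0}" using subspace_0[OF u(2)] by simp
    ultimately have "{v \<in> U. \<nu> v = 0} \<noteq> {0}" unfolding Z_def by auto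
    then obtain w where w: "w \<in> U" "\<nu> w = 0" "w \<noteq> 0" using subspace_0[OF u(2)] by auto
    define a b where "a = B w f" and "b = B w e"
    have wd: "w = a *s e + b *s f" unfolding a_def b_def using plane_decomp[OF u(1,2,4) p w(1)] .
    then have n: "a\<^sup>2 * \<nu> e + b\<^sup>2 + a * b = 0" using w(2) f ef by (simp add: nu_add nu_scale B_simps mult.commute)
    have a0: "a \<noteq> 0"
    proof
      assume "a = 0"
      then show False using n wd w(3) by simp
    qed
    have "\<nu> e = (b / a)\<^sup>2 + b / a"
    proof -
      have "a\<^sup>2 * \<nu> e = b\<^sup>2 + a * b" using n by (simp add: add.assoc add_eq_0)
      then have "\<nu> e = (b\<^sup>2 + a * b) / a\<^sup>2" using a0 by (simp add: nonzero_eq_divide_eq mult.commute)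
      then show ?thesis using a0 by (simp add: add_divide_distrib power_divide power2_eq_square)
    qed
    then show "\<nu> e \<in> artin_schreier" by (auto simp: artin_schreier_def)
  qed
qed

text \<open>For fixed \<open>f\<close> the candidates are \<open>e0 + t *s f\<close>, with values
  \<open>\<nu> e0 + (t\<^sup>2 + t)\<close>. Both \<open>\<nu> e0\<close> and
  \<open>\<alpha>\<close> lie in the class prescribed by the type, so their sum is in the subgroup
  of index 2 and exactly two \<open>t\<close> fit. There are \<open>Q - \<epsilon>\<close> choices
  of \<open>f\<close>.\<close>

lemma plane_count:
  assumes U: "qtype \<epsilon> 1 U" and \<alpha>: "\<alpha> \<in> artin_schreier \<longleftrightarrow> \<epsilon> = 1"
  shows "int (card {p \<in> hpairs U. \<nu> (fst p) = \<alpha> \<and> \<nu> (snd p) = 1}) = 2 * (Q - \<epsilon>)"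
proof -
  have u: "finite U" "subspace U" "nondeg U" "card U = q ^ 2" "\<epsilon> = 1 \<or> \<epsilon> = -1"
    "Q * int (Z U) = Q ^ 2 + \<epsilon> * (Q - 1) * Q" using U by (auto simp: qtype_def)
  let ?F = "{f \<in> U. \<nu> f = 1}"
  have k: "card {e \<in> U. B e f = 1 \<and> \<nu> e = \<alpha>} = 2" if f: "f \<in> ?F" for f
  proof -
    have f': "f \<in> U" "\<nu> f = 1" "f \<noteq> 0" using f by auto
    obtain e0 where p0: "(f, e0) \<in> hpairs U" using hpair_exists[OF u(2,3) f'(1,3)] .
    then have p: "(e0, f) \<in> hpairs U" using B_sym[of f] by (auto simp: hpairs_def)
    then have e0: "e0 \<in> U" "B e0 f = 1" by (auto simp: hpairs_def)
    let ?g = "\<lambda>t. e0 + t *s f"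
    have nu: "\<nu> (?g t) = \<nu> e0 + (t\<^sup>2 + t)" for t
      using f' e0 by (simp add: nu_add nu_scale B_simps ac_simps)
    have "{e \<in> U. B e f = 1 \<and> \<nu> e = \<alpha>} = ?g ` {t. t\<^sup>2 + t = \<nu> e0 + \<alpha>}"
    proof (intro equalityI subsetI)
      fix e assume e: "e \<in> {e \<in> U. B e f = 1 \<and> \<nu> e = \<alpha>}"
      have "e = B e f *s e0 + B e e0 *s f" using plane_decomp[OF u(1,2,4) p] e by blast
      then have eq: "e = ?g (B e e0)" using e by simp
      then have "\<nu> e0 + ((B e e0)\<^sup>2 + B e e0) = \<alpha>" using nu[of "B e e0"] e by simp
      then have "(B e e0)\<^sup>2 + B e e0 = \<nu> e0 + \<alpha>" by (metis self_add_left)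
      then show "e \<in> ?g ` {t. t\<^sup>2 + t = \<nu> e0 + \<alpha>}" using eq by blast
    next
      fix e assume "e \<in> ?g ` {t. t\<^sup>2 + t = \<nu> e0 + \<alpha>}"
      then obtain t where t: "t\<^sup>2 + t = \<nu> e0 + \<alpha>" "e = ?g t" by blast
      have "?g t \<in> U" using e0 f' u subspace_add subspace_scale by blast
      moreover have "B (?g t) f = 1" using e0 by (simp add: B_simps)
      moreover have "\<nu> (?g t) = \<alpha>" unfolding nu t(1) by simp
      ultimately show "e \<in> {e \<in> U. B e f = 1 \<and> \<nu> e = \<alpha>}" using t(2) by simp
    qed
    moreover have "inj_on ?g {t. t\<^sup>2 + t = \<nu> e0 + \<alpha>}" using f'(3) by (simp add: inj_on_def)
    moreover have "\<nu> e0 + \<alpha> \<in> artin_schreier"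
      using plane_artin_schreier[OF U p f'(2)] \<alpha> artin_schreier_add_in artin_schreier_add_notin by blast
    ultimately show ?thesis using artin_schreier_fibre by (simp add: card_image)
  qed
  let ?A = "{p \<in> hpairs U. \<nu> (fst p) = \<alpha> \<and> \<nu> (snd p) = 1}"
  have "card ?A = card ?F * 2"
  proof (rule card_fibres_const[of _ _ snd])
    show "finite ?A" using finite_hpairs[OF u(1)] by simp
    show "finite ?F" using u by simp
    show "snd ` ?A \<subseteq> ?F" by (auto simp: hpairs_def)
    fix f assume f: "f \<in> ?F"
    have "{a \<in> ?A. snd a = f} = (\<lambda>e. (e, f)) ` {e \<in> U. B e f = 1 \<and> \<nu> e = \<alpha>}"
      using f by (auto simp: hpairs_def)
    then show "card {a \<in> ?A. snd a = f} = 2" using k[OF f] by (simp add: card_image inj_on_def)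
  qed
  moreover have "int (card ?F) = Q - \<epsilon>"
  proof -
    have "int ((q - 1) * card ?F + Z U) = int (card U)" using count_nu_1[OF u(1,2)] by simp
    then have "(Q - 1) * int (card ?F) + int (Z U) = Q ^ 2" using u(4) q_ge_2 by (simp add: of_nat_diff)
    then have "Q * ((Q - 1) * int (card ?F)) = Q * Q ^ 2 - (Q ^ 2 + \<epsilon> * (Q - 1) * Q)"
      unfolding u(6)[symmetric] by (simp add: algebra_simps flip: distrib_left)
    also have "\<dots> = Q * ((Q - 1) * (Q - \<epsilon>))"
      by (simp add: algebra_simps power2_eq_square)
    finally show ?thesis using Q_ge_2 by simp
  qed
  ultimately show ?thesis by simp
qed

text \<open>The order of the orthogonal group of type \<open>\<epsilon>\<close> in dimension \<open>2 * m\<close>.  There is no form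
  with \<open>\<epsilon> = -1\<close> and \<open>m = 0\<close>, so \<open>oord (-1) 0\<close> is a junk value.\<close>

fun oord :: "int \<Rightarrow> nat \<Rightarrow> int" where
  "oord \<epsilon> 0 = 1"
| "oord \<epsilon> (Suc m) = 2 * Q ^ m * (Q ^ Suc m - \<epsilon>) * int (spord m)"

lemma oord_pos: "\<epsilon> = 1 \<or> \<epsilon> = -1 \<Longrightarrow> oord \<epsilon> m > 0"
proof (cases m)
  case (Suc k)
  assume e: "\<epsilon> = 1 \<or> \<epsilon> = -1"
  have "Q ^ Suc k > 1" using Q_ge_2 by (intro one_less_power) auto
  then have "Q ^ Suc k - \<epsilon> > 0" using e by linarith
  moreover have "Q ^ k > 0" using Q_ge_2 by simp
  ultimately show ?thesis using spord_pos[of k] Suc by simp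
qed simp

text \<open>The closed formula, rewritten as the recursion that arises from splitting off a singular
  pair. For \<open>\<epsilon> = -1\<close> and \<open>m = 0\<close> the right side is 0, as a plane
  of minus type has no nonzero singular vector; the second hypothesis excludes this case.\<close>

lemma oord_Suc:
  assumes e: "\<epsilon> = 1 \<or> \<epsilon> = -1" and m: "\<epsilon> = 1 \<or> m \<noteq> 0"
  shows "oord \<epsilon> (Suc m) = (Q ^ Suc m - \<epsilon>) * (Q ^ m + \<epsilon>) * Q ^ (2 * m) * oord \<epsilon> m"
proof (cases m)
  case 0
  then show ?thesis using m by simp
next
  case (Suc k)
  have "q ^ (2 * Suc k) \<ge> 1" using q_ge_2 by (intro one_le_power) simp
  then have sp: "int (spord (Suc k)) = (Q ^ (2 * Suc k) - 1) * Q ^ (2 * k + 1) * int (spord k)"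
    by (simp only: spord.simps of_nat_mult of_nat_diff of_nat_power) simp
  have "(x + \<epsilon>) * (x - \<epsilon>) = x * x - 1" for x
    using e by (auto simp: algebra_simps)
  then have 1: "Q ^ (2 * Suc k) - 1 = (Q ^ Suc k + \<epsilon>) * (Q ^ Suc k - \<epsilon>)"
    by (simp only: mult_2 power_add)
  have "Suc k + (2 * k + 1) = 2 * Suc k + k" by simp
  then have 2: "Q ^ Suc k * Q ^ (2 * k + 1) = Q ^ (2 * Suc k) * Q ^ k"
    by (simp only: power_add[symmetric])
  have "oord \<epsilon> (Suc m) =
      2 * (Q ^ Suc m - \<epsilon>) * ((Q ^ Suc k + \<epsilon>) * (Q ^ Suc k - \<epsilon>)) * (Q ^ Suc k * Q ^ (2 * k + 1)) * int (spord k)"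
    unfolding oord.simps Suc sp 1 by (simp only: mult_ac)
  also have "\<dots> = (Q ^ Suc m - \<epsilon>) * (Q ^ m + \<epsilon>) * Q ^ (2 * m) * oord \<epsilon> m"
    unfolding oord.simps Suc 2 by (simp only: mult_ac)
  finally show ?thesis .
qed

section \<open>Counting frames adapted to the quadratic form\<close>

lemma card_singular_pairs:
  assumes U: "qtype \<epsilon> (Suc m) U"
  shows "int (card {p \<in> hpairs U. \<nu> (fst p) = 0 \<and> \<nu> (snd p) = 0}) = (Q ^ Suc m - \<epsilon>) * (Q ^ m + \<epsilon>) * Q ^ (2 * m)"
proof -
  have u: "finite U" "subspace U" "nondeg U" "card U = q ^ (2 * Suc m)" "\<epsilon> = 1 \<or> \<epsilon> = -1"
    "Q * int (Z U) = Q ^ (2 * Suc m) + \<epsilon> * (Q - 1) * Q ^ Suc m" using U by (auto simp: qtype_def)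
  let ?A = "{p \<in> hpairs U. \<nu> (fst p) = 0 \<and> \<nu> (snd p) = 0}" and ?E = "{e \<in> U. \<nu> e = 0} - {0}"
  have k: "card {f \<in> U. B e f = 1 \<and> \<nu> f = 0} = q ^ (2 * m)" if e: "e \<in> ?E" for e
  proof -
    let ?F = "{f \<in> U. B e f = 1}"
    have e': "e \<in> U" "\<nu> e = 0" "e \<noteq> 0" using e by auto
    have fF: "finite ?F" using u by simp
    obtain f0 where "(e, f0) \<in> hpairs U" using hpair_exists[OF u(2,3) e'(1,3)] .
    then have "\<exists>x\<in>U. B e x \<noteq> 0" by (auto simp: hpairs_def intro: bexI[of _ f0])
    then have cF: "q * card ?F = card U"
      using u by (intro card_fibre_linear) (auto simp: B_simps)
    \<comment> \<open>Adding \<open>t *s e\<close> stays in the affine hyperplane and changes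
      \<open>\<nu>\<close> by \<open>t\<close>, so its points are spread evenly over all
      \<open>q\<close> values.\<close>
    have c: "card {f \<in> ?F. \<nu> f = t} = card {f \<in> ?F. \<nu> f = 0}" for t
    proof (rule bij_betw_same_card[of "\<lambda>f. f + t *s e"], rule bij_betw_byWitness[of _ "\<lambda>f. f + t *s e"])
      have s: "f + t *s e \<in> U" if "f \<in> U" for f using that e' u subspace_add subspace_scale by blast
      have n: "\<nu> (f + t *s e) = \<nu> f + t" "B e (f + t *s e) = 1" if "B e f = 1" for f
        using that e' B_sym[of f e] by (simp_all add: nu_add nu_scale B_simps)
      show "(\<lambda>f. f + t *s e) ` {f \<in> ?F. \<nu> f = t} \<subseteq> {f \<in> ?F. \<nu> f = 0}" using s n by auto
      show "(\<lambda>f. f + t *s e) ` {f \<in> ?F. \<nu> f = 0} \<subseteq> {f \<in> ?F. \<nu> f = t}" using s n by auto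
    qed (auto simp: add.assoc)
    have "card ?F = q * card {f \<in> ?F. \<nu> f = 0}"
      using card_fibres_const[of ?F "UNIV :: 'a set" \<nu>, OF fF finite_UNIV subset_UNIV c] card_field by simp
    then have "q * (q * card {f \<in> ?F. \<nu> f = 0}) = q * (q * q ^ (2 * m))" using cF u(4) by simp
    then show ?thesis by (simp add: conj_assoc)
  qed
  have "card ?A = card ?E * q ^ (2 * m)"
  proof (rule card_fibres_const[of _ _ fst])
    show "finite ?A" using finite_hpairs[OF u(1)] by simp
    show "finite ?E" using u by simp
    show "fst ` ?A \<subseteq> ?E" by (auto simp: hpairs_def)
    fix e assume e: "e \<in> ?E"
    have "{a \<in> ?A. fst a = e} = Pair e ` {f \<in> U. B e f = 1 \<and> \<nu> f = 0}"
      using e by (auto simp: hpairs_def)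
    then show "card {a \<in> ?A. fst a = e} = q ^ (2 * m)" using k[OF e] by (simp add: card_image inj_on_def)
  qed
  moreover have "int (card ?E) = (Q ^ Suc m - \<epsilon>) * (Q ^ m + \<epsilon>)"
  proof -
    have f0: "finite {e \<in> U. \<nu> e = 0}" "0 \<in> {e \<in> U. \<nu> e = 0}" using u subspace_0[OF u(2)] by auto
    then have "card ?E = Z U - 1" "Z U > 0" unfolding Z_def by (auto simp: card_gt_0_iff)
    then have "Q * int (card ?E) = Q * int (Z U) - Q" by (simp add: of_nat_diff right_diff_distrib)
    also have "\<dots> = Q * ((Q ^ Suc m - \<epsilon>) * (Q ^ m + \<epsilon>))"
      using u(5) unfolding u(6) by (auto simp: algebra_simps mult_2 mult_2_right power_add)
    finally show ?thesis using q_pos(2) by (simp only: mult_cancel_left) simp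
  qed
  ultimately show ?thesis by simp
qed

text \<open>All pairs are singular except the last one, where \<open>\<alpha>\<close> carries the
  type. A single shape of frame thus serves both types.\<close>

definition pattern :: "nat \<Rightarrow> 'a \<Rightarrow> 'a list" where
  "pattern m \<alpha> = replicate (2 * m) 0 @ [\<alpha>, 1]"

text \<open>The induction starts in dimension 2, with the plane that carries
  \<open>\<alpha>\<close>, and thereby stays clear of \<open>oord (-1) 0\<close>.\<close>

lemma card_orthogonal_frames:
  assumes "qtype \<epsilon> (Suc m) U" and \<alpha>: "\<alpha> \<in> artin_schreier \<longleftrightarrow> \<epsilon> = 1"
  shows "int (card {ws \<in> frames (Suc m) U. map \<nu> ws = pattern m \<alpha>}) = oord \<epsilon> (Suc m)"
  using assms(1)
proof (induction m arbitrary: U)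
  case 0
  let ?A = "{p \<in> hpairs U. \<nu> (fst p) = \<alpha> \<and> \<nu> (snd p) = 1}"
  have "{ws \<in> frames (Suc 0) U. map \<nu> ws = pattern 0 \<alpha>} =
      {fst p # snd p # ws | p ws. p \<in> ?A \<and> ws \<in> {[]}}"
    unfolding frames_Suc by (auto simp: pattern_def)
  moreover have "finite (hpairs U)" using 0 finite_hpairs by (auto simp: qtype_def)
  then have "card {fst p # snd p # ws | p ws. p \<in> ?A \<and> ws \<in> {[]}} = card ?A * 1"
    by (intro card_Cons_image) (auto simp: prod_eq_iff)
  ultimately show ?case using plane_count[OF _ \<alpha>, of U] 0 by simp
next
  case (Suc m)
  let ?A = "{p \<in> hpairs U. \<nu> (fst p) = 0 \<and> \<nu> (snd p) = 0}"
  let ?S = "\<lambda>p. {ws \<in> frames (Suc m) (hperp U (fst p) (snd p)). map \<nu> ws = pattern m \<alpha>}"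
  let ?N = "oord \<epsilon> (Suc m)"
  have u: "finite U" "subspace U" "nondeg U" "card U = q ^ (2 * Suc (Suc m))" and eps: "\<epsilon> = 1 \<or> \<epsilon> = -1"
    using Suc.prems by (auto simp: qtype_def)
  have "{ws \<in> frames (Suc (Suc m)) U. map \<nu> ws = pattern (Suc m) \<alpha>} =
    {fst p # snd p # ws | p ws. p \<in> ?A \<and> ws \<in> ?S p}"
    unfolding frames_Suc[of "Suc m"] by (auto simp: pattern_def)
  moreover have "card {fst p # snd p # ws | p ws. p \<in> ?A \<and> ws \<in> ?S p} = card ?A * nat ?N"
  proof (rule card_Cons_image)
    fix p assume p: "p \<in> ?A"
    show "finite (?S p)" using finite_frames[OF finite_subset[OF hperp_sub u(1)]] by simp
    have "qtype \<epsilon> (Suc m) (hperp U (fst p) (snd p))"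
      using hperp_qtype_iff(1)[OF u, of "fst p" "snd p"] p Suc.prems by auto
    then have "int (card (?S p)) = ?N" by (rule Suc.IH)
    then show "card (?S p) = nat ?N" by linarith
  qed (use finite_hpairs[OF u(1)] in \<open>auto simp: prod_eq_iff\<close>)
  ultimately have "int (card {ws \<in> frames (Suc (Suc m)) U. map \<nu> ws = pattern (Suc m) \<alpha>}) = int (card ?A) * ?N"
    using oord_pos[OF eps, of "Suc m"] by (simp del: oord.simps)
  also have "\<dots> = oord \<epsilon> (Suc (Suc m))"
    unfolding card_singular_pairs[OF Suc.prems] by (rule oord_Suc[OF eps, symmetric]) simp
  finally show ?case .
qed

section \<open>Tuple counts in terms of group orders\<close>

lemma triangle_Suc: "Suc r * r div 2 = r * (r - 1) div 2 + r"
proof -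
  have "Suc r * r = r * (r - 1) + r * 2" by (cases r) auto
  then show ?thesis by (metis div_mult_self1 add.commute zero_neq_numeral)
qed

text \<open>In terms of group actions, the cofactor of the number of tuples is the order of the
  pointwise stabilizer of one of them. Here the identity comes from matching the extension step
  \<open>card_sing_tuples_Suc\<close> with the recursion \<open>oord_Suc\<close>.\<close>

lemma sing_tuples_oord:
  assumes V: "qtype \<epsilon> n V" and r: "n = r + k" and k: "\<epsilon> = 1 \<or> k \<noteq> 0"
  shows "int (card (sing_tuples r V)) * Q ^ (r * (r - 1) div 2 + r * (2 * k)) * oord \<epsilon> k = oord \<epsilon> n"
  using r k
proof (induction r arbitrary: k)
  case 0
  then show ?case by (simp add: sing_tuples_0)
next
  case (Suc r)
  have e: "\<epsilon> = 1 \<or> \<epsilon> = -1" using V by (auto simp: qtype_def)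
  let ?T = "int (card (sing_tuples r V))"
  have IH: "?T * Q ^ (r * (r - 1) div 2 + r * (2 * Suc k)) * oord \<epsilon> (Suc k) = oord \<epsilon> n"
    using Suc.IH[of "Suc k"] Suc.prems by simp
  have T: "int (card (sing_tuples (Suc r) V)) = ?T * (Q ^ r * (Q ^ Suc k - \<epsilon>) * (Q ^ k + \<epsilon>))"
    using card_sing_tuples_Suc[OF V] Suc.prems(1) by simp
  have "r + (Suc r * (Suc r - 1) div 2 + Suc r * (2 * k)) = (r * (r - 1) div 2 + r * (2 * Suc k)) + 2 * k"
    unfolding diff_Suc_1 triangle_Suc by simp
  then have E: "Q ^ r * Q ^ (Suc r * (Suc r - 1) div 2 + Suc r * (2 * k)) = Q ^ (r * (r - 1) div 2 + r * (2 * Suc k)) * Q ^ (2 * k)"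
    by (simp only: power_add[symmetric])
  have "int (card (sing_tuples (Suc r) V)) * Q ^ (Suc r * (Suc r - 1) div 2 + Suc r * (2 * k)) * oord \<epsilon> k =
    ?T * (Q ^ r * Q ^ (Suc r * (Suc r - 1) div 2 + Suc r * (2 * k))) * ((Q ^ Suc k - \<epsilon>) * (Q ^ k + \<epsilon>)) * oord \<epsilon> k"
    unfolding T by (simp only: mult_ac)
  also have "\<dots> = ?T * Q ^ (r * (r - 1) div 2 + r * (2 * Suc k)) * ((Q ^ Suc k - \<epsilon>) * (Q ^ k + \<epsilon>) * Q ^ (2 * k) * oord \<epsilon> k)"
    unfolding E by (simp only: mult_ac)
  also have "\<dots> = oord \<epsilon> n" unfolding oord_Suc[OF e Suc.prems(2), symmetric] by (rule IH)
  finally show ?case .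
qed

text \<open>\<open>oord \<epsilon> (Suc k)\<close> is \<open>2 * spord k\<close> times the number of
  vectors of value 1 in dimension \<open>2 * Suc k\<close>, and the choice of the extra vector
  accounts for that number up to a power of \<open>Q\<close>. This is why a symplectic order
  remains, and why \<open>B_coeff\<close> and \<open>C_coeff\<close> are the same for both
  types.\<close>

lemma ext_tuples_oord:
  assumes V: "qtype \<epsilon> n V" and r: "n = Suc (s + k)"
  shows "2 * Q ^ (Suc s * s div 2 + s * (2 * k)) * int (spord k) * int (card (ext_tuples s V)) = oord \<epsilon> n"
proof -
  let ?T = "int (card (sing_tuples s V))"
  have X: "int (card (ext_tuples s V)) = ?T * (Q ^ (s + k) * (Q ^ Suc k - \<epsilon>))"
  proof -
    have "n + k = (s + k) + Suc k" using r by simp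
    then have "Q ^ (n + k) = Q ^ (s + k) * Q ^ Suc k" by (simp only: power_add)
    then show ?thesis using card_ext_tuples[OF V r] by (simp add: right_diff_distrib)
  qed
  have I: "?T * Q ^ (s * (s - 1) div 2 + s * (2 * Suc k)) * oord \<epsilon> (Suc k) = oord \<epsilon> n"
    using sing_tuples_oord[OF V, of s "Suc k"] r by simp
  have "(Suc s * s div 2 + s * (2 * k)) + (s + k) = (s * (s - 1) div 2 + s * (2 * Suc k)) + k"
    unfolding triangle_Suc by simp
  then have E: "Q ^ (Suc s * s div 2 + s * (2 * k)) * Q ^ (s + k) = Q ^ (s * (s - 1) div 2 + s * (2 * Suc k)) * Q ^ k"
    by (simp only: power_add[symmetric])
  have "2 * Q ^ (Suc s * s div 2 + s * (2 * k)) * int (spord k) * int (card (ext_tuples s V)) =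
    2 * (Q ^ (Suc s * s div 2 + s * (2 * k)) * Q ^ (s + k)) * int (spord k) * ?T * (Q ^ Suc k - \<epsilon>)"
    unfolding X by (simp only: mult_ac)
  also have "\<dots> = ?T * Q ^ (s * (s - 1) div 2 + s * (2 * Suc k)) * oord \<epsilon> (Suc k)"
    unfolding E oord.simps by (simp only: mult_ac)
  also have "\<dots> = oord \<epsilon> n" by (rule I)
  finally show ?thesis .
qed

end

section \<open>Involutions\<close>

locale orthogonal_space = isometry_space scale q B \<nu> 1 V \<pi>
  for scale :: "'a::{field,finite} \<Rightarrow> 'b::ab_group_add \<Rightarrow> 'b" (infixr "*s" 75) and q :: nat
    and B :: "'b \<Rightarrow> 'b \<Rightarrow> 'a" and \<nu> :: "'b \<Rightarrow> 'a" and V :: "'b set" and \<pi> :: "'b \<Rightarrow> 'b"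
begin

sublocale quad scale q B \<nu>
  by unfold_locales (use nu_add' nu_scale' in auto)

text \<open>The involutions are the maps \<open>\<pi> + N\<close> with \<open>N\<close> in the following set.\<close>

definition nils :: "('b \<Rightarrow> 'b) set" where
  "nils = {N. (\<forall>x y. N (x + y) = N x + N y) \<and> (\<forall>c x. N (c *s x) = c *s N x) \<and>
     (\<forall>x. N (\<pi> x) = N x) \<and> (\<forall>x. N x \<in> V) \<and> (\<forall>x. N (N x) = 0) \<and> (\<forall>x. \<nu> (N x) = B x (N x))}"

lemma nilsD:
  assumes "N \<in> nils"
  shows "N (x + y) = N x + N y" "N (c *s x) = c *s N x" "N (\<pi> x) = N x" "N x \<in> V" "N (N x) = 0"
    "\<nu> (N x) = B x (N x)"
  using assms by (auto simp: nils_def)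

text \<open>Adding \<open>\<pi>\<close> is its own inverse. For \<open>g = \<pi> + N\<close>,
  preservation of \<open>\<nu>\<close> amounts to \<open>\<nu> (N x) = B x (N x)\<close>;
  preservation of \<open>B\<close> then follows by polarization.\<close>

lemma card_involutions_nils: "card {g \<in> isos. \<forall>x. g (g x) = \<pi> x} = card nils"
proof (rule bij_betw_same_card[of "\<lambda>g x. \<pi> x + g x"], rule bij_betw_byWitness[of _ "\<lambda>N x. \<pi> x + N x"])
  have pp: "\<pi> (\<pi> x) = \<pi> x" for x using pi_id[OF pi_in] .
  show "(\<lambda>g x. \<pi> x + g x) ` {g \<in> isos. \<forall>x. g (g x) = \<pi> x} \<subseteq> nils"
  proof (intro subsetI, clarify)
    fix g assume g: "g \<in> isos" and gg: "\<forall>x. g (g x) = \<pi> x"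
    have g': "g (x + y) = g x + g y" "g (c *s x) = c *s g x" "g (\<pi> x) = g x" "g x \<in> V" "\<nu> (g x) = \<nu> x" for x y c
      using g by (auto simp: isos_def)
    have "\<pi> (g x) = g x" for x using pi_id g'(4) by blast
    then show "(\<lambda>x. \<pi> x + g x) \<in> nils"
      unfolding nils_def using g' gg
      by (auto simp: pi_add pi_scale scale_right_distrib pp pi_in nu_add nu_pi B_simps B_pi B_pi_r subspace_add[OF subV] ac_simps)
  qed
  show "(\<lambda>N x. \<pi> x + N x) ` nils \<subseteq> {g \<in> isos. \<forall>x. g (g x) = \<pi> x}"
  proof (intro subsetI, clarify)
    fix N assume N: "N \<in> nils"
    have "\<pi> (N x) = N x" for x using pi_id nilsD(4)[OF N] by blast
    moreover have nu: "\<nu> (\<pi> x + N x) = \<nu> x" for x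
      using nilsD(6)[OF N] by (simp add: nu_add nu_pi B_pi add.assoc)
    have "B (\<pi> x + N x) (\<pi> y + N y) = B x y" for x y
    proof -
      have "\<nu> ((\<pi> x + N x) + (\<pi> y + N y)) = \<nu> (\<pi> (x + y) + N (x + y))"
        by (simp add: pi_add nilsD(1)[OF N] ac_simps)
      then have "\<nu> x + \<nu> y + B (\<pi> x + N x) (\<pi> y + N y) = \<nu> (x + y)"
        unfolding nu by (subst (asm) nu_add) (simp add: nu)
      then show ?thesis by (simp add: nu_add)
    qed
    ultimately show "(\<lambda>x. \<pi> x + N x) \<in> isos \<and> (\<forall>x. \<pi> (\<pi> x + N x) + N (\<pi> x + N x) = \<pi> x)"
      unfolding isos_def using nu nilsD[OF N]
      by (auto simp: pi_add pi_scale scale_right_distrib pp pi_in subspace_add[OF subV] ac_simps)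
  qed
qed auto

text \<open>Polarizing \<open>\<nu> (N x) = B x (N x)\<close> expresses \<open>B (N x) (N y)\<close>
  as \<open>B x (N y) + B y (N x)\<close>. With \<open>N x\<close> in place of \<open>x\<close> all
  other terms vanish, so the image is isotropic; then the identity says that \<open>N\<close> is
  self-adjoint.\<close>

lemma nils_iso:
  assumes N: "N \<in> nils"
  shows "B (N x) (N y) = 0" and "B (N x) y = B x (N y)"
proof -
  have *: "B (N x) (N y) = B x (N y) + B y (N x)" for x y
  proof -
    have "\<nu> (N (x + y)) = B (x + y) (N (x + y))" using nilsD(6)[OF N] .
    then have "B x (N x) + B y (N y) + B (N x) (N y) = B x (N x) + (B x (N y) + (B y (N x) + B y (N y)))"
      using nilsD[OF N] by (simp add: nu_add B_simps ac_simps)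
    then have "B y (N y) + B (N x) (N y) = B x (N y) + (B y (N x) + B y (N y))" by (simp add: add.assoc)
    then have "B y (N y) + B (N x) (N y) = B y (N y) + (B x (N y) + B y (N x))" by (simp add: ac_simps)
    then show ?thesis by simp
  qed
  have 0: "B (N x) (N y) = 0" for x y using *[of "N x" y] nilsD(5)[OF N] by simp
  show "B (N x) (N y) = 0" by (rule 0)
  have "B x (N y) = B y (N x)" using *[of x y] 0[of x y] by (simp add: add_eq_0)
  then show "B (N x) y = B x (N y)" by (simp add: B_sym)
qed

lemma nils_range:
  assumes N: "N \<in> nils"
  shows "finite (range N)" "subspace (range N)" "range N \<subseteq> V"
proof -
  show 1: "range N \<subseteq> V" using nilsD(4)[OF N] by auto
  show "finite (range N)" using 1 finV finite_subset by blast
  have "N 0 = 0" using nilsD(2)[OF N, of 0 0] by simp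
  then show "subspace (range N)"
    using nilsD(1,2)[OF N, symmetric] by (auto simp: subspace_def image_iff)
qed

text \<open>\<open>c x y\<close> is \<open>B (s x) y\<close> for a linear \<open>s\<close> with
  \<open>N (s y) = y\<close> on the image. Since \<open>s\<close> is defined on the whole type,
  \<open>c\<close> is bilinear everywhere, as \<open>bilin\<close> demands; self-adjointness of
  \<open>N\<close> makes the values on the image independent of \<open>s\<close>.\<close>

lemma form_on_range:
  assumes N: "N \<in> nils"
  obtains c where "bilin scale q c" and "\<And>x y. c (N x) (N y) = B x (N y)"
proof -
  interpret vp: vector_space_pair scale scale by unfold_locales
  have "Vector_Spaces.linear scale scale N"
    using nilsD(1,2)[OF N] by unfold_locales auto
  from vp.linear_exists_right_inverse_on[OF this subspace_UNIV]
  obtain s where s: "Vector_Spaces.linear scale scale s" "\<And>y. y \<in> range N \<Longrightarrow> N (s y) = y" by auto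
  interpret s: Vector_Spaces.linear scale scale s by (rule s(1))
  show ?thesis
  proof
    show "bilin scale q (\<lambda>x y. B (s x) y)"
      by unfold_locales (auto simp: B_simps s.add s.scale)
    show "B (s (N x)) (N y) = B x (N y)" for x y
      using nils_iso(2)[OF N, of "s (N x)" y] nils_iso(2)[OF N, of x y] s(2)[of "N x"] by simp
  qed
qed

text \<open>The form \<open>c\<close> of the next two maps has Gram matrix \<open>(1)\<close> at \<open>[u]\<close> and rows \<open>(1, 1)\<close>, \<open>(1, 0)\<close> at
  \<open>[f, u]\<close>, respectively, orthogonally extended by a hyperbolic list \<open>ws\<close>; the coefficients below
  are the entries of the inverse Gram matrix.\<close>

definition phi_odd :: "'b \<Rightarrow> 'b list \<Rightarrow> 'b \<Rightarrow> 'b" where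
  "phi_odd u ws v = B v u *s u + tr ws ws v"

definition phi_even :: "'b \<Rightarrow> 'b \<Rightarrow> 'b list \<Rightarrow> 'b \<Rightarrow> 'b" where
  "phi_even f u ws v = B v u *s (u + f) + (B v f *s u + tr ws ws v)"

lemma ext_tuples_Cons:
  "f # ws \<in> ext_tuples r U \<longleftrightarrow> ws \<in> sing_tuples r U \<and> f \<in> U \<and> (\<forall>w\<in>span (set ws). B f w = 0) \<and> \<nu> f = 1"
  by (auto simp: ext_tuples_def perp_def)

lemma ext_tuples_indep:
  assumes "f # ws \<in> ext_tuples r U"
  shows "indep (f # ws)"
  using assms by (auto simp: ext_tuples_Cons indep_Cons sing_tuples_def)

lemma sing_tuples_B:
  assumes "ws \<in> sing_tuples r U" "x \<in> span (set ws)" "y \<in> span (set ws)"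
  shows "B x y = 0"
  using B_singular[OF subspace_span _ assms(2,3)] assms(1) by (auto simp: sing_tuples_def)

text \<open>Each pair of the list contributes the same product twice.\<close>

lemma B_tr_self: "B x (tr ws ws x) = 0"
proof (induction ws rule: induct_list012)
  case (3 e f ws)
  then show ?case by (simp add: B_simps mult.commute)
qed auto

lemma tr_pi: "tr ws us (\<pi> v) = tr ws us v"
  by (intro tr_cong) (simp add: B_pi)

lemma tr_in_V: "set us \<subseteq> V \<Longrightarrow> tr ws us v \<in> V"
  using tr_span[of ws us v] span_minimal[OF _ subV, of "set us"] by blast

lemma tr_singular_0:
  assumes ws: "ws \<in> sing_tuples r V" and x: "\<forall>w\<in>set ws. B x w = 0"
  shows "tr ws ws x = 0"
  using tr_cong[of ws x 0 ws] x tr_0 by simp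

text \<open>No form on the span is given in advance. Total singularity makes the image orthogonal to
  \<open>ws\<close>, hence the square is 0, and both sides of the condition on \<open>\<nu>\<close>
  vanish.\<close>

lemma tr_nils:
  assumes ws: "ws \<in> sing_tuples r V"
  shows "tr ws ws \<in> nils"
proof -
  have 1: "\<nu> (tr ws ws x) = 0" for x using ws tr_span[of ws ws x] by (auto simp: sing_tuples_def)
  have 2: "tr ws ws (tr ws ws x) = 0" for x
    using sing_tuples_B[OF ws tr_span] by (intro tr_singular_0[OF ws]) (auto intro: span_base)
  show ?thesis unfolding nils_def
    using 1 2 ws by (auto simp: tr_add tr_scale tr_pi B_tr_self sing_tuples_def tr_in_V)
qed

lemma phi_odd_nils:
  assumes "u # ws \<in> ext_tuples r V"
  shows "phi_odd u ws \<in> nils"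
proof -
  have ws: "ws \<in> sing_tuples r V" and u: "u \<in> V" "\<nu> u = 1" and p: "\<And>w. w \<in> span (set ws) \<Longrightarrow> B u w = 0"
    using assms by (auto simp: ext_tuples_Cons)
  note N = nilsD[OF tr_nils[OF ws]]
  have ut: "B u (tr ws ws x) = 0" "B (tr ws ws x) u = 0" for x
    using p[OF tr_span] B_sym by metis+
  have tu: "tr ws ws u = 0" using p by (intro tr_singular_0[OF ws]) (auto intro: span_base)
  have wsV: "set ws \<subseteq> V" using ws by (simp add: sing_tuples_def)
  have nt: "\<nu> (tr ws ws x) = 0" for x using N(6) B_tr_self by simp
  show ?thesis unfolding nils_def phi_odd_def
    using ut u tu
    by (auto simp: N(1,2,3,5) B_simps scale_left_distrib scale_right_distrib B_pi nu_add nu_scale nt B_tr_self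
        subspace_add[OF subV] subspace_scale[OF subV] tr_in_V[OF wsV] ac_simps power2_eq_square)
qed

text \<open>As in the odd case, both sides of the condition on \<open>\<nu>\<close> equal
  \<open>(B x u)\<^sup>2\<close>: in the image only \<open>f\<close> is nonsingular, with
  coefficient \<open>B x u\<close>, and in \<open>B x (phi_even f u ws x)\<close> the products of
  \<open>B x u\<close> and \<open>B x f\<close> cancel.\<close>

lemma phi_even_nils:
  assumes "f # u # ws \<in> ext_tuples r V"
  shows "phi_even f u ws \<in> nils"
proof -
  have uws: "u # ws \<in> sing_tuples r V" and f: "f \<in> V" "\<nu> f = 1"
    and p: "\<And>w. w \<in> span (set (u # ws)) \<Longrightarrow> B f w = 0"
    using assms by (auto simp: ext_tuples_Cons)
  have s: "span (set ws) \<subseteq> span (set (u # ws))" by (intro span_mono) auto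
  have ws: "ws \<in> sing_tuples (r - 1) V" using uws s by (auto simp: sing_tuples_def indep_Cons)
  note N = nilsD[OF tr_nils[OF ws]]
  have u: "u \<in> V" "\<nu> u = 0" "u \<in> span (set (u # ws))" using uws by (auto simp: sing_tuples_def span_base)
  have t: "tr ws ws x \<in> span (set (u # ws))" for x using tr_span[of ws ws x] s by blast
  have b: "B u (tr ws ws x) = 0" "B (tr ws ws x) u = 0" "B f (tr ws ws x) = 0" "B (tr ws ws x) f = 0"
    "B f u = 0" "B u f = 0" for x
    using sing_tuples_B[OF uws u(3) t[of x]] p[OF t[of x]] p[OF u(3)] B_sym by metis+
  have "tr ws ws u = 0" "tr ws ws f = 0"
    using p sing_tuples_B[OF uws u(3)] s by (auto intro!: tr_singular_0[OF ws] intro: span_base)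
  moreover have wsV: "set ws \<subseteq> V" using ws by (simp add: sing_tuples_def)
  moreover have nt: "\<nu> (tr ws ws x) = 0" for x using N(6) B_tr_self by simp
  ultimately show ?thesis unfolding nils_def phi_even_def
    using u f b
    by (auto simp: N(1,2,3,5) B_simps scale_left_distrib scale_right_distrib B_pi nu_add nu_scale B_tr_self
        subspace_add[OF subV] subspace_scale[OF subV] tr_in_V ac_simps power2_eq_square)
qed

end

section \<open>The symmetric form on the image of N\<close>

locale nil_form = orthogonal_space scale q B \<nu> V \<pi> + c: bilin scale q c
  for scale :: "'a::{field,finite} \<Rightarrow> 'b::ab_group_add \<Rightarrow> 'b" (infixr "*s" 75) and q :: nat
    and B :: "'b \<Rightarrow> 'b \<Rightarrow> 'a" and \<nu> :: "'b \<Rightarrow> 'a" and V :: "'b set" and \<pi> :: "'b \<Rightarrow> 'b"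
    and c :: "'b \<Rightarrow> 'b \<Rightarrow> 'a" +
  fixes N :: "'b \<Rightarrow> 'b"
  assumes N: "N \<in> nils" and c_N: "c (N x) (N y) = B x (N y)"
begin

abbreviation "W \<equiv> range N"

lemma finW: "finite W" and subW: "subspace W" and WV: "W \<subseteq> V"
  using nils_range[OF N] by auto

lemma c_eval: "w \<in> W \<Longrightarrow> c (N v) w = B v w"
  using c_N by auto

lemma c_sym: "x \<in> W \<Longrightarrow> y \<in> W \<Longrightarrow> c x y = c y x"
  using c_N nils_iso(2)[OF N] B_sym by (metis rangeE)

lemma c_diag: "w \<in> W \<Longrightarrow> c w w = \<nu> w"
  using c_N nilsD(6)[OF N] by auto

lemma B_W: "x \<in> W \<Longrightarrow> y \<in> W \<Longrightarrow> B x y = 0"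
  using nils_iso(1)[OF N] by auto

lemma c_nondeg: "c.nondeg W"
  unfolding c.nondeg_def
proof (intro ballI impI)
  fix w assume w: "w \<in> W" and h: "\<forall>v\<in>W. c v w = 0"
  have "B v w = 0" for v using h c_eval[OF w, of v] by auto
  then show "w = 0" using ndV w WV by (auto simp: nondeg_def)
qed

lemma W_card_le: "card W = q ^ r \<Longrightarrow> card V = q ^ (2 * n) \<Longrightarrow> r \<le> n"
proof -
  assume r: "card W = q ^ r" and n: "card V = q ^ (2 * n)"
  have "card (perp V W) * card W = card V"
    using perp_card[OF finV subV finW subW] ndV WV by (auto simp: nondeg_def)
  moreover have "W \<subseteq> perp V W" using WV B_W by (auto simp: perp_def)
  then have "card W \<le> card (perp V W)" using finV by (intro card_mono) (auto simp: perp_def)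
  ultimately have "card W * card W \<le> card V" by (metis mult_le_mono1)
  then have "q ^ (2 * r) \<le> q ^ (2 * n)" using r n by (simp add: mult_2 power_add)
  then show "r \<le> n" using q_ge_2 by (simp add: power_increasing_iff)
qed

text \<open>The \<open>c\<close>-coordinates of \<open>N v\<close> are the
  \<open>B\<close>-coordinates of \<open>v\<close>. Expanding \<open>N v\<close> in a basis that is
  hyperbolic for \<open>c\<close> therefore expresses \<open>N\<close> by \<open>tr\<close>.\<close>

lemma c_tr: "set ws \<subseteq> W \<Longrightarrow> c.tr ws us (N v) = tr ws us v"
  by (induction ws us v rule: tr.induct) (auto simp: c_eval)

lemma tr_append_dual:
  assumes "even (length us)" "\<forall>w\<in>set us. B v w = 0" "\<forall>w\<in>set vs. B v w = 0"
  shows "tr (us @ e # f # vs) (us @ e # f # vs) v = B v f *s e + B v e *s f"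
proof -
  have z: "tr vs vs' v = 0" for vs' using tr_cong[of vs v 0 vs'] assms(3) tr_0 by simp
  show ?thesis
    using assms(1,2)
  proof (induction us rule: induct_list012)
    case 1
    then show ?case using z by simp
  qed auto
qed

text \<open>Hyperbolic coordinates swap partners: the vector dual to \<open>f\<close> goes to
  \<open>e\<close> and the one dual to \<open>e\<close> goes to \<open>f\<close>. The list
  \<open>xs\<close> is \<open>[]\<close>, \<open>[u]\<close> or \<open>[f, u]\<close>; orthogonality
  to it removes the extra terms of \<open>phi_odd\<close> and \<open>phi_even\<close>. The even
  length of \<open>us\<close> keeps \<open>e\<close> and \<open>f\<close> in one pair.\<close>

lemma tuple_frame_aux:
  assumes ind: "indep (xs @ us @ e # f # vs)" and V: "set (xs @ us @ e # f # vs) \<subseteq> V" and ev: "even (length us)"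
    and N_tr: "\<And>v. \<forall>x\<in>set xs. B v x = 0 \<Longrightarrow> N v = tr (us @ e # f # vs) (us @ e # f # vs) v"
  shows "\<exists>v. N v = e \<and> B v f = 1 \<and> B v e = 0 \<and> (\<forall>x\<in>set (xs @ us @ vs). B v x = 0)"
    and "\<exists>v. N v = f \<and> B v e = 1 \<and> B v f = 0 \<and> (\<forall>x\<in>set (xs @ us @ vs). B v x = 0)"
proof -
  have "indep (f # e # xs @ us @ vs)" by (rule indep_perm[OF ind]) auto
  from dual_vector[OF finV subV ndV this] V obtain v where
    v: "B v f = 1" "B v e = 0" "\<forall>x\<in>set (xs @ us @ vs). B v x = 0" by auto
  have "N v = tr (us @ e # f # vs) (us @ e # f # vs) v" using v by (intro N_tr) simp
  also have "\<dots> = e" using tr_append_dual[OF ev, of v vs e f] v by simp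
  finally show "\<exists>v. N v = e \<and> B v f = 1 \<and> B v e = 0 \<and> (\<forall>x\<in>set (xs @ us @ vs). B v x = 0)" using v by blast
next
  have "indep (e # f # xs @ us @ vs)" by (rule indep_perm[OF ind]) auto
  from dual_vector[OF finV subV ndV this] V obtain v where
    v: "B v e = 1" "B v f = 0" "\<forall>x\<in>set (xs @ us @ vs). B v x = 0" by auto
  have "N v = tr (us @ e # f # vs) (us @ e # f # vs) v" using v by (intro N_tr) simp
  also have "\<dots> = f" using tr_append_dual[OF ev, of v vs e f] v by simp
  finally show "\<exists>v. N v = f \<and> B v e = 1 \<and> B v f = 0 \<and> (\<forall>x\<in>set (xs @ us @ vs). B v x = 0)" using v by blast
qed

text \<open>If \<open>e = N v\<close> with \<open>v\<close> dual to the partner of \<open>e\<close>,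
  then \<open>c e x = B v x\<close>, and duality gives the hyperbolic Gram matrix. So being
  hyperbolic for \<open>c\<close> does not restrict the list; it is a consequence of building
  \<open>N\<close> from it.\<close>

lemma tuple_frame:
  assumes ind: "indep (xs @ ws)" and V: "set (xs @ ws) \<subseteq> V" and ev: "even (length ws)"
    and N_tr: "\<And>v. \<forall>x\<in>set xs. B v x = 0 \<Longrightarrow> N v = tr ws ws v"
  shows "set ws \<subseteq> W" and "c.hyperbolic ws"
proof -
  have sub: "set vs \<subseteq> W" if "ws = us @ vs" "even (length us)" "even (length vs)" for us vs
    using that
  proof (induction vs arbitrary: us rule: induct_list012)
    case (3 e f vs)
    have "e \<in> W" using tuple_frame_aux(1)[of xs us e f vs] ind V N_tr 3(3,4) by auto
    moreover have "f \<in> W" using tuple_frame_aux(2)[of xs us e f vs] ind V N_tr 3(3,4) by auto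
    moreover have "set vs \<subseteq> W" using 3(1)[of "us @ [e, f]"] 3(3-5) by simp
    ultimately show ?case by simp
  qed auto
  show W: "set ws \<subseteq> W" using sub[of "[]" ws] ev by simp
  have "c.hyperbolic vs" if "ws = us @ vs" "even (length us)" "even (length vs)" for us vs
    using that
  proof (induction vs arbitrary: us rule: induct_list012)
    case (3 e f vs)
    have m: "e \<in> W" "f \<in> W" "set vs \<subseteq> W" using W 3(3) by auto
    obtain v where v: "N v = e" "B v f = 1" "\<forall>x\<in>set vs. B v x = 0"
      using tuple_frame_aux(1)[of xs us e f vs] ind V N_tr 3(3,4) by auto
    obtain v' where v': "N v' = f" "\<forall>x\<in>set vs. B v' x = 0"
      using tuple_frame_aux(2)[of xs us e f vs] ind V N_tr 3(3,4) by auto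
    have "c e f = 1" using c_eval[OF m(2), of v] v by simp
    moreover have "c e x = 0" "c f x = 0" if "x \<in> set vs" for x
      using c_eval[of x v] c_eval[of x v'] v v' m(3) that by auto
    moreover have "c.hyperbolic vs" using 3(1)[of "us @ [e, f]"] 3(3-5) by simp
    ultimately show ?case by simp
  qed auto
  then show "c.hyperbolic ws" using ev by (metis append_Nil even_zero list.size(3))
qed

section \<open>Totally singular images: the tuples that yield N\<close>

lemma fibre_A_sub:
  assumes ws: "ws \<in> sing_tuples (2 * s) V" and eq: "N = tr ws ws"
  shows "ws \<in> c.frames s W" and "span (set ws) = W"
proof -
  have "set ws \<subseteq> W" "c.hyperbolic ws"
    using tuple_frame[of "[]" ws] ws eq by (auto simp: sing_tuples_def)
  then show "ws \<in> c.frames s W" using ws by (simp add: c.frames_def sing_tuples_def)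
  have "N x \<in> span (set ws)" for x unfolding eq by (rule tr_span)
  then show "span (set ws) = W" using span_minimal[OF \<open>set ws \<subseteq> W\<close> subW] by blast
qed

lemma frames_span:
  assumes "finite U" "subspace U" "c.alt U" "c.nondeg U" "card U = q ^ (2 * s)" "ws \<in> c.frames s U"
  shows "span (set ws) = U" and "indep ws"
proof -
  have "x \<in> span (set ws)" if "x \<in> U" for x
    using c.tr_id[OF assms that] c.tr_span[of ws ws x] by simp
  moreover have "set ws \<subseteq> U" using assms by (simp add: c.frames_def)
  ultimately show "span (set ws) = U" using span_minimal[of "set ws" U] assms by blast
  then show "indep ws" using assms by (simp add: indep_def c.frames_def)
qed

lemma fibre_A_sup:
  assumes sing: "\<forall>w\<in>W. \<nu> w = 0" and W: "card W = q ^ (2 * s)" and ws: "ws \<in> c.frames s W"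
  shows "ws \<in> sing_tuples (2 * s) V" and "N = tr ws ws"
proof -
  have alt: "c.alt W" using sing c_diag by (auto simp: c.alt_def)
  have sp: "span (set ws) = W" "indep ws" using frames_span[OF finW subW alt c_nondeg W ws] by auto
  have ws': "length ws = 2 * s" "set ws \<subseteq> W" using ws by (auto simp: c.frames_def)
  then show "ws \<in> sing_tuples (2 * s) V" using sp sing WV by (auto simp: sing_tuples_def)
  show "N = tr ws ws"
  proof
    fix v
    have "N v = c.tr ws ws (N v)" using c.tr_id[OF finW subW alt c_nondeg W ws] by simp
    then show "N v = tr ws ws v" using c_tr[OF ws'(2)] by simp
  qed
qed

text \<open>On the totally isotropic subspace \<open>W\<close> the form \<open>\<nu>\<close> is the square of a linear functional.\<close>

lemma sqrt_vector_exists: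
  assumes "\<exists>w\<in>W. \<nu> w \<noteq> 0"
  obtains u where "u \<in> W" "\<And>w. w \<in> W \<Longrightarrow> (c u w)\<^sup>2 = \<nu> w"
proof -
  have add: "\<nu> (x + y) = \<nu> x + \<nu> y" if "x \<in> W" "y \<in> W" for x y
    using nu_add B_W[OF that] by simp
  let ?K = "{w \<in> W. \<nu> w = 0}"
  have K: "finite ?K" "subspace ?K" "?K \<subseteq> W"
    using finW subW by (auto simp: subspace_def add nu_scale)
  have cK: "q * card ?K = card W"
    using assms by (intro card_fibre_sq finW subW add nu_scale)
  \<comment> \<open>The kernel \<open>?K\<close> has index \<open>q\<close>, so its perp is a line;
    a multiple of a generator \<open>u0\<close> will be the required vector.\<close>
  have "card (c.perp W ?K) * card ?K = card W"
    using c_nondeg by (intro c.perp_card finW subW K) (auto simp: c.nondeg_def)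
  then have "card (c.perp W ?K) * card ?K = q * card ?K" using cK by simp
  moreover have "card ?K \<noteq> 0" using K(1) subspace_0[OF K(2)] card_eq_0_iff[of ?K] by blast
  ultimately have "card (c.perp W ?K) = q" by (simp only: mult_cancel2) simp
  then have "c.perp W ?K \<noteq> {0}" using q_ge_2 by auto
  moreover have "0 \<in> c.perp W ?K" using subspace_0[OF subW] by (auto simp: c.perp_def)
  ultimately obtain u0 where u0: "u0 \<in> W" "\<And>w. w \<in> ?K \<Longrightarrow> c u0 w = 0" "u0 \<noteq> 0"
    by (auto simp: c.perp_def)
  obtain f0 where f0: "f0 \<in> W" "\<nu> f0 \<noteq> 0" using assms by blast
  obtain t where t: "t\<^sup>2 = inverse (\<nu> f0)" using sq_surj by blast
  define f where "f = t *s f0"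
  have f: "f \<in> W" "\<nu> f = 1"
    using f0 t subspace_scale[OF subW] by (auto simp: f_def nu_scale)
  \<comment> \<open>\<open>w + a *s f\<close> lies in the kernel, because
    \<open>\<nu> f = 1\<close>. So \<open>c u0\<close> is the square root of \<open>\<nu>\<close> up
    to the constant factor \<open>c u0 f\<close>.\<close>
  have dec: "c u0 w = a * c u0 f" if w: "w \<in> W" and a: "a\<^sup>2 = \<nu> w" for w a
  proof -
    have af: "a *s f \<in> W" using subspace_scale[OF subW f(1)] .
    then have "w + a *s f \<in> ?K" using w a f subspace_add[OF subW w af] by (simp add: add nu_scale)
    then have "c u0 (w + a *s f) = 0" by (rule u0(2))
    then show ?thesis by (simp add: c.B_simps add_eq_0)
  qed
  have nz: "c u0 f \<noteq> 0"
  proof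
    assume 0: "c u0 f = 0"
    have "c w u0 = 0" if w: "w \<in> W" for w
    proof -
      obtain a where "a\<^sup>2 = \<nu> w" using sq_surj by blast
      then show ?thesis using dec[OF w] 0 c_sym[OF w u0(1)] by simp
    qed
    then show False using c_nondeg u0 by (auto simp: c.nondeg_def)
  qed
  show ?thesis
  proof
    show "inverse (c u0 f) *s u0 \<in> W" using u0(1) subspace_scale[OF subW] by blast
    fix w assume w: "w \<in> W"
    obtain a where a: "a\<^sup>2 = \<nu> w" using sq_surj by blast
    have "c (inverse (c u0 f) *s u0) w = a" using dec[OF w a] nz by (simp add: c.B_simps mult.left_commute)
    then show "(c (inverse (c u0 f) *s u0) w)\<^sup>2 = \<nu> w" using a by simp
  qed
qed

lemma sqrt_vector_unique:
  assumes "u \<in> W" "u' \<in> W" "\<And>w. w \<in> W \<Longrightarrow> (c u w)\<^sup>2 = \<nu> w" "\<And>w. w \<in> W \<Longrightarrow> (c u' w)\<^sup>2 = \<nu> w"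
  shows "u' = u"
proof -
  have "c w (u + u') = 0" if w: "w \<in> W" for w
  proof -
    have "c u w = c u' w" using assms(3,4)[OF w] sq_inj by metis
    then show ?thesis using c_sym[OF w] assms(1,2) by (simp add: c.B_simps)
  qed
  then have "u + u' = 0" using c_nondeg subspace_add[OF subW assms(1,2)] by (auto simp: c.nondeg_def)
  then show ?thesis by (simp add: vadd_eq_0)
qed

end

section \<open>Images that are not totally singular\<close>

locale nil_sqrt = nil_form scale q B \<nu> V \<pi> c N
  for scale :: "'a::{field,finite} \<Rightarrow> 'b::ab_group_add \<Rightarrow> 'b" (infixr "*s" 75) and q :: nat
    and B :: "'b \<Rightarrow> 'b \<Rightarrow> 'a" and \<nu> :: "'b \<Rightarrow> 'a" and V :: "'b set" and \<pi> :: "'b \<Rightarrow> 'b"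
    and c :: "'b \<Rightarrow> 'b \<Rightarrow> 'a" and N :: "'b \<Rightarrow> 'b" +
  fixes u :: 'b
  assumes uW: "u \<in> W" and u_sq: "w \<in> W \<Longrightarrow> (c u w)\<^sup>2 = \<nu> w" and nonsing: "\<exists>w\<in>W. \<nu> w \<noteq> 0"
begin

definition K :: "'b set" where "K = {w \<in> W. \<nu> w = 0}"

lemma K_eq: "K = {w \<in> W. c u w = 0}"
  using u_sq by (force simp: K_def)

lemma KW: "K \<subseteq> W" and finK: "finite K" and subK: "subspace K"
  using finW subW finite_subset[of K W] by (auto simp: K_eq subspace_def c.B_simps)

lemma altK: "c.alt K"
  using c_diag by (auto simp: c.alt_def K_def)

text \<open>\<open>(c u u)\<^sup>2 = \<nu> u = c u u\<close>. By \<open>odd_card\<close> and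
  \<open>even_card\<close> this dichotomy is the parity of the rank, and so separates
  \<open>C_coeff\<close> from \<open>B_coeff\<close>.\<close>

lemma cuu: "c u u = 0 \<or> c u u = 1"
proof -
  have "(c u u)\<^sup>2 = c u u" using u_sq[OF uW] c_diag[OF uW] by simp
  then show ?thesis by (simp add: power2_eq_square)
qed

lemma c_u_nonzero: "\<exists>w\<in>W. c u w \<noteq> 0"
proof -
  obtain w where w: "w \<in> W" "\<nu> w \<noteq> 0" using nonsing by blast
  then have "c u w \<noteq> 0" using u_sq[OF w(1)] by auto
  then show ?thesis using w(1) by blast
qed

lemma card_K: "q * card K = card W"
proof -
  show ?thesis unfolding K_eq using c_u_nonzero by (intro card_fibre_linear finW subW) (auto simp: c.B_simps)
qed

lemma f_exists: obtains f where "f \<in> W" "c u f = 1"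
proof -
  obtain w where w: "w \<in> W" "c u w \<noteq> 0" using c_u_nonzero by blast
  then show ?thesis using that[of "inverse (c u w) *s w"] subspace_scale[OF subW] by (simp add: c.B_simps)
qed

lemma odd_decomp:
  assumes "c u u = 1" "w \<in> W"
  shows "w + c u w *s u \<in> K"
  using assms uW subspace_add[OF subW] subspace_scale[OF subW] by (simp add: K_eq c.B_simps)

lemma odd_nondeg:
  assumes 1: "c u u = 1"
  shows "c.nondeg K"
  unfolding c.nondeg_def
proof (intro ballI impI)
  fix k assume k: "k \<in> K" and h: "\<forall>v\<in>K. c v k = 0"
  have "c w k = 0" if w: "w \<in> W" for w
  proof -
    have "c (w + c u w *s u) k = 0" using h odd_decomp[OF 1 w] by blast
    then show ?thesis using k by (simp add: c.B_simps K_eq)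
  qed
  then show "k = 0" using c_nondeg k KW by (auto simp: c.nondeg_def)
qed

lemma odd_card:
  assumes "c u u = 1"
  obtains s where "card W = q ^ (2 * s + 1)"
  using c.alt_card_even[OF finK subK altK odd_nondeg[OF assms]] card_K by (metis Suc_eq_plus1 power_Suc)

lemma fibre_odd_sup:
  assumes 1: "c u u = 1" and W: "card W = q ^ (2 * s + 1)" and ws: "ws \<in> c.frames s K"
  shows "u # ws \<in> ext_tuples (2 * s) V" and "N = phi_odd u ws"
proof -
  have "q * card K = q * q ^ (2 * s)" using W card_K by simp
  then have cK: "card K = q ^ (2 * s)" by simp
  note fr = finK subK altK odd_nondeg[OF 1] cK ws
  have sp: "span (set ws) = K" "indep ws" using frames_span[OF fr] by auto
  have ws': "length ws = 2 * s" "set ws \<subseteq> K" using ws by (auto simp: c.frames_def)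
  have "ws \<in> sing_tuples (2 * s) V" using ws' sp KW WV by (auto simp: sing_tuples_def K_def)
  moreover have "\<nu> u = 1" using 1 c_diag[OF uW] by simp
  moreover have "B u w = 0" if "w \<in> K" for w using that B_W[OF uW] KW by blast
  ultimately show "u # ws \<in> ext_tuples (2 * s) V" using sp uW WV by (auto simp: ext_tuples_Cons)
  show "N = phi_odd u ws"
  proof
    fix v
    let ?k = "N v + c u (N v) *s u"
    \<comment> \<open>\<open>N v\<close> is the sum of a multiple of \<open>u\<close>, whose
      coefficient is computed here, and of \<open>?k\<close> in \<open>K\<close>, which the frame
      expands.\<close>
    have e: "c u (N v) = B v u" using c_eval[OF uW, of v] c_sym[OF uW, of "N v"] by simp
    have "?k = c.tr ws ws ?k" using c.tr_id[OF fr odd_decomp[OF 1]] by simp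
    also have "\<dots> = c.tr ws ws (N v)"
      using ws' by (intro c.tr_cong) (auto simp: c.B_simps K_eq)
    also have "\<dots> = tr ws ws v" using ws' KW by (intro c_tr) auto
    finally have "N v + B v u *s u = tr ws ws v" unfolding e .
    then show "N v = phi_odd u ws v" unfolding phi_odd_def by (metis add.commute vself_add_left)
  qed
qed

lemma even_f: "f \<in> W \<Longrightarrow> c u f = 1 \<Longrightarrow> c f f = 1"
  using u_sq[of f] c_diag[of f] by simp

lemma even_u:
  assumes "c u u = 0" "f \<in> W" "c u f = 1"
  shows "c f u = 1"
  using assms c_sym[OF uW] by simp

text \<open>The plane of \<open>u\<close> and \<open>f\<close> is not hyperbolic, since
  \<open>c f f = 1\<close>: its Gram matrix has rows \<open>(0, 1)\<close> and
  \<open>(1, 1)\<close>. The coefficients come from the inverse, with rows \<open>(1, 1)\<close> and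
  \<open>(1, 0)\<close>.\<close>

lemma even_decomp:
  assumes 0: "c u u = 0" and f: "f \<in> W" "c u f = 1" and w: "w \<in> W"
  shows "w + ((c w f + c w u) *s u + c w u *s f) \<in> c.hperp W u f"
proof -
  have "c f w = c w f" "c u w = c w u" using c_sym w f uW by auto
  then show ?thesis
    using 0 f w uW even_f[OF f] even_u[OF 0 f]
    by (auto simp: c.hperp_def c.B_simps subspace_add[OF subW] subspace_scale[OF subW] ac_simps)
qed

lemma even_nondeg:
  assumes 0: "c u u = 0" and f: "f \<in> W" "c u f = 1"
  shows "c.nondeg (c.hperp W u f)"
  unfolding c.nondeg_def
proof (intro ballI impI)
  fix k assume k: "k \<in> c.hperp W u f" and h: "\<forall>v\<in>c.hperp W u f. c v k = 0"
  have "c w k = 0" if w: "w \<in> W" for w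
  proof -
    have "c (w + ((c w f + c w u) *s u + c w u *s f)) k = 0" using h even_decomp[OF 0 f w] by blast
    then show ?thesis using k by (simp add: c.B_simps c.hperp_def)
  qed
  then show "k = 0" using c_nondeg k by (auto simp: c.nondeg_def c.hperp_def)
qed

text \<open>Orthogonality to \<open>u\<close> puts the complement inside \<open>K\<close>, where
  \<open>c\<close> is alternating although it is not so on \<open>W\<close>. As \<open>u\<close>
  itself lies in \<open>K\<close> and \<open>c f u = 1\<close>, orthogonality to \<open>f\<close>
  cuts \<open>K\<close> down by one more factor \<open>q\<close>.\<close>

lemma even_hperp:
  assumes 0: "c u u = 0" and f: "f \<in> W" "c u f = 1"
  shows "finite (c.hperp W u f)" "subspace (c.hperp W u f)" "c.alt (c.hperp W u f)" "c.hperp W u f \<subseteq> K"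
    "q * (q * card (c.hperp W u f)) = card W"
proof -
  show 1: "c.hperp W u f \<subseteq> K" by (auto simp: c.hperp_def K_eq)
  then show "finite (c.hperp W u f)" "c.alt (c.hperp W u f)"
    using finK altK finite_subset c.alt_mono by blast+
  show "subspace (c.hperp W u f)" using subW by (rule c.subspace_hperp)
  have "c.hperp W u f = {k \<in> K. c f k = 0}" by (auto simp: c.hperp_def K_eq)
  moreover have "q * card {k \<in> K. c f k = 0} = card K"
    using even_u[OF assms] uW 0
    by (intro card_fibre_linear finK subK) (auto simp: c.B_simps K_eq intro!: bexI[of _ u])
  ultimately show "q * (q * card (c.hperp W u f)) = card W" using card_K by simp
qed

lemma even_card:
  assumes 0: "c u u = 0"
  obtains s where "card W = q ^ (2 * s + 2)"
proof -
  obtain f where f: "f \<in> W" "c u f = 1" by (rule f_exists)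
  obtain s where "card (c.hperp W u f) = q ^ (2 * s)"
    using c.alt_card_even[OF even_hperp(1-3)[OF 0 f] even_nondeg[OF 0 f]] by blast
  then have "card W = q ^ (2 * s + 2)" using even_hperp(5)[OF 0 f] by simp
  then show ?thesis by (rule that)
qed

lemma fibre_even_sup:
  assumes 0: "c u u = 0" and f: "f \<in> W" "c u f = 1" and W: "card W = q ^ (2 * s + 2)"
    and ws: "ws \<in> c.frames s (c.hperp W u f)"
  shows "f # u # ws \<in> ext_tuples (2 * s + 1) V" and "N = phi_even f u ws"
proof -
  let ?H = "c.hperp W u f"
  have "q * (q * card ?H) = q * (q * q ^ (2 * s))" using W even_hperp(5)[OF 0 f] by simp
  then have cH: "card ?H = q ^ (2 * s)" by simp
  note fr = even_hperp(1-3)[OF 0 f] even_nondeg[OF 0 f] cH ws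
  have sp: "span (set ws) = ?H" "indep ws" using frames_span[OF fr] by auto
  have ws': "length ws = 2 * s" "set ws \<subseteq> ?H" using ws by (auto simp: c.frames_def)
  have HW: "?H \<subseteq> W" by (rule c.hperp_sub)
  have "u \<notin> ?H" using even_u[OF 0 f] by (simp add: c.hperp_def)
  then have ind: "indep (u # ws)" using sp by (simp add: indep_Cons)
  have "u \<in> K" using uW 0 by (simp add: K_eq)
  then have spK: "span (set (u # ws)) \<subseteq> K" using ws' even_hperp(4)[OF 0 f] subK by (intro span_minimal) auto
  have "set ws \<subseteq> V" using ws'(2) HW WV by (meson subset_trans)
  then have "u # ws \<in> sing_tuples (2 * s + 1) V"
    using ind spK ws'(1) WV uW by (auto simp: sing_tuples_def K_def)
  moreover have "\<nu> f = 1" using even_f[OF f] c_diag[OF f(1)] by simp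
  moreover have "B f w = 0" if "w \<in> K" for w using that B_W[OF f(1)] KW by blast
  ultimately show "f # u # ws \<in> ext_tuples (2 * s + 1) V" using spK f WV by (auto simp: ext_tuples_Cons)
  show "N = phi_even f u ws"
  proof
    fix v
    have e: "c (N v) u = B v u" "c (N v) f = B v f" using c_eval uW f by auto
    let ?k = "N v + ((B v f + B v u) *s u + B v u *s f)"
    have k: "?k \<in> ?H" using even_decomp[OF 0 f, of "N v"] e by simp
    have "?k = c.tr ws ws ?k" using c.tr_id[OF fr k] by simp
    also have "\<dots> = c.tr ws ws (N v)"
      using ws' by (intro c.tr_cong) (auto simp: c.B_simps c.hperp_def)
    also have "\<dots> = tr ws ws v" using ws' HW by (intro c_tr) auto
    finally have "tr ws ws v = ?k" by simp
    then show "N v = phi_even f u ws v" unfolding phi_even_def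
      by (simp add: scale_left_distrib scale_right_distrib ac_simps)
  qed
qed

end

section \<open>Reading the standard basis of the form off a tuple\<close>

context nil_form
begin

text \<open>\<open>N\<close> sends the vector \<open>v\<close> dual to \<open>u\<close> to
  \<open>u\<close>, so \<open>c u x = B v x\<close> on \<open>W\<close>. The first conclusion makes
  \<open>u\<close> the square root vector of \<open>\<nu>\<close>, hence determined by
  \<open>N\<close>.\<close>

lemma fibre_odd_sub:
  assumes t: "u # ws \<in> ext_tuples (2 * s) V" and eq: "N = phi_odd u ws"
  shows "nil_sqrt scale q B \<nu> V \<pi> c N u" and "c u u = 1" and "card W = q ^ (2 * s + 1)"
    and "ws \<in> c.frames s {w \<in> W. \<nu> w = 0}"
proof -
  have ws: "ws \<in> sing_tuples (2 * s) V" and u: "u \<in> V" "\<nu> u = 1" and p: "\<And>w. w \<in> span (set ws) \<Longrightarrow> B u w = 0"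
    using t by (auto simp: ext_tuples_Cons)
  have ind: "indep (u # ws)" by (rule ext_tuples_indep[OF t])
  have V: "set (u # ws) \<subseteq> V" using ws u by (auto simp: sing_tuples_def)
  have len: "length ws = 2 * s" using ws by (simp add: sing_tuples_def)
  have fr: "set ws \<subseteq> W" "c.hyperbolic ws"
    using tuple_frame[of "[u]" ws] ind V len by (auto simp: eq phi_odd_def)
  obtain v where v: "B v u = 1" "\<forall>w\<in>set ws. B v w = 0" using dual_vector[OF finV subV ndV ind V] by blast
  have "tr ws ws v = 0" using v by (intro tr_singular_0[OF ws]) auto
  then have Nv: "N v = u" using v by (simp add: eq phi_odd_def)
  then have uW: "u \<in> W" by blast
  show c1: "c u u = 1" using c_eval[OF uW, of v] v Nv by simp
  have cw: "c u w = 0" if "w \<in> span (set ws)" for w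
  proof (rule c.zero_on_span[OF _ that], rule ballI)
    fix x assume "x \<in> set ws"
    then show "c u x = 0" using c_eval[of x v] fr(1) v Nv by auto
  qed
  have "N x \<in> span (set (u # ws))" for x
  proof -
    have "tr ws ws x \<in> span (set (u # ws))" using tr_span[of ws ws x] span_mono[of "set ws" "set (u # ws)"] by auto
    then show ?thesis unfolding eq phi_odd_def by (intro span_add span_scale) (auto intro: span_base)
  qed
  then have sp: "W = span (set (u # ws))" using span_minimal[of "set (u # ws)" W] fr(1) uW subW by auto
  then show "card W = q ^ (2 * s + 1)" using ind len by (simp add: indep_def)
  have sq: "(c u w)\<^sup>2 = \<nu> w" if "w \<in> W" for w
  proof -
    obtain k y where y: "w = k *s u + y" "y \<in> span (set ws)"
      using \<open>w \<in> W\<close> unfolding sp by (auto elim: span_insertE)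
    then have "\<nu> y = 0" using ws by (simp add: sing_tuples_def)
    then show ?thesis using y cw[OF y(2)] p[OF y(2)] c1 u by (simp add: c.B_simps B_simps nu_add nu_scale)
  qed
  show "nil_sqrt scale q B \<nu> V \<pi> c N u"
  proof unfold_locales
    show "\<exists>w\<in>W. \<nu> w \<noteq> 0" using u(2) by (intro bexI[OF _ uW]) simp
  qed (rule uW, rule sq)
  show "ws \<in> c.frames s {w \<in> W. \<nu> w = 0}"
    using fr len ws by (auto simp: c.frames_def sing_tuples_def span_base)
qed

lemma fibre_even_sub:
  assumes t: "f # u # ws \<in> ext_tuples (2 * s + 1) V" and eq: "N = phi_even f u ws"
  shows "nil_sqrt scale q B \<nu> V \<pi> c N u" and "c u u = 0" and "card W = q ^ (2 * s + 2)"
    and "f \<in> W" and "c u f = 1" and "ws \<in> c.frames s (c.hperp W u f)"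
proof -
  have uws: "u # ws \<in> sing_tuples (2 * s + 1) V" and f: "f \<in> V" "\<nu> f = 1"
    and p: "\<And>w. w \<in> span (set (u # ws)) \<Longrightarrow> B f w = 0"
    using t by (auto simp: ext_tuples_Cons)
  have ind: "indep (f # u # ws)" by (rule ext_tuples_indep[OF t])
  then have ind2: "indep (u # f # ws)" by (rule indep_perm) auto
  have V: "set (f # u # ws) \<subseteq> V" using uws f by (auto simp: sing_tuples_def)
  have len: "length ws = 2 * s" using uws by (simp add: sing_tuples_def)
  have "span (set ws) \<subseteq> span (set (u # ws))" by (intro span_mono) auto
  then have ws: "ws \<in> sing_tuples (2 * s) V" using uws by (auto simp: sing_tuples_def indep_Cons)
  have fr: "set ws \<subseteq> W" "c.hyperbolic ws"
    using tuple_frame[of "[f, u]" ws] ind V len by (auto simp: eq phi_even_def)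
  obtain v where v: "B v f = 1" "B v u = 0" "\<forall>w\<in>set ws. B v w = 0"
    using dual_vector[OF finV subV ndV ind V] by auto
  obtain v' where v': "B v' u = 1" "B v' f = 0" "\<forall>w\<in>set ws. B v' w = 0"
    using dual_vector[OF finV subV ndV ind2] V by auto
  have "tr ws ws v = 0" "tr ws ws v' = 0" using v v' by (auto intro!: tr_singular_0[OF ws])
  \<comment> \<open>Here \<open>v\<close> is dual to \<open>f\<close> and \<open>v'\<close> to
    \<open>u\<close>; their images are the rows of the inverse Gram matrix. So \<open>f\<close>, as
    the sum of both images, is in \<open>W\<close>.\<close>
  then have Nv: "N v = u" "N v' = u + f" using v v' by (simp_all add: eq phi_even_def)
  then have uW: "u \<in> W" by blast
  have "u + (u + f) \<in> W" using Nv uW subspace_add[OF subW] by (metis rangeI)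
  then show fW: "f \<in> W" by simp
  show c0: "c u u = 0" using c_eval[OF uW, of v] v Nv by simp
  show c1: "c u f = 1" using c_eval[OF fW, of v] v Nv by simp
  have cws: "c u x = 0" "c f x = 0" if x: "x \<in> set ws" for x
  proof -
    have "x \<in> W" using x fr by blast
    from c_eval[OF this, of v] c_eval[OF this, of v'] show "c u x = 0" "c f x = 0"
      using v v' x Nv by (auto simp: c.B_simps)
  qed
  have cw: "c u w = 0" if "w \<in> span (set (u # ws))" for w
    using c0 cws by (intro c.zero_on_span[OF _ that]) auto
  have "N x \<in> span (set (f # u # ws))" for x
  proof -
    have "tr ws ws x \<in> span (set (f # u # ws))"
      using tr_span[of ws ws x] span_mono[of "set ws" "set (f # u # ws)"] by auto
    then show ?thesis unfolding eq phi_even_def by (intro span_add span_scale) (auto intro: span_base)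
  qed
  then have sp: "W = span (set (f # u # ws))"
    using span_minimal[of "set (f # u # ws)" W] fr(1) uW fW subW by auto
  then show "card W = q ^ (2 * s + 2)" using ind len by (simp add: indep_def)
  have sq: "(c u w)\<^sup>2 = \<nu> w" if "w \<in> W" for w
  proof -
    obtain k y where y: "w = k *s f + y" "y \<in> span (set (u # ws))"
      using \<open>w \<in> W\<close> unfolding sp by (auto elim: span_insertE)
    then have "\<nu> y = 0" using uws by (simp add: sing_tuples_def)
    then show ?thesis using y cw[OF y(2)] p[OF y(2)] c1 f by (simp add: c.B_simps B_simps nu_add nu_scale)
  qed
  show "nil_sqrt scale q B \<nu> V \<pi> c N u"
  proof unfold_locales
    show "\<exists>w\<in>W. \<nu> w \<noteq> 0" using f(2) by (intro bexI[OF _ fW]) simp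
  qed (rule uW, rule sq)
  show "ws \<in> c.frames s (c.hperp W u f)"
    using fr len cws by (auto simp: c.frames_def c.hperp_def)
qed

end

section \<open>Counting the maps N by rank\<close>

context orthogonal_space
begin

definition nil_sing :: "nat \<Rightarrow> ('b \<Rightarrow> 'b) set" where
  "nil_sing r = {N \<in> nils. (\<forall>w\<in>range N. \<nu> w = 0) \<and> card (range N) = q ^ r}"

definition nil_nonsing :: "nat \<Rightarrow> ('b \<Rightarrow> 'b) set" where
  "nil_nonsing r = {N \<in> nils. (\<exists>w\<in>range N. \<nu> w \<noteq> 0) \<and> card (range N) = q ^ r}"

lemma finite_nils: "finite nils"
proof (rule inj_on_finite)
  show "inj_on (\<lambda>N. restrict N V) nils"
  proof (rule inj_onI)
    fix N M assume N: "N \<in> nils" and M: "M \<in> nils" and eq: "restrict N V = restrict M V"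
    have "N x = M x" for x
    proof -
      have "N (\<pi> x) = M (\<pi> x)" using fun_cong[OF eq, of "\<pi> x"] pi_in by simp
      then show ?thesis using nilsD(3)[OF N] nilsD(3)[OF M] by simp
    qed
    then show "N = M" by blast
  qed
  show "(\<lambda>N. restrict N V) ` nils \<subseteq> V \<rightarrow>\<^sub>E V" using nilsD(4) by auto
  show "finite (V \<rightarrow>\<^sub>E V)" using finV by (intro finite_PiE) auto
qed

lemma nil_form_exists:
  assumes "N \<in> nils"
  obtains c where "nil_form scale q B \<nu> V \<pi> c N"
proof -
  obtain c where c: "bilin scale q c" "\<And>x y. c (N x) (N y) = B x (N y)" using form_on_range[OF assms] by blast
  interpret c: bilin scale q c by (rule c(1))
  have "nil_form scale q B \<nu> V \<pi> c N" by unfold_locales (rule assms, rule c(2))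
  then show ?thesis by (rule that)
qed

lemma card_sing_tuples_even:
  "card (sing_tuples (2 * s) V) = card (nil_sing (2 * s)) * spord s"
proof (rule card_fibres_const[of _ _ "\<lambda>ws. tr ws ws"])
  show "finite (sing_tuples (2 * s) V)" using finite_sing_tuples[OF finV] .
  show "finite (nil_sing (2 * s))" using finite_nils by (simp add: nil_sing_def)
  show "(\<lambda>ws. tr ws ws) ` sing_tuples (2 * s) V \<subseteq> nil_sing (2 * s)"
  proof (intro subsetI, elim imageE)
    fix N ws assume eq: "N = tr ws ws" and ws: "ws \<in> sing_tuples (2 * s) V"
    have N: "N \<in> nils" unfolding eq by (rule tr_nils[OF ws])
    obtain c where "nil_form scale q B \<nu> V \<pi> c N" using nil_form_exists[OF N] .
    then interpret n: nil_form scale q B \<nu> V \<pi> c N .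
    have "span (set ws) = range N" using n.fibre_A_sub(2)[OF ws eq] .
    then show "N \<in> nil_sing (2 * s)" using N ws by (auto simp: nil_sing_def sing_tuples_def indep_def)
  qed
  fix N assume "N \<in> nil_sing (2 * s)"
  then have N: "N \<in> nils" and s: "\<forall>w\<in>range N. \<nu> w = 0" and W: "card (range N) = q ^ (2 * s)"
    by (auto simp: nil_sing_def)
  obtain c where "nil_form scale q B \<nu> V \<pi> c N" using nil_form_exists[OF N] .
  then interpret n: nil_form scale q B \<nu> V \<pi> c N .
  have "{ws \<in> sing_tuples (2 * s) V. tr ws ws = N} = n.c.frames s (range N)"
  proof (intro equalityI subsetI)
    fix ws assume "ws \<in> {ws \<in> sing_tuples (2 * s) V. tr ws ws = N}"
    then show "ws \<in> n.c.frames s (range N)" using n.fibre_A_sub(1) by blast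
  next
    fix ws assume "ws \<in> n.c.frames s (range N)"
    from n.fibre_A_sup[OF s W this] show "ws \<in> {ws \<in> sing_tuples (2 * s) V. tr ws ws = N}" by simp
  qed
  moreover have "n.c.alt (range N)" using s n.c_diag by (auto simp: n.c.alt_def)
  then have "card (n.c.frames s (range N)) = n.c.spord s"
    using n.c.card_frames[OF n.finW n.subW _ n.c_nondeg W] by blast
  ultimately show "card {ws \<in> sing_tuples (2 * s) V. tr ws ws = N} = spord s" by simp
qed

lemma nil_sqrt_exists:
  assumes "nil_form scale q B \<nu> V \<pi> c N" "\<exists>w\<in>range N. \<nu> w \<noteq> 0"
  obtains u where "nil_sqrt scale q B \<nu> V \<pi> c N u"
proof -
  interpret n: nil_form scale q B \<nu> V \<pi> c N by (rule assms(1))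
  obtain u where u: "u \<in> range N" "\<And>w. w \<in> range N \<Longrightarrow> (c u w)\<^sup>2 = \<nu> w"
    using n.sqrt_vector_exists[OF assms(2)] by blast
  have "nil_sqrt scale q B \<nu> V \<pi> c N u" by unfold_locales (rule u(1), rule u(2), assumption, rule assms(2))
  then show ?thesis by (rule that)
qed

text \<open>In a fibre the head is forced, being the unique \<open>u\<close> of \<open>N\<close>;
  only the frame of \<open>K\<close> is free.\<close>

lemma card_ext_tuples_even:
  "card (ext_tuples (2 * s) V) = card (nil_nonsing (2 * s + 1)) * spord s"
proof (rule card_fibres_const[of _ _ "\<lambda>t. phi_odd (hd t) (tl t)"])
  have C: "\<exists>u ws. t = u # ws" if "t \<in> ext_tuples r V" for t r using that by (auto simp: ext_tuples_def)
  show "finite (ext_tuples (2 * s) V)"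
    by (rule finite_subset[OF _ finite_lists_length_eq[OF finV, of "Suc (2 * s)"]])
      (auto simp: ext_tuples_def sing_tuples_def perp_def)
  show "finite (nil_nonsing (2 * s + 1))" using finite_nils by (simp add: nil_nonsing_def)
  show "(\<lambda>t. phi_odd (hd t) (tl t)) ` ext_tuples (2 * s) V \<subseteq> nil_nonsing (2 * s + 1)"
  proof (intro subsetI, elim imageE)
    fix N t assume eq: "N = phi_odd (hd t) (tl t)" and t: "t \<in> ext_tuples (2 * s) V"
    obtain u ws where tu: "t = u # ws" using C[OF t] by blast
    have N: "N \<in> nils" using phi_odd_nils t eq tu by simp
    obtain c where "nil_form scale q B \<nu> V \<pi> c N" using nil_form_exists[OF N] .
    then interpret n: nil_form scale q B \<nu> V \<pi> c N .
    have t': "u # ws \<in> ext_tuples (2 * s) V" "N = phi_odd u ws" using t eq tu by auto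
    interpret m: nil_sqrt scale q B \<nu> V \<pi> c N u using n.fibre_odd_sub(1)[OF t'] .
    show "N \<in> nil_nonsing (2 * s + 1)"
      using N m.nonsing n.fibre_odd_sub(3)[OF t'] by (simp add: nil_nonsing_def)
  qed
  fix N assume "N \<in> nil_nonsing (2 * s + 1)"
  then have N: "N \<in> nils" and ns: "\<exists>w\<in>range N. \<nu> w \<noteq> 0" and W: "card (range N) = q ^ (2 * s + 1)"
    by (auto simp: nil_nonsing_def)
  obtain c where nf: "nil_form scale q B \<nu> V \<pi> c N" using nil_form_exists[OF N] .
  interpret n: nil_form scale q B \<nu> V \<pi> c N by (rule nf)
  obtain u where "nil_sqrt scale q B \<nu> V \<pi> c N u" using nil_sqrt_exists[OF nf ns] .
  then interpret m: nil_sqrt scale q B \<nu> V \<pi> c N u .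
  have 1: "c u u = 1"
  proof (rule ccontr)
    assume "c u u \<noteq> 1"
    then have "c u u = 0" using m.cuu by simp
    then obtain t where "card (range N) = q ^ (2 * t + 2)" using m.even_card by blast
    then have "2 * t + 2 = 2 * s + 1" using W by (metis q_power_inject)
    then show False by presburger
  qed
  have "{t \<in> ext_tuples (2 * s) V. phi_odd (hd t) (tl t) = N} = (#) u ` n.c.frames s m.K"
  proof (intro equalityI subsetI)
    fix t assume t: "t \<in> {t \<in> ext_tuples (2 * s) V. phi_odd (hd t) (tl t) = N}"
    obtain u' ws where tu: "t = u' # ws" using C t by blast
    have t': "u' # ws \<in> ext_tuples (2 * s) V" "N = phi_odd u' ws" using t tu by auto
    interpret m': nil_sqrt scale q B \<nu> V \<pi> c N u' using n.fibre_odd_sub(1)[OF t'] .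
    have "u' = u" using n.sqrt_vector_unique[OF m.uW m'.uW m.u_sq m'.u_sq] .
    then show "t \<in> (#) u ` n.c.frames s m.K"
      using n.fibre_odd_sub(4)[OF t'] tu by (simp add: m.K_def)
  next
    fix t assume "t \<in> (#) u ` n.c.frames s m.K"
    then obtain ws where ws: "t = u # ws" "ws \<in> n.c.frames s m.K" by blast
    then show "t \<in> {t \<in> ext_tuples (2 * s) V. phi_odd (hd t) (tl t) = N}"
      using m.fibre_odd_sup[OF 1 W ws(2)] by simp
  qed
  moreover have "q * card m.K = q * q ^ (2 * s)" using W m.card_K by simp
  then have "card m.K = q ^ (2 * s)" by simp
  then have "card (n.c.frames s m.K) = n.c.spord s"
    using n.c.card_frames[OF m.finK m.subK m.altK m.odd_nondeg[OF 1]] by blast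
  ultimately show "card {t \<in> ext_tuples (2 * s) V. phi_odd (hd t) (tl t) = N} = spord s"
    by (simp add: card_image)
qed

text \<open>Here \<open>u\<close> is forced, but \<open>f\<close> ranges over the affine hyperplane
  \<open>c u f = 1\<close> of \<open>W\<close>, which gives the factor
  \<open>q ^ (2 * s + 1)\<close>. The complement to be framed changes with \<open>f\<close>, its
  size does not.\<close>

lemma card_ext_tuples_odd:
  "card (ext_tuples (2 * s + 1) V) = card (nil_nonsing (2 * s + 2)) * (q ^ (2 * s + 1) * spord s)"
proof (rule card_fibres_const[of _ _ "\<lambda>t. phi_even (hd t) (hd (tl t)) (tl (tl t))"])
  let ?phi = "\<lambda>t. phi_even (hd t) (hd (tl t)) (tl (tl t))"
  have C: "\<exists>f u ws. t = f # u # ws" if "t \<in> ext_tuples (2 * s + 1) V" for t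
    using that by (auto simp: ext_tuples_def sing_tuples_def length_Suc_conv)
  show "finite (ext_tuples (2 * s + 1) V)"
    by (rule finite_subset[OF _ finite_lists_length_eq[OF finV, of "2 * s + 2"]])
      (auto simp: ext_tuples_def sing_tuples_def perp_def)
  show "finite (nil_nonsing (2 * s + 2))" using finite_nils by (simp add: nil_nonsing_def)
  show "?phi ` ext_tuples (2 * s + 1) V \<subseteq> nil_nonsing (2 * s + 2)"
  proof (intro subsetI, elim imageE)
    fix N t assume eq: "N = ?phi t" and t: "t \<in> ext_tuples (2 * s + 1) V"
    obtain f u ws where tu: "t = f # u # ws" using C[OF t] by blast
    have N: "N \<in> nils" using phi_even_nils t eq tu by simp
    obtain c where "nil_form scale q B \<nu> V \<pi> c N" using nil_form_exists[OF N] .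
    then interpret n: nil_form scale q B \<nu> V \<pi> c N .
    have t': "f # u # ws \<in> ext_tuples (2 * s + 1) V" "N = phi_even f u ws" using t eq tu by auto
    interpret m: nil_sqrt scale q B \<nu> V \<pi> c N u using n.fibre_even_sub(1)[OF t'] .
    show "N \<in> nil_nonsing (2 * s + 2)"
      using N m.nonsing n.fibre_even_sub(3)[OF t'] by (simp add: nil_nonsing_def)
  qed
  fix N assume "N \<in> nil_nonsing (2 * s + 2)"
  then have N: "N \<in> nils" and ns: "\<exists>w\<in>range N. \<nu> w \<noteq> 0" and W: "card (range N) = q ^ (2 * s + 2)"
    by (auto simp: nil_nonsing_def)
  obtain c where nf: "nil_form scale q B \<nu> V \<pi> c N" using nil_form_exists[OF N] .
  interpret n: nil_form scale q B \<nu> V \<pi> c N by (rule nf)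
  obtain u where "nil_sqrt scale q B \<nu> V \<pi> c N u" using nil_sqrt_exists[OF nf ns] .
  then interpret m: nil_sqrt scale q B \<nu> V \<pi> c N u .
  have 0: "c u u = 0"
  proof (rule ccontr)
    assume "c u u \<noteq> 0"
    then have "c u u = 1" using m.cuu by simp
    then obtain t where "card (range N) = q ^ (2 * t + 1)" using m.odd_card by blast
    then have "2 * t + 1 = 2 * s + 2" using W by (metis q_power_inject)
    then show False by presburger
  qed
  let ?F = "{f \<in> range N. c u f = 1}"
  have "{t \<in> ext_tuples (2 * s + 1) V. ?phi t = N} =
      {f # u # ws | f ws. f \<in> ?F \<and> ws \<in> n.c.frames s (n.c.hperp (range N) u f)}"
  proof (intro equalityI subsetI)
    fix t assume t: "t \<in> {t \<in> ext_tuples (2 * s + 1) V. ?phi t = N}"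
    obtain f u' ws where tu: "t = f # u' # ws" using C t by blast
    have t': "f # u' # ws \<in> ext_tuples (2 * s + 1) V" "N = phi_even f u' ws" using t tu by auto
    interpret m': nil_sqrt scale q B \<nu> V \<pi> c N u' using n.fibre_even_sub(1)[OF t'] .
    have "u' = u" using n.sqrt_vector_unique[OF m.uW m'.uW m.u_sq m'.u_sq] .
    then show "t \<in> {f # u # ws | f ws. f \<in> ?F \<and> ws \<in> n.c.frames s (n.c.hperp (range N) u f)}"
      using n.fibre_even_sub(4-6)[OF t'] tu by blast
  next
    fix t assume "t \<in> {f # u # ws | f ws. f \<in> ?F \<and> ws \<in> n.c.frames s (n.c.hperp (range N) u f)}"
    then obtain f ws where t: "t = f # u # ws" "f \<in> range N" "c u f = 1"
      "ws \<in> n.c.frames s (n.c.hperp (range N) u f)" by blast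
    then show "t \<in> {t \<in> ext_tuples (2 * s + 1) V. ?phi t = N}"
      using m.fibre_even_sup[OF 0 t(2,3) W t(4)] by simp
  qed
  moreover have "card {f # u # ws | f ws. f \<in> ?F \<and> ws \<in> n.c.frames s (n.c.hperp (range N) u f)} = card ?F * n.c.spord s"
  proof (rule card_Cons_image)
    show "finite ?F" using n.finW by simp
    fix f assume "f \<in> ?F"
    then have f: "f \<in> range N" "c u f = 1" by auto
    show "finite (n.c.frames s (n.c.hperp (range N) u f))"
      using m.even_hperp(1)[OF 0 f] by (rule n.c.finite_frames)
    have "q * (q * card (n.c.hperp (range N) u f)) = q * (q * q ^ (2 * s))"
      using m.even_hperp(5)[OF 0 f] W by simp
    then have "card (n.c.hperp (range N) u f) = q ^ (2 * s)" by simp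
    then show "card (n.c.frames s (n.c.hperp (range N) u f)) = n.c.spord s"
      using n.c.card_frames[OF m.even_hperp(1-3)[OF 0 f] m.even_nondeg[OF 0 f]] by blast
  qed auto
  moreover have "q * card ?F = q * q ^ (2 * s + 1)"
    using m.c_u_nonzero W
    by (subst card_fibre_linear[OF n.finW n.subW]) (auto simp: n.c.B_simps)
  then have "card ?F = q ^ (2 * s + 1)" using q_pos(2) by (simp only: mult_cancel1) simp
  ultimately show "card {t \<in> ext_tuples (2 * s + 1) V. ?phi t = N} = q ^ (2 * s + 1) * spord s"
    by simp
qed

lemma nil_sing_odd: "odd r \<Longrightarrow> nil_sing r = {}"
proof (rule equals0I)
  fix N assume r: "odd r" and "N \<in> nil_sing r"
  then have N: "N \<in> nils" and s: "\<forall>w\<in>range N. \<nu> w = 0" and W: "card (range N) = q ^ r"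
    by (auto simp: nil_sing_def)
  obtain c where "nil_form scale q B \<nu> V \<pi> c N" using nil_form_exists[OF N] .
  then interpret n: nil_form scale q B \<nu> V \<pi> c N .
  have "n.c.alt (range N)" using s n.c_diag by (auto simp: n.c.alt_def)
  then obtain m where "card (range N) = q ^ (2 * m)"
    using n.c.alt_card_even[OF n.finW n.subW _ n.c_nondeg] by blast
  then have "2 * m = r" using W by (metis q_power_inject)
  then show False using r by presburger
qed

lemma nil_nonsing_0: "nil_nonsing 0 = {}"
proof (rule equals0I)
  fix N assume "N \<in> nil_nonsing 0"
  then have N: "N \<in> nils" and ns: "\<exists>w\<in>range N. \<nu> w \<noteq> 0" and W: "card (range N) = 1"
    by (auto simp: nil_nonsing_def)
  have "0 \<in> range N" using nils_range(2)[OF N] by (rule subspace_0)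
  moreover obtain x where x: "range N = {x}" by (rule card_1_singletonE[OF W])
  ultimately have "x = 0" by (metis singletonD)
  then show False using ns unfolding x by simp
qed

lemma card_nils:
  assumes n: "card V = q ^ (2 * n)"
  shows "card nils = (\<Sum>r\<in>{0..n}. card (nil_sing r) + card (nil_nonsing r))"
proof -
  have eq: "nils = (\<Union>r\<in>{0..n}. nil_sing r \<union> nil_nonsing r)"
  proof (intro equalityI subsetI)
    fix N assume N: "N \<in> nils"
    obtain r where r: "card (range N) = q ^ r" using card_subspace[OF nils_range(1,2)[OF N]] .
    obtain c where "nil_form scale q B \<nu> V \<pi> c N" using nil_form_exists[OF N] .
    then interpret n: nil_form scale q B \<nu> V \<pi> c N .
    have "r \<le> n" using n.W_card_le[OF r n] .
    moreover have "N \<in> nil_sing r \<union> nil_nonsing r" using N r by (auto simp: nil_sing_def nil_nonsing_def)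
    ultimately show "N \<in> (\<Union>r\<in>{0..n}. nil_sing r \<union> nil_nonsing r)" by auto
  qed (auto simp: nil_sing_def nil_nonsing_def)
  have fin: "finite (nil_sing r)" "finite (nil_nonsing r)" for r
    using finite_nils by (auto simp: nil_sing_def nil_nonsing_def)
  have "card nils = (\<Sum>r\<in>{0..n}. card (nil_sing r \<union> nil_nonsing r))"
    unfolding eq
  proof (rule card_UN_disjoint)
    show "\<forall>i\<in>{0..n}. \<forall>j\<in>{0..n}. i \<noteq> j \<longrightarrow>
      (nil_sing i \<union> nil_nonsing i) \<inter> (nil_sing j \<union> nil_nonsing j) = {}"
    proof (intro ballI impI, rule equals0I)
      fix i j N assume ij: "i \<noteq> j" and "N \<in> (nil_sing i \<union> nil_nonsing i) \<inter> (nil_sing j \<union> nil_nonsing j)"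
      then have "q ^ i = q ^ j" by (auto simp: nil_sing_def nil_nonsing_def)
      then show False using ij by simp
    qed
  qed (use fin in auto)
  also have "\<dots> = (\<Sum>r\<in>{0..n}. card (nil_sing r) + card (nil_nonsing r))"
  proof (rule sum.cong[OF refl])
    fix r
    have "nil_sing r \<inter> nil_nonsing r = {}" by (auto simp: nil_sing_def nil_nonsing_def)
    then show "card (nil_sing r \<union> nil_nonsing r) = card (nil_sing r) + card (nil_nonsing r)"
      by (rule card_Un_disjoint[OF fin])
  qed
  finally show ?thesis .
qed

text \<open>\<open>card_isos\<close> needs a reference frame of the desired pattern. One exists
  because the number of such frames, \<open>oord \<epsilon> m\<close>, is positive.\<close>

lemma card_isos_orthogonal:
  assumes V: "qtype \<epsilon> m V" and m: "\<epsilon> = 1 \<or> m \<noteq> 0"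
  shows "int (card isos) = oord \<epsilon> m"
proof (cases m)
  case 0
  then have cV: "card V = q ^ (2 * 0)" using V by (simp add: qtype_def)
  have "card isos = card {ws \<in> frames 0 V. map \<nu> ws = map \<nu> []}" by (rule card_isos[OF cV]) simp
  also have "{ws \<in> frames 0 V. map \<nu> ws = map \<nu> []} = {[]}" by auto
  finally show ?thesis using 0 by simp
next
  case (Suc k)
  have e: "\<epsilon> = 1 \<or> \<epsilon> = -1" and cV: "card V = q ^ (2 * Suc k)" using V Suc by (auto simp: qtype_def)
  obtain \<alpha> where \<alpha>: "\<alpha> \<in> artin_schreier \<longleftrightarrow> \<epsilon> = 1" using artin_schreier_exists[OF e] .
  let ?F = "{ws \<in> frames (Suc k) V. map \<nu> ws = pattern k \<alpha>}"
  have c: "int (card ?F) = oord \<epsilon> (Suc k)"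
    using card_orthogonal_frames[OF _ \<alpha>, of k V] V Suc by simp
  then have "card ?F \<noteq> 0" using oord_pos[OF e, of "Suc k"] by linarith
  then have "?F \<noteq> {}" by (metis card.empty)
  then obtain ws0 where ws0: "ws0 \<in> frames (Suc k) V" "map \<nu> ws0 = pattern k \<alpha>" by blast
  have "card isos = card ?F" using card_isos[OF cV ws0(1)] ws0(2) by simp
  then show ?thesis using c Suc by simp
qed

lemma involution_terms:
  assumes V: "qtype \<epsilon> n V"
    and sp: "\<And>m. m \<le> n \<Longrightarrow> sp (2 * m) = spord m"
    and ort: "\<And>m. m \<le> n \<Longrightarrow> \<epsilon> = 1 \<or> m \<noteq> 0 \<Longrightarrow> int (ort (2 * m)) = oord \<epsilon> m"
    and n: "n \<ge> 1"
  shows "even r \<Longrightarrow> r \<le> n \<Longrightarrow> \<epsilon> = 1 \<or> r < n \<Longrightarrow>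
      real (ort (2 * n)) / real (A_coeff q n sp ort r) = real (card (nil_sing r))"
    and "\<epsilon> = -1 \<Longrightarrow> nil_sing n = {}"
    and "even r \<Longrightarrow> 1 \<le> r \<Longrightarrow> r \<le> n \<Longrightarrow>
      real (ort (2 * n)) / real (B_coeff q n sp r) = real (card (nil_nonsing r))"
    and "odd r \<Longrightarrow> r \<le> n \<Longrightarrow>
      real (ort (2 * n)) / real (C_coeff q n sp r) = real (card (nil_nonsing r))"
proof -
  have e: "\<epsilon> = 1 \<or> \<epsilon> = -1" using V by (auto simp: qtype_def)
  have on: "int (ort (2 * n)) = oord \<epsilon> n" using ort[of n] n by simp
  \<comment> \<open>All quotients are exact. The denominator is nonzero because its product with
    \<open>c\<close> is the positive group order.\<close>
  have quot: "real (ort (2 * n)) / real D = real c" if D: "int D * int c = oord \<epsilon> n" for D c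
  proof -
    have D0: "D \<noteq> 0"
    proof
      assume "D = 0"
      then show False using D oord_pos[OF e, of n] by simp
    qed
    have "int (D * c) = int (ort (2 * n))" using D on by simp
    then have "ort (2 * n) = D * c" by (simp only: of_nat_eq_iff)
    then show ?thesis using D0 by simp
  qed
  show "real (ort (2 * n)) / real (A_coeff q n sp ort r) = real (card (nil_sing r))"
    if r: "even r" "r \<le> n" "\<epsilon> = 1 \<or> r < n"
  proof (rule quot)
    obtain s where s: "r = 2 * s" using r(1) by blast
    obtain k where k: "n = r + k" using r(2) le_Suc_ex by blast
    have k0: "\<epsilon> = 1 \<or> k \<noteq> 0" using r(3) k by auto
    have "int (ort (2 * k)) = oord \<epsilon> k" using ort[OF _ k0] k by simp
    moreover have "2 * n - 2 * r = 2 * k" using k by simp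
    moreover have "sp r = spord s" using sp[of s] s r(2) by simp
    ultimately have A: "int (A_coeff q n sp ort r) = Q ^ (r * (r - 1) div 2 + r * (2 * k)) * int (spord s) * oord \<epsilon> k"
      by (simp add: A_coeff_def)
    have "int (card (sing_tuples r V)) = int (card (nil_sing r)) * int (spord s)"
      using card_sing_tuples_even[of s] unfolding s by simp
    then show "int (A_coeff q n sp ort r) * int (card (nil_sing r)) = oord \<epsilon> n"
      unfolding A sing_tuples_oord[OF V k k0, symmetric] by (simp only: mult_ac)
  qed
  show "nil_sing n = {}" if minus: "\<epsilon> = -1"
  proof (cases "even n")
    case True
    then obtain s where s: "n = 2 * s" by blast
    obtain r where r: "n = Suc r" using n by (cases n) auto
    \<comment> \<open>The factor \<open>Q ^ 0 + \<epsilon>\<close> of the last extension step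
      vanishes for the minus type.\<close>
    have "int (card (sing_tuples n V)) = 0"
      using card_sing_tuples_Suc[OF V, of r 0] r minus by simp
    then have "card (nil_sing n) * spord s = 0" using card_sing_tuples_even[of s] s by simp
    then have "card (nil_sing n) = 0" using spord_pos[of s] by simp
    moreover have "finite (nil_sing n)" using finite_nils by (simp add: nil_sing_def)
    ultimately show ?thesis by simp
  next
    case False
    then show ?thesis by (rule nil_sing_odd)
  qed
  show "real (ort (2 * n)) / real (B_coeff q n sp r) = real (card (nil_nonsing r))"
    if r: "even r" "1 \<le> r" "r \<le> n"
  proof (rule quot)
    obtain s where s: "r = 2 * s + 2"
    proof -
      obtain t where t: "r = 2 * t" using r(1) by blast
      then have "t \<noteq> 0" using r(2) by auto
      then obtain s where "t = Suc s" using not0_implies_Suc by blast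
      then show ?thesis using that[of s] t by simp
    qed
    obtain k where k: "n = r + k" using r(3) le_Suc_ex by blast
    have n': "n = Suc ((2 * s + 1) + k)" using k s by simp
    have k2: "2 * n - 2 * r = 2 * k" using k by simp
    \<comment> \<open>\<open>r * (r + 1) div 2\<close> exceeds the triangular part in
      \<open>ext_tuples_oord\<close> by \<open>r\<close>. After the \<open>- 1\<close> the surplus
      is \<open>2 * s + 1\<close>, the exponent in the number of choices of
      \<open>f\<close>.\<close>
    have E: "r * (r + 1) div 2 + (r - 1) * (2 * k) - 1 =
        (Suc (2 * s + 1) * (2 * s + 1) div 2 + (2 * s + 1) * (2 * k)) + (2 * s + 1)"
    proof -
      have "r * (r + 1) div 2 = Suc (2 * s + 1) * (2 * s + 1) div 2 + r"
        using triangle_Suc[of r] s by (simp add: mult.commute)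
      then show ?thesis using s by simp
    qed
    have "sp (r - 2) = spord s" "sp (2 * k) = spord k" using sp[of s] sp[of k] s k by simp_all
    then have B: "int (B_coeff q n sp r) =
        2 * (Q ^ (Suc (2 * s + 1) * (2 * s + 1) div 2 + (2 * s + 1) * (2 * k)) * Q ^ (2 * s + 1)) * int (spord s) * int (spord k)"
      unfolding B_coeff_def k2 E by (simp only: of_nat_mult of_nat_power power_add of_nat_numeral)
    have "int (card (ext_tuples (2 * s + 1) V)) = int (card (nil_nonsing r)) * (Q ^ (2 * s + 1) * int (spord s))"
      using card_ext_tuples_odd[of s] unfolding s by simp
    then show "int (B_coeff q n sp r) * int (card (nil_nonsing r)) = oord \<epsilon> n"
      unfolding B ext_tuples_oord[OF V n', symmetric] by (simp only: mult_ac)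
  qed
  show "real (ort (2 * n)) / real (C_coeff q n sp r) = real (card (nil_nonsing r))"
    if r: "odd r" "r \<le> n"
  proof (rule quot)
    obtain s where s: "r = 2 * s + 1" using r(1) by (auto elim: oddE)
    obtain k where k: "n = r + k" using r(2) le_Suc_ex by blast
    have n': "n = Suc (2 * s + k)" using k s by simp
    have k2: "2 * n - 2 * r = 2 * k" using k by simp
    have r': "r = Suc (2 * s)" using s by simp
    have "sp (2 * s) = spord s" "sp (2 * k) = spord k" using sp[of s] sp[of k] s k by simp_all
    then have C: "int (C_coeff q n sp r) =
        2 * Q ^ (Suc (2 * s) * (2 * s) div 2 + (2 * s) * (2 * k)) * int (spord s) * int (spord k)"
      unfolding C_coeff_def r' k2[unfolded r'] diff_Suc_1 by (simp only: of_nat_mult of_nat_power of_nat_numeral)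
    have "int (card (ext_tuples (2 * s) V)) = int (card (nil_nonsing r)) * int (spord s)"
      using card_ext_tuples_even[of s] unfolding s by simp
    then show "int (C_coeff q n sp r) * int (card (nil_nonsing r)) = oord \<epsilon> n"
      unfolding C ext_tuples_oord[OF V n', symmetric] by (simp only: mult_ac)
  qed
qed

text \<open>For the minus type \<open>l\<close> is \<open>n - 1\<close>: at \<open>r = n\<close>
  there is no map with totally singular image, and the quotient would involve the nonexistent group
  O^-(0,q).\<close>

lemma involution_count:
  assumes V: "qtype \<epsilon> n V"
    and sp: "\<And>m. m \<le> n \<Longrightarrow> sp (2 * m) = spord m"
    and ort: "\<And>m. m \<le> n \<Longrightarrow> \<epsilon> = 1 \<or> m \<noteq> 0 \<Longrightarrow> int (ort (2 * m)) = oord \<epsilon> m"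
    and n: "n \<ge> 1"
    and l: "l = (if \<epsilon> = 1 then n else n - 1)"
  shows "real (card {g \<in> isos. \<forall>x. g (g x) = \<pi> x}) =
      (\<Sum>r | 0 \<le> r \<and> r \<le> l \<and> even r. real (ort (2 * n)) / real (A_coeff q n sp ort r)) +
      (\<Sum>r | 1 \<le> r \<and> r \<le> n \<and> even r. real (ort (2 * n)) / real (B_coeff q n sp r)) +
      (\<Sum>r | 1 \<le> r \<and> r \<le> n \<and> odd r. real (ort (2 * n)) / real (C_coeff q n sp r))"
proof -
  note T = involution_terms[OF V sp ort n]
  have cV: "card V = q ^ (2 * n)" and e: "\<epsilon> = 1 \<or> \<epsilon> = -1" using V by (auto simp: qtype_def)
  have "(\<Sum>r\<in>{0..n}. real (card (nil_sing r))) = (\<Sum>r | 0 \<le> r \<and> r \<le> l \<and> even r. real (card (nil_sing r)))"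
  proof (rule sum.mono_neutral_right)
    show "\<forall>r\<in>{0..n} - {r. 0 \<le> r \<and> r \<le> l \<and> even r}. real (card (nil_sing r)) = 0"
    proof
      fix r assume r: "r \<in> {0..n} - {r. 0 \<le> r \<and> r \<le> l \<and> even r}"
      then have "odd r \<or> (\<epsilon> = -1 \<and> r = n)" using l e by (auto split: if_splits)
      then have "nil_sing r = {}" using nil_sing_odd T(2) by blast
      then show "real (card (nil_sing r)) = 0" by simp
    qed
  qed (use l in auto)
  also have "\<dots> = (\<Sum>r | 0 \<le> r \<and> r \<le> l \<and> even r. real (ort (2 * n)) / real (A_coeff q n sp ort r))"
  proof (rule sum.cong[OF refl])
    fix r assume "r \<in> {r. 0 \<le> r \<and> r \<le> l \<and> even r}"
    then have "even r" "r \<le> n" "\<epsilon> = 1 \<or> r < n" using l n by (auto split: if_splits)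
    then show "real (card (nil_sing r)) = real (ort (2 * n)) / real (A_coeff q n sp ort r)" using T(1) by simp
  qed
  finally have S: "(\<Sum>r\<in>{0..n}. real (card (nil_sing r))) =
    (\<Sum>r | 0 \<le> r \<and> r \<le> l \<and> even r. real (ort (2 * n)) / real (A_coeff q n sp ort r))" .
  have split: "{1..n} = {r. 1 \<le> r \<and> r \<le> n \<and> even r} \<union> {r. 1 \<le> r \<and> r \<le> n \<and> odd r}" by auto
  have "(\<Sum>r\<in>{0..n}. real (card (nil_nonsing r))) = (\<Sum>r\<in>{1..n}. real (card (nil_nonsing r)))"
    using nil_nonsing_0 by (simp add: sum.atLeast_Suc_atMost[of 0])
  also have "\<dots> = (\<Sum>r | 1 \<le> r \<and> r \<le> n \<and> even r. real (card (nil_nonsing r))) +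
      (\<Sum>r | 1 \<le> r \<and> r \<le> n \<and> odd r. real (card (nil_nonsing r)))"
    unfolding split by (rule sum.union_disjoint) auto
  also have "(\<Sum>r | 1 \<le> r \<and> r \<le> n \<and> even r. real (card (nil_nonsing r))) =
      (\<Sum>r | 1 \<le> r \<and> r \<le> n \<and> even r. real (ort (2 * n)) / real (B_coeff q n sp r))"
    by (intro sum.cong refl T(3)[symmetric]) simp_all
  also have "(\<Sum>r | 1 \<le> r \<and> r \<le> n \<and> odd r. real (card (nil_nonsing r))) =
      (\<Sum>r | 1 \<le> r \<and> r \<le> n \<and> odd r. real (ort (2 * n)) / real (C_coeff q n sp r))"
    by (intro sum.cong refl T(4)[symmetric]) simp_all
  finally have X: "(\<Sum>r\<in>{0..n}. real (card (nil_nonsing r))) =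
    (\<Sum>r | 1 \<le> r \<and> r \<le> n \<and> even r. real (ort (2 * n)) / real (B_coeff q n sp r)) +
    (\<Sum>r | 1 \<le> r \<and> r \<le> n \<and> odd r. real (ort (2 * n)) / real (C_coeff q n sp r))" .
  have "real (card {g \<in> isos. \<forall>x. g (g x) = \<pi> x}) = (\<Sum>r\<in>{0..n}. real (card (nil_sing r))) + (\<Sum>r\<in>{0..n}. real (card (nil_nonsing r)))"
    unfolding card_involutions_nils card_nils[OF cV] by (simp add: sum.distrib)
  then show ?thesis unfolding S X by simp
qed

end

section \<open>Matrices\<close>

definition fun_scale :: "'a::times \<Rightarrow> (nat \<Rightarrow> 'a) \<Rightarrow> nat \<Rightarrow> 'a" where
  "fun_scale c x = (\<lambda>i. c * x i)"

definition trunc :: "nat \<Rightarrow> (nat \<Rightarrow> 'a::zero) \<Rightarrow> nat \<Rightarrow> 'a" where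
  "trunc d x = (\<lambda>i. if i < d then x i else 0)"

text \<open>Vectors of length \<open>d\<close>, continued by 0. Functions on \<open>nat\<close> form
  one abelian group for all \<open>d\<close>, which can be the ambient space;
  \<open>fun_space d\<close> then serves as \<open>V\<close> and \<open>trunc d\<close> as
  \<open>\<pi>\<close>.\<close>

definition fun_space :: "nat \<Rightarrow> (nat \<Rightarrow> 'a::zero) set" where
  "fun_space d = {x. \<forall>i\<ge>d. x i = 0}"

definition emb :: "nat \<Rightarrow> 'a::zero vec \<Rightarrow> nat \<Rightarrow> 'a" where
  "emb d v = (\<lambda>i. if i < d then v $ i else 0)"

lemma vec_emb [simp]: "v \<in> carrier_vec d \<Longrightarrow> vec d (emb d v) = v"
  by (auto simp: emb_def)

lemma emb_vec [simp]: "emb d (vec d x) = trunc d x"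
  by (auto simp: emb_def trunc_def)

lemma vec_trunc [simp]: "vec d (trunc d x) = vec d x"
  by (auto simp: trunc_def)

lemma vec_add: "vec d ((x :: nat \<Rightarrow> 'a::plus) + y) = vec d x + vec d y"
  by auto

lemma vec_fun_scale: "vec d (fun_scale c x) = c \<cdot>\<^sub>v vec d x"
  by (auto simp: fun_scale_def)

lemma emb_in [simp]: "emb d v \<in> fun_space d"
  by (simp add: emb_def fun_space_def)

lemma trunc_id: "x \<in> fun_space d \<Longrightarrow> trunc d x = x"
  by (auto simp: fun_space_def trunc_def fun_eq_iff)

lemma trunc_in [simp]: "trunc d x \<in> fun_space d"
  by (auto simp: fun_space_def trunc_def)

lemma trunc_add: "trunc d ((x :: nat \<Rightarrow> 'a::monoid_add) + y) = trunc d x + trunc d y"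
  by (auto simp: trunc_def)

lemma trunc_scale: "trunc d (fun_scale c x) = fun_scale c (trunc d (x :: nat \<Rightarrow> 'a::mult_zero))"
  by (auto simp: trunc_def fun_scale_def)

lemma emb_add: "v \<in> carrier_vec d \<Longrightarrow> w \<in> carrier_vec d \<Longrightarrow> emb d (v + w) = emb d v + emb d (w :: 'a::monoid_add vec)"
  by (auto simp: emb_def)

lemma emb_smult: "v \<in> carrier_vec d \<Longrightarrow> emb d (c \<cdot>\<^sub>v v) = fun_scale c (emb d (v :: 'a::mult_zero vec))"
  by (auto simp: emb_def fun_scale_def)

lemma fun_vector_space: "vector_space (fun_scale :: 'a::field \<Rightarrow> _)"
  by unfold_locales (auto simp: fun_scale_def algebra_simps fun_eq_iff)

lemma inj_emb: "inj_on (emb d) (carrier_vec d)"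
  by (rule inj_on_inverseI[of _ "vec d"]) simp

lemma fun_space_eq: "fun_space d = emb d ` carrier_vec d"
proof (intro equalityI subsetI)
  fix x :: "nat \<Rightarrow> 'a" assume "x \<in> fun_space d"
  then have "x = emb d (vec d x)" by (simp add: trunc_id)
  then show "x \<in> emb d ` carrier_vec d" by (rule image_eqI) simp
qed auto

lemma card_fun_space:
  "finite (fun_space d :: (nat \<Rightarrow> 'a::{zero,finite}) set)"
  "card (fun_space d :: (nat \<Rightarrow> 'a::{zero,finite}) set) = card (UNIV :: 'a set) ^ d"
proof -
  have b: "bij_betw (\<lambda>x. restrict x {..<d}) (fun_space d) ({..<d} \<rightarrow>\<^sub>E (UNIV :: 'a set))"
    by (rule bij_betw_byWitness[of _ "trunc d"])
      (auto simp: trunc_def fun_space_def fun_eq_iff PiE_def extensional_def)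
  show "finite (fun_space d :: (nat \<Rightarrow> 'a) set)"
    using bij_betw_finite[OF b] by (simp add: finite_PiE)
  show "card (fun_space d :: (nat \<Rightarrow> 'a) set) = card (UNIV :: 'a set) ^ d"
    using bij_betw_same_card[OF b] by (simp add: card_PiE)
qed

text \<open>Translation by 1 permutes the field. Comparing the sum of all \<open>x + 1\<close> with
  the sum of all \<open>x\<close> shows that the number of elements is 0 in the field.\<close>

lemma char_two_of_card:
  assumes "card (UNIV :: 'a::{field,finite} set) = 2 ^ k"
  shows "(1::'a) + 1 = 0"
proof -
  have "(\<Sum>x\<in>(UNIV :: 'a set). x + 1) = (\<Sum>x\<in>UNIV. x)"
    by (rule sum.reindex_bij_betw) (rule bij_betw_byWitness[of _ "\<lambda>x. x - 1"], auto)
  then have "of_nat (card (UNIV :: 'a set)) = (0::'a)" by (simp add: sum.distrib)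
  then have "(2::'a) ^ k = 0" unfolding assms by simp
  then have "(2::'a) = 0" by simp
  then show ?thesis by simp
qed

lemma mat_eqI_vec:
  fixes A C :: "'a::field mat"
  assumes "A \<in> carrier_mat m d" "C \<in> carrier_mat m d"
    and "\<And>v. v \<in> carrier_vec d \<Longrightarrow> A *\<^sub>v v = C *\<^sub>v v"
  shows "A = C"
proof (rule eq_matI)
  fix i j assume ij: "i < dim_row C" "j < dim_col C"
  have "(D *\<^sub>v unit_vec d j) $ i = D $$ (i, j)" if "D \<in> carrier_mat m d" for D :: "'a mat"
    using that ij assms(2) by simp
  then show "A $$ (i, j) = C $$ (i, j)" using assms by (metis unit_vec_carrier)
qed (use assms in auto)

section \<open>From matrices to maps on the function space\<close>

locale vec_form =
  fixes d q :: nat and \<beta> :: "'a::{field,finite} vec \<Rightarrow> 'a vec \<Rightarrow> 'a" and \<mu> :: "'a vec \<Rightarrow> 'a" and \<kappa> :: 'a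
  assumes char_two: "(1::'a) + 1 = 0" and card_UNIV: "card (UNIV :: 'a set) = q"
    and alternating: "alternating_form d \<beta>" and nondegenerate: "nondegenerate_form d \<beta>"
    and mu_add: "v \<in> carrier_vec d \<Longrightarrow> w \<in> carrier_vec d \<Longrightarrow> \<mu> (v + w) = \<mu> v + \<mu> w + \<kappa> * \<beta> v w"
    and mu_scale: "v \<in> carrier_vec d \<Longrightarrow> \<mu> (c \<cdot>\<^sub>v v) = c\<^sup>2 * \<mu> v"
begin

lemma bilinear: "bilinear_form d \<beta>"
  using alternating by (simp add: alternating_form_def)

lemma is_char2_space: "char2_space (fun_scale :: 'a \<Rightarrow> _) q"
  by (intro char2_space.intro fun_vector_space char2_space_axioms.intro char_two card_UNIV)

lemma is_bilin: "bilin (fun_scale :: 'a \<Rightarrow> _) q (\<lambda>x y. \<beta> (vec d x) (vec d y))"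
  by (intro bilin.intro is_char2_space bilin_axioms.intro)
    (use bilinear in \<open>auto simp: bilinear_form_def vec_add vec_fun_scale\<close>)

sublocale isometry_space "fun_scale :: 'a \<Rightarrow> _" q "\<lambda>x y. \<beta> (vec d x) (vec d y)"
  "\<lambda>x. \<mu> (vec d x)" \<kappa> "fun_space d" "trunc d"
proof -
  interpret bilin "fun_scale :: 'a \<Rightarrow> _" q "\<lambda>x y. \<beta> (vec d x) (vec d y)" by (rule is_bilin)
  have sub: "subspace (fun_space d)"
    by (auto simp: subspace_def fun_space_def fun_scale_def)
  have self: "\<beta> (vec d x) (vec d x) = 0" for x
    using alternating by (simp add: alternating_form_def)
  have sym: "\<beta> (vec d x) (vec d y) = \<beta> (vec d y) (vec d x)" for x y
    using alt_sym[of UNIV x y] self by (simp add: alt_def)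
  have nd: "nondeg (fun_space d)"
    unfolding nondeg_def
  proof (intro ballI impI)
    fix w :: "nat \<Rightarrow> 'a" assume w: "w \<in> fun_space d" and h: "\<forall>v\<in>fun_space d. \<beta> (vec d v) (vec d w) = 0"
    have "\<beta> (vec d w) v = 0" if v: "v \<in> carrier_vec d" for v
      using h[rule_format, of "emb d v"] sym[of w "emb d v"] v by simp
    then have "vec d w = 0\<^sub>v d" using nondegenerate by (simp add: nondegenerate_form_def)
    then have "trunc d w = emb d (0\<^sub>v d)" by (metis emb_vec)
    then show "w = 0" using w by (auto simp: trunc_id emb_def)
  qed
  show "isometry_space (fun_scale :: 'a \<Rightarrow> _) q (\<lambda>x y. \<beta> (vec d x) (vec d y)) (\<lambda>x. \<mu> (vec d x)) \<kappa> (fun_space d) (trunc d)"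
  proof (intro isometry_space.intro is_bilin isometry_space_axioms.intro)
    show "finite (fun_space d :: (nat \<Rightarrow> 'a) set)" by (rule card_fun_space(1))
  qed (use sub nd self in \<open>auto simp: vec_add vec_fun_scale mu_add mu_scale trunc_id trunc_add trunc_scale\<close>)
qed

lemma card_V: "card (fun_space d :: (nat \<Rightarrow> 'a) set) = q ^ d"
  using card_fun_space(2) card_UNIV by metis

definition isometry_mats :: "'a mat set" where
  "isometry_mats = {g \<in> carrier_mat d d.
     (\<forall>v\<in>carrier_vec d. \<forall>w\<in>carrier_vec d. \<beta> (g *\<^sub>v v) (g *\<^sub>v w) = \<beta> v w) \<and>
     (\<forall>v\<in>carrier_vec d. \<mu> (g *\<^sub>v v) = \<mu> v)}"

definition act :: "'a mat \<Rightarrow> (nat \<Rightarrow> 'a) \<Rightarrow> nat \<Rightarrow> 'a" where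
  "act g x = emb d (g *\<^sub>v vec d x)"

text \<open>A vector in the kernel would pair to 0 with everything. So \<open>isometry_mats\<close>
  agrees with the groups whose definitions demand invertibility.\<close>

lemma isometry_mats_invertible:
  assumes "g \<in> carrier_mat d d" "\<forall>v\<in>carrier_vec d. \<forall>w\<in>carrier_vec d. \<beta> (g *\<^sub>v v) (g *\<^sub>v w) = \<beta> v w"
  shows "invertible_mat g"
proof -
  have "det g \<noteq> 0"
  proof
    assume "det g = 0"
    then obtain v where v: "v \<in> carrier_vec d" "v \<noteq> 0\<^sub>v d" "g *\<^sub>v v = 0\<^sub>v d"
      using det_0_iff_vec_prod_zero_field[OF assms(1)] by blast
    have "\<beta> v w = 0" if w: "w \<in> carrier_vec d" for w
    proof -
      have "\<beta> v w = \<beta> (g *\<^sub>v v) (g *\<^sub>v w)" by (rule assms(2)[rule_format, OF v(1) w, symmetric])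
      \<comment> \<open>The zero vector is written as a multiple of itself so that homogeneity of
        \<open>\<beta>\<close> applies.\<close>
      also have "\<dots> = \<beta> (0 \<cdot>\<^sub>v 0\<^sub>v d) (g *\<^sub>v w)"
      proof -
        have "0 \<cdot>\<^sub>v 0\<^sub>v d = (0\<^sub>v d :: 'a vec)" by (rule eq_vecI) auto
        then show ?thesis using v(3) by simp
      qed
      also have "\<dots> = 0" using bilinear w assms(1) unfolding bilinear_form_def
        by (metis mult_zero_left mult_mat_vec_carrier zero_carrier_vec)
      finally show ?thesis .
    qed
    then show False using nondegenerate v by (simp add: nondegenerate_form_def)
  qed
  then have "g \<in> Units (ring_mat TYPE('a) d ())" by (rule det_non_zero_imp_unit[OF assms(1)])
  then obtain h where "h \<in> carrier_mat d d" "h * g = 1\<^sub>m d" "g * h = 1\<^sub>m d"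
    by (auto simp: Units_def ring_mat_def)
  then show ?thesis using assms(1) unfolding invertible_mat_def inverts_mat_def
    by (intro conjI exI[of _ h]) auto
qed

lemma act_vec: "g \<in> carrier_mat d d \<Longrightarrow> vec d (act g x) = g *\<^sub>v vec d x"
  unfolding act_def by (rule vec_emb) (auto intro: mult_mat_vec_carrier)

lemma act_bij: "bij_betw act isometry_mats isos"
proof (intro bij_betwI')
  fix g h assume g: "g \<in> isometry_mats" and h: "h \<in> isometry_mats"
  show "(act g = act h) = (g = h)"
  proof
    assume eq: "act g = act h"
    show "g = h"
    proof (rule mat_eqI_vec)
      fix v :: "'a vec" assume v: "v \<in> carrier_vec d"
      have "vec d (act g (emb d v)) = vec d (act h (emb d v))" using eq by simp
      then show "g *\<^sub>v v = h *\<^sub>v v" using g h v by (simp add: act_vec isometry_mats_def)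
    qed (use g h in \<open>auto simp: isometry_mats_def\<close>)
  qed simp
next
  fix g assume "g \<in> isometry_mats"
  then have g: "g \<in> carrier_mat d d"
    "\<And>v w. v \<in> carrier_vec d \<Longrightarrow> w \<in> carrier_vec d \<Longrightarrow> \<beta> (g *\<^sub>v v) (g *\<^sub>v w) = \<beta> v w"
    "\<And>v. v \<in> carrier_vec d \<Longrightarrow> \<mu> (g *\<^sub>v v) = \<mu> v" by (auto simp: isometry_mats_def)
  have c: "g *\<^sub>v vec d x \<in> carrier_vec d" for x using g(1) by (auto intro: mult_mat_vec_carrier)
  have "act g (x + y) = act g x + act g y" for x y
    unfolding act_def vec_add using g(1) c by (simp add: mult_add_distrib_mat_vec[of g d d] emb_add)
  moreover have "act g (fun_scale a x) = fun_scale a (act g x)" for a x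
    unfolding act_def vec_fun_scale using g(1) c by (simp add: mult_mat_vec[of g d d] emb_smult)
  ultimately show "act g \<in> isos"
    unfolding isos_def using g by (auto simp: act_vec) (auto simp: act_def)
next
  fix f assume "f \<in> isos"
  then have f: "\<And>x y. f (x + y) = f x + f y" "\<And>c x. f (fun_scale c x) = fun_scale c (f x)"
    "\<And>x. f (trunc d x) = f x" "\<And>x. f x \<in> fun_space d"
    "\<And>x y. \<beta> (vec d (f x)) (vec d (f y)) = \<beta> (vec d x) (vec d y)" "\<And>x. \<mu> (vec d (f x)) = \<mu> (vec d x)"
    by (auto simp: isos_def)
  define e where "e j = emb d (unit_vec d j :: 'a vec)" for j
  define g where "g = mat d d (\<lambda>(i, j). f (e j) i)"
  have g: "g \<in> carrier_mat d d" by (simp add: g_def)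
  have f0: "f 0 = 0" using f(1)[of 0 0] by simp
  have fs: "f (\<Sum>j\<in>J. fun_scale (x j) (e j)) = (\<Sum>j\<in>J. fun_scale (x j) (f (e j)))" if "finite J" for J x
    using that by (induction J rule: finite_induct) (simp_all only: sum.empty sum.insert f f0 not_False_eq_True)
  have sum_fun: "(\<Sum>j\<in>J. h j) i = (\<Sum>j\<in>J. h j i)" for h :: "nat \<Rightarrow> nat \<Rightarrow> 'a" and J i
    by (induction J rule: infinite_finite_induct) auto
  have tr: "trunc d x = (\<Sum>j<d. fun_scale (x j) (e j))" for x :: "nat \<Rightarrow> 'a"
  proof
    fix i
    show "trunc d x i = (\<Sum>j<d. fun_scale (x j) (e j)) i"
    proof (cases "i < d")
      case True
      have "(\<Sum>j<d. fun_scale (x j) (e j)) i = (\<Sum>j<d. if j = i then x j else 0)"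
        unfolding sum_fun by (rule sum.cong) (use True in \<open>auto simp: fun_scale_def e_def emb_def unit_vec_def\<close>)
      then show ?thesis using True by (simp add: trunc_def)
    next
      case False
      then show ?thesis by (simp add: sum_fun trunc_def fun_scale_def e_def emb_def)
    qed
  qed
  have gv: "g *\<^sub>v vec d x = vec d (f x)" for x
  proof (rule eq_vecI)
    fix i assume "i < dim_vec (vec d (f x))"
    then have i: "i < d" by simp
    have "f x = (\<Sum>j<d. fun_scale (x j) (f (e j)))" using f(3)[of x] fs[of "{..<d}" x] unfolding tr by simp
    then have "f x i = (\<Sum>j<d. x j * f (e j) i)" by (simp add: sum_fun fun_scale_def)
    moreover have "(g *\<^sub>v vec d x) $ i = (\<Sum>j<d. f (e j) i * x j)"
      using i by (simp add: g_def scalar_prod_def lessThan_atLeast0)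
    ultimately show "(g *\<^sub>v vec d x) $ i = vec d (f x) $ i" using i by (simp add: mult.commute)
  qed (simp add: g_def)
  have gv': "g *\<^sub>v v = vec d (f (emb d v))" if "v \<in> carrier_vec d" for v
    using gv[of "emb d v"] that by simp
  have "g \<in> isometry_mats"
    unfolding isometry_mats_def using g by (auto simp: gv' f)
  moreover have "f = act g"
    by (rule ext) (simp add: act_def gv trunc_id f)
  ultimately show "\<exists>g\<in>isometry_mats. f = act g" by blast
qed

lemma card_isometry_mats: "card isometry_mats = card isos"
  by (rule bij_betw_same_card[OF act_bij])

lemma card_isometry_mats_involutions:
  "card (involutions d isometry_mats) = card {g \<in> isos. \<forall>x. g (g x) = trunc d x}"
proof (rule bij_betw_same_card[of act])
  have iff: "g * g = 1\<^sub>m d \<longleftrightarrow> (\<forall>x. act g (act g x) = trunc d x)" if "g \<in> isometry_mats" for g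
  proof -
    have g: "g \<in> carrier_mat d d" using that by (simp add: isometry_mats_def)
    have a: "act g (act g x) = emb d ((g * g) *\<^sub>v vec d x)" for x
      using g act_vec[OF g] by (simp add: act_def[of g "act g x"] assoc_mult_mat_vec[of g d d g d])
    show ?thesis
    proof
      assume "g * g = 1\<^sub>m d"
      then show "\<forall>x. act g (act g x) = trunc d x" by (simp add: a)
    next
      assume h: "\<forall>x. act g (act g x) = trunc d x"
      show "g * g = 1\<^sub>m d"
      proof (rule mat_eqI_vec)
        fix v :: "'a vec" assume v: "v \<in> carrier_vec d"
        have "emb d ((g * g) *\<^sub>v v) = emb d v"
          using h[rule_format, of "emb d v"] v trunc_id[OF emb_in] unfolding a by simp
        then have "vec d (emb d ((g * g) *\<^sub>v v)) = vec d (emb d v)" by simp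
        then show "(g * g) *\<^sub>v v = 1\<^sub>m d *\<^sub>v v" using v g by (simp add: mult_mat_vec_carrier[of _ d d])
      qed (use g in auto)
    qed
  qed
  show "bij_betw act (involutions d isometry_mats) {g \<in> isos. \<forall>x. g (g x) = trunc d x}"
  proof -
    have "act ` involutions d isometry_mats = {g \<in> isos. \<forall>x. g (g x) = trunc d x}"
    proof (intro equalityI subsetI)
      fix f assume "f \<in> {g \<in> isos. \<forall>x. g (g x) = trunc d x}"
      moreover from this obtain g where "g \<in> isometry_mats" "f = act g"
        using act_bij unfolding bij_betw_def by blast
      ultimately show "f \<in> act ` involutions d isometry_mats" using iff by (auto simp: involutions_def)
    qed (use iff act_bij in \<open>auto simp: bij_betw_def involutions_def\<close>)
    moreover have "inj_on act (involutions d isometry_mats)"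
      using act_bij unfolding bij_betw_def involutions_def by (auto intro: inj_on_subset)
    ultimately show ?thesis by (simp add: bij_betw_def)
  qed
qed

end

section \<open>Dimensions of subspaces and types of forms\<close>

lemma vec_subspace_iff:
  "VectorSpace.subspace class_ring W (module_vec TYPE('a::field) d) \<longleftrightarrow>
     W \<subseteq> carrier_vec d \<and> 0\<^sub>v d \<in> W \<and> (\<forall>v\<in>W. \<forall>w\<in>W. v + w \<in> W) \<and> (\<forall>c. \<forall>v\<in>W. c \<cdot>\<^sub>v v \<in> W)"
  using vec_vs[of d] vec_module[of d]
  by (auto simp: VectorSpace.subspace_def submodule_def module_vec_def)

text \<open>Coordinates in a basis identify \<open>W\<close> with the functions from the basis to
  the field. From here on, dimensions appear only as exponents of cardinalities.\<close>

lemma card_subspace_dim: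
  fixes W :: "'a::{field,finite} vec set"
  assumes W: "VectorSpace.subspace class_ring W (module_vec TYPE('a) d)"
  shows "card W = card (UNIV :: 'a set) ^ subspace_dim d W"
proof -
  let ?M = "(module_vec TYPE('a) d)\<lparr>carrier := W\<rparr>"
  interpret v: vectorspace "class_ring :: 'a ring" "module_vec TYPE('a) d" by (rule vec_vs)
  interpret w: vectorspace "class_ring :: 'a ring" ?M by (rule v.subspace_is_vs[OF W])
  have "W \<subseteq> carrier_vec d" using W by (simp add: vec_subspace_iff)
  moreover have "finite (carrier_vec d :: 'a vec set)"
    using card_fun_space(1)[where ?'a = 'a and d = d] inj_emb unfolding fun_space_eq by (rule finite_imageD)
  ultimately have fW: "finite W" by (rule finite_subset)
  have "w.fin_dim"
    unfolding w.fin_dim_def using fW w.in_own_span[of W] w.span_is_subset2[of W] by (intro exI[of _ W]) auto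
  then obtain b where b: "finite b" "w.basis b" using w.finite_basis_exists by blast
  then have bW: "b \<subseteq> carrier ?M" by (simp add: w.basis_def)
  have ex1: "\<exists>!a. a \<in> b \<rightarrow>\<^sub>E UNIV \<and> w.lincomb a b = v" if "v \<in> W" for v
    using w.basis_criterion[OF b(1) bW] b(2) that by simp
  have "bij_betw (\<lambda>a. w.lincomb a b) (b \<rightarrow>\<^sub>E UNIV) W"
  proof (rule bij_betwI')
    have cl: "w.lincomb a b \<in> W" for a using w.lincomb_closed[OF bW, of a] by simp
    fix x y assume xy: "x \<in> b \<rightarrow>\<^sub>E (UNIV :: 'a set)" "y \<in> b \<rightarrow>\<^sub>E (UNIV :: 'a set)"
    show "(w.lincomb x b = w.lincomb y b) = (x = y)"
    proof
      assume eq: "w.lincomb x b = w.lincomb y b"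
      define P where "P a \<longleftrightarrow> a \<in> b \<rightarrow>\<^sub>E UNIV \<and> w.lincomb a b = w.lincomb x b" for a
      have "\<exists>!a. P a" unfolding P_def by (rule ex1[OF cl])
      moreover have "P x" "P y" unfolding P_def using xy eq by (simp_all only: simp_thms)
      ultimately show "x = y" by blast
    qed simp
    show "w.lincomb x b \<in> W" by (rule cl)
  next
    fix v assume "v \<in> W"
    from ex1_implies_ex[OF ex1[OF this]] obtain a where "a \<in> b \<rightarrow>\<^sub>E UNIV \<and> w.lincomb a b = v" ..
    then show "\<exists>a\<in>b \<rightarrow>\<^sub>E UNIV. v = w.lincomb a b" by (intro bexI[of _ a]) simp_all
  qed
  then have "card W = card (b \<rightarrow>\<^sub>E (UNIV :: 'a set))" using bij_betw_same_card by metis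
  then show ?thesis using b w.dim_basis by (simp add: card_PiE subspace_dim_def)
qed

locale orthogonal_form =
  fixes d q :: nat and \<nu> :: "'a::{field,finite} vec \<Rightarrow> 'a"
  assumes char_two: "(1::'a) + 1 = 0" and card_UNIV: "card (UNIV :: 'a set) = q"
    and nondegenerate_quadratic: "nondegenerate_quadratic_form d \<nu>"
begin

lemma is_vec_form: "vec_form d q (assoc_form \<nu>) \<nu> 1"
proof -
  have s: "x + x = 0" for x :: 'a
    by (metis char_two distrib_left mult.right_neutral mult_zero_right)
  have quad: "quadratic_form d \<nu>" "nondegenerate_form d (assoc_form \<nu>)"
    using nondegenerate_quadratic by (auto simp: nondegenerate_quadratic_form_def)
  have sc: "\<nu> (c \<cdot>\<^sub>v v) = c\<^sup>2 * \<nu> v" if "v \<in> carrier_vec d" for c v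
    using quad that by (simp add: quadratic_form_def)
  have "assoc_form \<nu> v v = 0" if v: "v \<in> carrier_vec d" for v
  proof -
    \<comment> \<open>Homogeneity gives \<open>\<nu> (v + v)\<close> the value 0, and the two
      remaining terms of \<open>assoc_form \<nu> v v\<close> cancel.\<close>
    have "v + v = 0 \<cdot>\<^sub>v v" using v s by (intro eq_vecI) auto
    then have "\<nu> (v + v) = 0" using sc[OF v, of 0] by simp
    then show ?thesis using s[of "\<nu> v"] by (simp add: assoc_form_def)
  qed
  then have "alternating_form d (assoc_form \<nu>)"
    using quad by (simp add: alternating_form_def quadratic_form_def)
  moreover have "\<nu> (v + w) = \<nu> v + \<nu> w + 1 * assoc_form \<nu> v w" for v w
  proof -
    have "\<nu> v + \<nu> w + 1 * assoc_form \<nu> v w = \<nu> (v + w) + ((\<nu> v + \<nu> v) + (\<nu> w + \<nu> w))"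
      unfolding assoc_form_def by (simp only: mult_1 ac_simps)
    then show ?thesis unfolding s by simp
  qed
  ultimately show ?thesis
    by (intro vec_form.intro) (use char_two card_UNIV quad sc in auto)
qed

sublocale vec_form d q "assoc_form \<nu>" \<nu> 1 by (rule is_vec_form)

sublocale orthogonal_space "fun_scale :: 'a \<Rightarrow> _" q "\<lambda>x y. assoc_form \<nu> (vec d x) (vec d y)"
  "\<lambda>x. \<nu> (vec d x)" "fun_space d" "trunc d"
  by (intro orthogonal_space.intro isometry_space_axioms)

lemma orthogonal_group_eq: "orthogonal_group d \<nu> = isometry_mats"
proof (intro equalityI subsetI)
  fix g assume "g \<in> orthogonal_group d \<nu>"
  then have g: "g \<in> carrier_mat d d" "\<And>v. v \<in> carrier_vec d \<Longrightarrow> \<nu> (g *\<^sub>v v) = \<nu> v"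
    by (auto simp: orthogonal_group_def)
  have "assoc_form \<nu> (g *\<^sub>v v) (g *\<^sub>v w) = assoc_form \<nu> v w"
    if "v \<in> carrier_vec d" "w \<in> carrier_vec d" for v w
    unfolding assoc_form_def using g that by (simp flip: mult_add_distrib_mat_vec)
  then show "g \<in> isometry_mats" using g by (simp add: isometry_mats_def)
next
  fix g assume g: "g \<in> isometry_mats"
  then have "invertible_mat g" by (intro isometry_mats_invertible) (auto simp: isometry_mats_def)
  then show "g \<in> orthogonal_group d \<nu>" using g by (simp add: isometry_mats_def orthogonal_group_def)
qed

lemma card_involutions:
  "card (involutions d (orthogonal_group d \<nu>)) = card {g \<in> isos. \<forall>x. g (g x) = trunc d x}"
  unfolding orthogonal_group_eq by (rule card_isometry_mats_involutions)

lemma card_V2: "d = 2 * m \<Longrightarrow> card (fun_space d :: (nat \<Rightarrow> 'a) set) = q ^ (2 * m)"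
  using card_V by simp

lemma plus_qtype:
  assumes "plus_type d \<nu>" and d: "d = 2 * m"
  shows "qtype 1 m (fun_space d)"
proof -
  obtain W where W: "totally_singular_subspace d \<nu> W" "2 * subspace_dim d W = d"
    using assms by (auto simp: plus_type_def)
  then have sW: "VectorSpace.subspace class_ring W (module_vec TYPE('a) d)" "\<And>w. w \<in> W \<Longrightarrow> \<nu> w = 0"
    by (auto simp: totally_singular_subspace_def)
  then have W': "W \<subseteq> carrier_vec d" "0\<^sub>v d \<in> W" "\<And>v w. v \<in> W \<Longrightarrow> w \<in> W \<Longrightarrow> v + w \<in> W"
    "\<And>c v. v \<in> W \<Longrightarrow> c \<cdot>\<^sub>v v \<in> W" by (auto simp: vec_subspace_iff)
  have cW: "card W = q ^ m" using card_subspace_dim[OF sW(1)] W(2) d card_UNIV by simp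
  show ?thesis
  proof (rule plus_type_witness[OF finV subV ndV card_V2[OF d]])
    show "subspace (emb d ` W)"
      unfolding subspace_def
    proof (intro conjI ballI allI)
      have "emb d (0\<^sub>v d) = (0 :: nat \<Rightarrow> 'a)" by (auto simp: emb_def)
      then show "0 \<in> emb d ` W" using W'(2) by (metis imageI)
    next
      fix x y assume "x \<in> emb d ` W" "y \<in> emb d ` W"
      then obtain v w where "x = emb d v" "y = emb d w" "v \<in> W" "w \<in> W" by blast
      then show "x + y \<in> emb d ` W" using W' by (auto simp: emb_add[symmetric] subset_iff)
    next
      fix c x assume "x \<in> emb d ` W"
      then obtain v where "x = emb d v" "v \<in> W" by blast
      then show "fun_scale c x \<in> emb d ` W" using W' by (auto simp: emb_smult[symmetric] subset_iff)
    qed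
    show "emb d ` W \<subseteq> fun_space d" by auto
    show "\<nu> (vec d w) = 0" if "w \<in> emb d ` W" for w using that sW(2) W'(1) by (auto simp: subset_iff)
    show "card (emb d ` W) = q ^ m"
      using cW card_image[OF inj_on_subset[OF inj_emb W'(1)]] by simp
  qed
qed

lemma minus_qtype:
  assumes "minus_type d \<nu>" and d: "d = 2 * m"
  shows "qtype (-1) m (fun_space d)"
proof (rule ccontr)
  assume "\<not> qtype (-1) m (fun_space d)"
  then obtain U where U: "subspace U" "U \<subseteq> fun_space d" "\<forall>u\<in>U. \<nu> (vec d u) = 0" "card U = q ^ m"
    using minus_type_or_witness[OF finV subV ndV card_V2[OF d]] by blast
  let ?W = "vec d ` U"
  have 0: "vec d (0 :: nat \<Rightarrow> 'a) = 0\<^sub>v d" by (auto simp: vec_eq_iff)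
  have W: "VectorSpace.subspace class_ring ?W (module_vec TYPE('a) d)"
    unfolding vec_subspace_iff
  proof (intro conjI ballI allI)
    show "?W \<subseteq> carrier_vec d" by auto
    show "0\<^sub>v d \<in> ?W" using subspace_0[OF U(1)] 0 by (metis imageI)
  next
    fix v w assume "v \<in> ?W" "w \<in> ?W"
    then obtain x y where "v = vec d x" "w = vec d y" "x \<in> U" "y \<in> U" by blast
    then show "v + w \<in> ?W" using subspace_add[OF U(1)] vec_add by (metis imageI)
  next
    fix c v assume "v \<in> ?W"
    then obtain x where "v = vec d x" "x \<in> U" by blast
    then show "c \<cdot>\<^sub>v v \<in> ?W" using subspace_scale[OF U(1)] vec_fun_scale by (metis imageI)
  qed
  have "inj_on (vec d) U"
    using U(2) by (intro inj_on_inverseI[of _ "emb d"]) (auto simp: trunc_id)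
  then have "card ?W = q ^ m" using U(4) by (simp add: card_image)
  then have "q ^ subspace_dim d ?W = q ^ m" using card_subspace_dim[OF W] card_UNIV by simp
  then have "subspace_dim d ?W = m" by simp
  moreover have "totally_singular_subspace d \<nu> ?W"
    using W U(3) by (auto simp: totally_singular_subspace_def)
  ultimately show False using assms by (auto simp: minus_type_def)
qed

lemma card_orthogonal_group:
  assumes "qtype \<epsilon> m (fun_space d)" "\<epsilon> = 1 \<or> m \<noteq> 0"
  shows "int (card (orthogonal_group d \<nu>)) = oord \<epsilon> m"
  unfolding orthogonal_group_eq card_isometry_mats by (rule card_isos_orthogonal[OF assms])

end

text \<open>The instance of \<open>vec_form\<close> with zero quadratic form and
  \<open>\<kappa> = 0\<close>, in which the condition on \<open>\<mu>\<close> is void.\<close>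

lemma card_symplectic_group:
  fixes \<beta> :: "'a::{field,finite} vec \<Rightarrow> 'a vec \<Rightarrow> 'a"
  assumes "(1::'a) + 1 = 0" "card (UNIV :: 'a set) = q" "alternating_form d \<beta>" "nondegenerate_form d \<beta>" "d = 2 * m"
  shows "card (symplectic_group d \<beta>) = bilin.spord q m"
proof -
  interpret vec_form d q \<beta> "\<lambda>_. 0" 0 by unfold_locales (use assms in auto)
  have "symplectic_group d \<beta> = isometry_mats"
    using isometry_mats_invertible by (auto simp: symplectic_group_def isometry_mats_def)
  then show ?thesis using card_isometry_mats card_isos_symplectic[of m] card_V assms(5) by simp
qed

text \<open>The coefficients involve groups of several dimensions at once, so one form is fixed in
  each even dimension; it may be any form of its kind. The minus forms start in dimension 2, as
  there is none in dimension 0.\<close>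

theorem theorem5p6:
  fixes q k n :: nat
    and \<beta> :: "nat \<Rightarrow> 'a::{field,finite} vec \<Rightarrow> 'a vec \<Rightarrow> 'a"
    and \<nu>p \<nu>m :: "nat \<Rightarrow> 'a vec \<Rightarrow> 'a"
  assumes "card (UNIV :: 'a set) = q" and "q = 2 ^ k" and "k \<ge> 1" and "n \<ge> 1"
    and "\<And>d. even d \<Longrightarrow> d \<le> 2 * n \<Longrightarrow> alternating_form d (\<beta> d) \<and> nondegenerate_form d (\<beta> d)"
    and "\<And>d. even d \<Longrightarrow> d \<le> 2 * n \<Longrightarrow> plus_type d (\<nu>p d)"
    and "\<And>d. even d \<Longrightarrow> 2 \<le> d \<Longrightarrow> d \<le> 2 * n \<Longrightarrow> minus_type d (\<nu>m d)"
  shows "let sp = (\<lambda>d. card (symplectic_group d (\<beta> d)));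
             op = (\<lambda>d. card (orthogonal_group d (\<nu>p d)));
             om = (\<lambda>d. card (orthogonal_group d (\<nu>m d)))
         in
           real (card (involutions (2 * n) (orthogonal_group (2 * n) (\<nu>p (2 * n))))) =
             (\<Sum>r | 0 \<le> r \<and> r \<le> n \<and> even r. real (op (2 * n)) / real (A_coeff q n sp op r)) +
             (\<Sum>r | 1 \<le> r \<and> r \<le> n \<and> even r. real (op (2 * n)) / real (B_coeff q n sp r)) +
             (\<Sum>r | 1 \<le> r \<and> r \<le> n \<and> odd r. real (op (2 * n)) / real (C_coeff q n sp r)) \<and>
           real (card (involutions (2 * n) (orthogonal_group (2 * n) (\<nu>m (2 * n))))) =
             (\<Sum>r | 0 \<le> r \<and> r \<le> n - 1 \<and> even r. real (om (2 * n)) / real (A_coeff q n sp om r)) +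
             (\<Sum>r | 1 \<le> r \<and> r \<le> n \<and> even r. real (om (2 * n)) / real (B_coeff q n sp r)) +
             (\<Sum>r | 1 \<le> r \<and> r \<le> n \<and> odd r. real (om (2 * n)) / real (C_coeff q n sp r))"
proof -
  let ?sp = "\<lambda>d. card (symplectic_group d (\<beta> d))"
  let ?op = "\<lambda>d. card (orthogonal_group d (\<nu>p d))" and ?om = "\<lambda>d. card (orthogonal_group d (\<nu>m d))"
  have two: "(1::'a) + 1 = 0" using char_two_of_card assms(1,2) by blast
  have sp: "?sp (2 * m) = bilin.spord q m" if "m \<le> n" for m
    using that assms(5)[of "2 * m"] by (intro card_symplectic_group two assms(1)) auto
  have plus: "orthogonal_form (2 * m) q (\<nu>p (2 * m))" if "m \<le> n" for m
    using assms(1) assms(6)[of "2 * m"] two that by (intro orthogonal_form.intro) (auto simp: plus_type_def)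
  have minus: "orthogonal_form (2 * m) q (\<nu>m (2 * m))" if "m \<le> n" "m \<noteq> 0" for m
    using assms(1) assms(7)[of "2 * m"] two that by (intro orthogonal_form.intro) (auto simp: minus_type_def)
  have op: "int (?op (2 * m)) = quad.oord q 1 m" if "m \<le> n" for m
  proof -
    interpret orthogonal_form "2 * m" q "\<nu>p (2 * m)" by (rule plus[OF that])
    have "qtype 1 m (fun_space (2 * m))" using assms(6)[of "2 * m"] that by (intro plus_qtype) auto
    then show ?thesis by (intro card_orthogonal_group) auto
  qed
  have om: "int (?om (2 * m)) = quad.oord q (-1) m" if "m \<le> n" "m \<noteq> 0" for m
  proof -
    interpret orthogonal_form "2 * m" q "\<nu>m (2 * m)" by (rule minus[OF that])
    have "qtype (-1) m (fun_space (2 * m))" using assms(7)[of "2 * m"] that by (intro minus_qtype) auto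
    then show ?thesis using that by (intro card_orthogonal_group) auto
  qed
  show ?thesis
    unfolding Let_def
  proof (rule conjI, goal_cases)
    case 1
    interpret orthogonal_form "2 * n" q "\<nu>p (2 * n)" by (rule plus) simp
    have "qtype 1 n (fun_space (2 * n))" using assms(6)[of "2 * n"] by (intro plus_qtype) auto
    from involution_count[where sp = ?sp and ort = ?op, OF this sp op assms(4) refl]
    show ?case unfolding card_involutions by simp
  next
    case 2
    interpret orthogonal_form "2 * n" q "\<nu>m (2 * n)" by (rule minus) (use assms(4) in auto)
    have "qtype (-1) n (fun_space (2 * n))" using assms(4) assms(7)[of "2 * n"] by (intro minus_qtype) auto
    \<comment> \<open>The premise on \<open>ort\<close> is left open: its condition
      \<open>\<epsilon> = 1 \<or> m \<noteq> 0\<close> first has to be simplified to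
      \<open>m \<noteq> 0\<close>, the form in which \<open>om\<close> is stated.\<close>
    from involution_count[where sp = ?sp and ort = ?om, OF this sp _ assms(4) refl]
    show ?case unfolding card_involutions using om by simp
  qed
qed

end
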